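(* Let $\mu\ge\nu\ge-1$ be integers of the same parity, not both equal to $-1$, let $j\in\{0,1,2,\ldots\}$, and let $u$ be an $L^2$-solution of the differential equation $D_{\mu,\nu}u=4j(j+\mu+1)u$ on $(0,\infty)$. Then there exists a constant $A_j^{\mu,\nu}(u)$ such that for all real $\vartheta,\varphi$ with $\cos\vartheta+\cos\varphi>0$, setting $a:=\frac{\sin\vartheta}{\cos\vartheta+\cos\varphi}$ and $b:=\frac{\sin\varphi}{\cos\vartheta+\cos\varphi}$, one has $$\int_0^\infty u(x)\,\widetilde{J}_{\frac{\mu}{2}}(ax)\,\widetilde{J}_{\frac{\nu}{2}}(bx)\,x^{\mu+\nu+1}\,\mathrm{d}x = A_j^{\mu,\nu}(u)\left(\frac{\cos\vartheta+\cos\varphi}{2}\right)^{\frac{\mu+\nu+2}{2}}\widetilde{C}_j^{\frac{\mu+1}{2}}(\cos\vartheta)\,\widetilde{C}_{j+\frac{\mu-\nu}{2}}^{\frac{\nu+1}{2}}(\cos\varphi).$$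
   Context: Let $\theta=x\frac{\mathrm{d}}{\mathrm{d}x}$. The fourth order differential operator is $D_{\mu,\nu}=\frac{1}{x^2}\left((\theta+\mu)(\theta+\mu+\nu)-x^2\right)\left(\theta(\theta+\nu)-x^2\right)$. $L^2$-solutions: it is known that (for $\mu,\nu$ as in the claim) $D_{\mu,\nu}$ extends to a self-adjoint operator on $L^2(\mathbb{R}_+,x^{\mu+\nu+1}\mathrm{d}x)$, $\mathbb{R}_+=(0,\infty)$, with purely discrete spectrum $\lambda_j^{\mu,\nu}=4j(j+\mu+1)$, $j=0,1,2,\ldots$, and one-dimensional eigenspaces. An "$L^2$-solution" of $D_{\mu,\nu}u=\lambda_j^{\mu,\nu}u$ is an element of the corresponding eigenspace. It is known that this eigenspace is spanned by the real analytic function $\Lambda_j^{\mu,\nu}$ on $\mathbb{R}_+$ defined by the power series expansion in $t$ around $t=0$ $$\frac{1}{(1-t)^{\frac{\mu+\nu+2}{2}}}\widetilde{I}_{\frac{\mu}{2}}\left(\frac{tx}{1-t}\right)\widetilde{K}_{\frac{\nu}{2}}\left(\frac{x}{1-t}\right)=\sum_{j=0}^\infty\Lambda_j^{\mu,\nu}(x)t^j,$$ so the $L^2$-solutions are exactly the scalar multiples of $\Lambda_j^{\mu,\nu}$. Normalized special functions: $\widetilde{J}_\alpha(z)=(\frac z2)^{-\alpha}J_\alpha(z)$ (extended to an even entire function), $\widetilde{I}_\alpha(z)=(\frac z2)^{-\alpha}I_\alpha(z)$ (likewise extended), $\widetilde{K}_\alpha(z)=(\frac z2)^{-\alpha}K_\alpha(z)$,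 where $J_\alpha,I_\alpha,K_\alpha$ are the usual Bessel and modified Bessel functions. $\widetilde{C}_n^\lambda(x)=\Gamma(\lambda)C_n^\lambda(x)$ is the normalized Gegenbauer polynomial; for $\lambda=0$ and $n\ge1$ it is understood as the limit $\lambda\to0$, i.e. $\widetilde{C}_n^0(\cos\varphi)=\frac{2}{n}\cos(n\varphi)$. *)

theory Defs
  imports "HOL-Analysis.Analysis"
begin

text \<open>
  Bessel functions of real order, for positive real argument. The real function \<^const>\<open>rGamma\<close> is
  the reciprocal of the Gamma function and vanishes at the poles of the latter, so the series below
  are the usual ones for every real order.
\<close>

definition bessel_J :: "real \<Rightarrow> real \<Rightarrow> real" where
  "bessel_J \<alpha> z = (z / 2) powr \<alpha> *
     (\<Sum>n. (-1) ^ n * rGamma (\<alpha> + real n + 1) / fact n * (z / 2) ^ (2 * n))"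

definition bessel_I :: "real \<Rightarrow> real \<Rightarrow> real" where
  "bessel_I \<alpha> z = (z / 2) powr \<alpha> *
     (\<Sum>n. rGamma (\<alpha> + real n + 1) / fact n * (z / 2) ^ (2 * n))"

definition bessel_K :: "real \<Rightarrow> real \<Rightarrow> real" where
  "bessel_K \<alpha> z =
     (let F = (\<lambda>\<beta>. pi / 2 * ((bessel_I (- \<beta>) z - bessel_I \<beta> z) / sin (\<beta> * pi)))
      in if \<alpha> \<in> \<int> then Lim (at \<alpha>) F else F \<alpha>)"

text \<open>
  Normalized Bessel functions. The first two are given directly by the even power series that
  extends \<open>(z/2) powr (-\<alpha>) * J\<^sub>\<alpha>(z)\<close>, respectively \<open>(z/2) powr (-\<alpha>) * I\<^sub>\<alpha>(z)\<close>, from positive to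
  all real arguments; see the two lemmas that follow.
\<close>

definition bessel_J_norm :: "real \<Rightarrow> real \<Rightarrow> real" where
  "bessel_J_norm \<alpha> z = (\<Sum>n. (-1) ^ n * rGamma (\<alpha> + real n + 1) / fact n * (z / 2) ^ (2 * n))"

definition bessel_I_norm :: "real \<Rightarrow> real \<Rightarrow> real" where
  "bessel_I_norm \<alpha> z = (\<Sum>n. rGamma (\<alpha> + real n + 1) / fact n * (z / 2) ^ (2 * n))"

definition bessel_K_norm :: "real \<Rightarrow> real \<Rightarrow> real" where
  "bessel_K_norm \<alpha> z = (z / 2) powr (- \<alpha>) * bessel_K \<alpha> z"

lemma bessel_J_norm_pos: "z > 0 \<Longrightarrow> bessel_J_norm \<alpha> z = (z / 2) powr (- \<alpha>) * bessel_J \<alpha> z"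
  by (simp add: bessel_J_norm_def bessel_J_def powr_minus)

lemma bessel_I_norm_pos: "z > 0 \<Longrightarrow> bessel_I_norm \<alpha> z = (z / 2) powr (- \<alpha>) * bessel_I \<alpha> z"
  by (simp add: bessel_I_norm_def bessel_I_def powr_minus)

text \<open>
  \<open>gegenbauer n l x\<close> is the explicit form of the coefficient of \<open>t ^ n\<close> in the expansion of
  \<open>(1 - 2 * x * t + t\<^sup>2) powr (-l)\<close>. It vanishes at \<open>l = 0\<close> for \<open>n \<ge> 1\<close>, where \<open>Gamma\<close> has a pole;
  the normalized polynomial is there the limit of the product.
\<close>

definition gegenbauer :: "nat \<Rightarrow> real \<Rightarrow> real \<Rightarrow> real" where
  "gegenbauer n l x =
     (\<Sum>k\<le>n div 2. (-1) ^ k * pochhammer l (n - k) / (fact k * fact (n - 2 * k)) * (2 * x) ^ (n - 2 * k))"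

definition gegenbauer_norm :: "nat \<Rightarrow> real \<Rightarrow> real \<Rightarrow> real" where
  "gegenbauer_norm n l x =
     (if l = 0 then Lim (at 0) (\<lambda>s. Gamma s * gegenbauer n s x) else Gamma l * gegenbauer n l x)"

definition theta :: "(real \<Rightarrow> complex) \<Rightarrow> real \<Rightarrow> complex" where
  "theta u x = of_real x * vector_derivative u (at x)"

definition D_op :: "int \<Rightarrow> int \<Rightarrow> (real \<Rightarrow> complex) \<Rightarrow> real \<Rightarrow> complex" where
  "D_op \<mu> \<nu> u =
     (let shift = (\<lambda>c v x. theta v x + of_int c * v x);
          w = (\<lambda>x. theta (shift \<nu> u) x - of_real (x\<^sup>2) * u x)
      in (\<lambda>x. (shift \<mu> (shift (\<mu> + \<nu>) w) x - of_real (x\<^sup>2) * w x) / of_real (x\<^sup>2)))"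

definition Lambda_gen :: "int \<Rightarrow> int \<Rightarrow> real \<Rightarrow> real \<Rightarrow> real" where
  "Lambda_gen \<mu> \<nu> x t =
     1 / (1 - t) powr (of_int (\<mu> + \<nu> + 2) / 2) *
     bessel_I_norm (of_int \<mu> / 2) (t * x / (1 - t)) * bessel_K_norm (of_int \<nu> / 2) (x / (1 - t))"

definition Lambda :: "int \<Rightarrow> int \<Rightarrow> nat \<Rightarrow> real \<Rightarrow> real" where
  "Lambda \<mu> \<nu> j x = (deriv ^^ j) (Lambda_gen \<mu> \<nu> x) 0 / fact j"

definition classical_solution :: "int \<Rightarrow> int \<Rightarrow> nat \<Rightarrow> (real \<Rightarrow> complex) \<Rightarrow> bool" where
  "classical_solution \<mu> \<nu> j u \<longleftrightarrow>
     (\<forall>k<4. ((\<lambda>f x. vector_derivative f (at x)) ^^ k) u differentiable_on {0<..}) \<and>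
     (\<forall>x>0. D_op \<mu> \<nu> u x = of_int (4 * int j * (int j + \<mu> + 1)) * u x)"

definition square_integrable :: "int \<Rightarrow> int \<Rightarrow> (real \<Rightarrow> complex) \<Rightarrow> bool" where
  "square_integrable \<mu> \<nu> u \<longleftrightarrow>
     set_borel_measurable lborel {0<..} u \<and>
     set_integrable lborel {0<..} (\<lambda>x. (cmod (u x))\<^sup>2 * x powi (\<mu> + \<nu> + 1))"

text \<open>
  The differential operator alone does not single out the self-adjoint operator: for some parameters
  (for instance \<open>\<mu> = \<nu>\<close>) it is not essentially self-adjoint on test functions, and there may be
  square integrable solutions of the differential equation outside the domain of the self-adjoint
  extension. That extension is the one whose eigenspaces are spanned by the functions
  \<^const>\<open>Lambda\<close>. The third conjunct expresses membership in its eigenspace; the first two hold for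
  every multiple of \<^const>\<open>Lambda\<close>. Only the values of \<open>u\<close> on the positive half-line matter.
\<close>

definition L2_solution :: "int \<Rightarrow> int \<Rightarrow> nat \<Rightarrow> (real \<Rightarrow> complex) \<Rightarrow> bool" where
  "L2_solution \<mu> \<nu> j u \<longleftrightarrow>
     classical_solution \<mu> \<nu> j u \<and> square_integrable \<mu> \<nu> u \<and>
     (\<exists>c. \<forall>x>0. u x = c * of_real (Lambda \<mu> \<nu> j x))"

end

theory Submission
  imports Defs
begin

text \<open>
  In the variable \<open>y = x\<^sup>2/4\<close> all Bessel functions of the theorem come from two families:
  Clifford's entire functions \<open>E\<^sub>a\<close> (here \<open>clifford\<close>), with \<open>I\<^sub>a \<leadsto> E\<^sub>a(y)\<close> and
  \<open>J\<^sub>a(sx) \<leadsto> E\<^sub>a(-s\<^sup>2y)\<close>, and \<open>k\<^sub>b(y) = \<integral> exp(-s - y/s) s powr (-b-1) ds\<close> over the half-line,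
  with \<open>K\<^sub>b \<leadsto> k\<^sub>b(y)/2\<close>. Put \<open>a = \<mu>/2\<close>, \<open>b = \<nu>/2\<close>, \<open>N = a + b\<close>, \<open>m = a - b\<close>, and let \<open>L\<^sub>j(y)\<close> be
  \<open>\<Lambda>\<^sub>j(x)\<close>. The integral is then a constant multiple of
  \<open>T\<^sub>j(A,B) = \<integral> L\<^sub>j(y) E\<^sub>a(-Ay) E\<^sub>b(-By) y\<^sup>N dy\<close>, where \<open>A\<close> and \<open>B\<close> are the squares of the two scale factors.
  With \<open>\<rho>\<^sup>2 = 1 + 2A + 2B + (A-B)\<^sup>2\<close> one has \<open>cos \<theta> + cos \<phi> = 2/\<rho>\<close>, \<open>cos \<theta> = (1-A+B)/\<rho>\<close> and
  \<open>cos \<phi> = (1+A-B)/\<rho>\<close>, so that the right-hand side is a function of \<open>A\<close> and \<open>B\<close> as well.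

  The reason for the formula is that dilation acts in the same way on both sides. The Euler
  operator \<open>y d/dy\<close> maps \<open>L\<^sub>j\<close> to a combination of \<open>L\<^sub>j\<close> and its neighbours \<open>L\<^sub>j\<^sub>+\<^sub>1\<close> and \<open>L\<^sub>j\<^sub>-\<^sub>1\<close>
  (\<open>Lam_recursion\<close>, from the two Bessel equations that the generating function satisfies). For \<open>T\<^sub>j\<close>
  this is a statement on the derivative along rays \<open>s \<mapsto> (sA,sB)\<close> (\<open>htrans_Lam_recursion\<close>). The same
  derivative of \<open>\<rho>\<close> to the power \<open>-(N+1)\<close> times two Gegenbauer polynomials yields,
  besides a multiple of this function, products with both degrees raised or both lowered; the mixed products cancel exactly because the degrees differ by \<open>m\<close>
  (\<open>profile_derivative\<close>). Hence the formula for \<open>j\<close> and \<open>j-1\<close> implies the one for \<open>j+1\<close>.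

  For \<open>j = 0\<close> the function \<open>L\<^sub>0\<close> is a multiple of \<open>k\<^sub>b\<close>. If \<open>a = b\<close>, the transform satisfies
  differential equations of first order in \<open>A\<close> and \<open>B\<close>, since an explicit combination of products of Bessel
  functions is an antiderivative (\<open>base_telescoper\<close>), and they force it to be a multiple of \<open>\<rho>\<close> to the power
  \<open>-(N+1)\<close>. Each derivative in \<open>A\<close> raises \<open>a\<close> by one and the degree of the Gegenbauer polynomial by one
  (\<open>htrans_raise_order\<close>), which gives all \<open>a = b + m\<close>. For \<open>b = -1/2\<close> the integral with \<open>a = b\<close> diverges; there
  the boundary term of the same antiderivative gives the case \<open>m = 1\<close>.
\<close>

section \<open>Clifford's entire functions\<close>

text \<open>
  Evaluated at \<open>z\<^sup>2/4\<close> and \<open>-z\<^sup>2/4\<close> it gives the normalized functions \<open>I\<close> and \<open>J\<close>.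
\<close>
definition clifford :: "real \<Rightarrow> real \<Rightarrow> real" where
  "clifford a y = (\<Sum>n. rGamma (a + real n + 1) / fact n * y ^ n)"

text \<open>
  By the functional equation the moduli eventually decrease. Hence the Clifford series is
  dominated by an exponential series.
\<close>
lemma rGamma_bounded_shift: "\<exists>C. \<forall>n. \<bar>rGamma (a + real n + 1)\<bar> \<le> C"
proof -
  \<comment> \<open>Beyond \<open>m\<close> the argument is at least 1, where the recursion divides by a number \<open>\<ge> 1\<close>.\<close>
  obtain m :: nat where m: "real m \<ge> \<bar>a\<bar>" using real_arch_simple by blast
  have step: "\<bar>rGamma (a + real (m + n) + 1)\<bar> \<le> \<bar>rGamma (a + real m + 1)\<bar>" for n
  proof (induction n)
    case (Suc n)
    let ?z = "a + real (m + n) + 1"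
    have z: "?z \<ge> 1" using m by simp
    have "\<bar>?z\<bar> * \<bar>rGamma (?z + 1)\<bar> = \<bar>rGamma ?z\<bar>"
      using rGamma_plus1[of ?z] by (metis abs_mult)
    moreover have "1 * \<bar>rGamma (?z + 1)\<bar> \<le> \<bar>?z\<bar> * \<bar>rGamma (?z + 1)\<bar>"
      using z by (intro mult_right_mono) auto
    ultimately have "\<bar>rGamma (?z + 1)\<bar> \<le> \<bar>rGamma ?z\<bar>" by linarith
    with Suc show ?case by (simp add: add_ac)
  qed simp
  have fin: "finite ((\<lambda>n. \<bar>rGamma (a + real n + 1)\<bar>) ` {..m})" by simp
  let ?C = "Max ((\<lambda>n. \<bar>rGamma (a + real n + 1)\<bar>) ` {..m})"
  have "\<bar>rGamma (a + real n + 1)\<bar> \<le> ?C" for n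
  proof (cases "n \<le> m")
    case True then show ?thesis by (intro Max_ge[OF fin]) auto
  next
    case False
    then obtain k where "n = m + k" using less_imp_add_positive by (metis not_le)
    moreover have "\<bar>rGamma (a + real m + 1)\<bar> \<le> ?C" by (intro Max_ge[OF fin]) auto
    ultimately show ?thesis using order_trans[OF step[of k]] by simp
  qed
  then show ?thesis by blast
qed

lemma clifford_summable: "summable (\<lambda>n. rGamma (a + real n + 1) / fact n * y ^ n)"
proof -
  obtain C where C: "\<And>n. \<bar>rGamma (a + real n + 1)\<bar> \<le> C" using rGamma_bounded_shift by blast
  have "summable (\<lambda>n. C * (\<bar>y\<bar> ^ n /\<^sub>R fact n))"
    by (intro summable_mult summable_exp_generic)
  then show ?thesis
  proof (rule summable_comparison_test')
    fix n assume "n \<ge> (0::nat)"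
    have "norm (rGamma (a + real n + 1) / fact n * y ^ n) = \<bar>rGamma (a + real n + 1)\<bar> * (\<bar>y\<bar> ^ n / fact n)"
      by (simp add: abs_mult power_abs)
    also have "\<dots> \<le> C * (\<bar>y\<bar> ^ n / fact n)" by (intro mult_right_mono C) auto
    finally show "norm (rGamma (a + real n + 1) / fact n * y ^ n) \<le> C * (\<bar>y\<bar> ^ n /\<^sub>R fact n)"
      by (simp add: divide_inverse mult_ac)
  qed
qed

lemma clifford_sums: "(\<lambda>n. rGamma (a + real n + 1) / fact n * y ^ n) sums clifford a y"
  unfolding clifford_def by (rule summable_sums[OF clifford_summable])

lemma clifford_has_derivative: "(clifford a has_real_derivative clifford (a + 1) y) (at y)"
proof -
  let ?c = "\<lambda>n. rGamma (a + real n + 1) / fact n"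
  have d: "diffs ?c = (\<lambda>n. rGamma ((a + 1) + real n + 1) / fact n)"
    by (auto simp: diffs_def fun_eq_iff field_simps simp del: of_nat_Suc) (simp add: add_ac)
  have "((\<lambda>x. \<Sum>n. ?c n * x ^ n) has_real_derivative (\<Sum>n. diffs ?c n * y ^ n)) (at y)"
    by (rule termdiffs_strong[where K="\<bar>y\<bar> + 1"]) (use clifford_summable in \<open>auto simp del: times_divide_eq_left\<close>)
  then show ?thesis unfolding d clifford_def[symmetric] .
qed

lemma clifford_has_derivative' [derivative_intros]:
  assumes "(f has_real_derivative f') (at x within S)"
  shows "((\<lambda>x. clifford a (f x)) has_real_derivative clifford (a + 1) (f x) * f') (at x within S)"
  using DERIV_chain2[OF clifford_has_derivative assms] .

lemma continuous_on_clifford [continuous_intros]: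
  "continuous_on S f \<Longrightarrow> continuous_on S (\<lambda>x. clifford a (f x))"
  by (rule continuous_on_compose2[of UNIV "clifford a"])
     (auto intro: DERIV_continuous_on clifford_has_derivative)

lemma clifford_0 [simp]: "clifford a 0 = rGamma (a + 1)"
proof -
  have "(\<lambda>n. rGamma (a + real n + 1) / fact n * 0 ^ n) sums (rGamma (a + real 0 + 1) / fact 0)"
    using powser_sums_zero[of "\<lambda>n. rGamma (a + real n + 1) / fact n"] by simp
  from sums_unique2[OF clifford_sums this] show ?thesis by simp
qed

text \<open>
  Comparison of coefficients, from \<open>z * rGamma (z + 1) = rGamma z\<close>. Since differentiation raises
  the order by one, this is Bessel's equation; it is also the rule that lowers the order.
\<close>
lemma clifford_lower: "clifford a y = (a + 1) * clifford (a + 1) y + y * clifford (a + 2) y"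
proof -
  let ?t = "\<lambda>a n. rGamma (a + real n + 1) / fact n * y ^ n"
  have 1: "(\<lambda>n. real (Suc n) * ?t (a + 1) (Suc n)) sums (y * clifford (a + 2) y)"
  proof -
    have "real (Suc n) * ?t (a + 1) (Suc n) = y * ?t (a + 2) n" for n
      by (simp add: field_simps del: of_nat_Suc) (simp add: add_ac)
    then show ?thesis using sums_mult[OF clifford_sums, of y "a + 2" y] by (simp only:)
  qed
  have 2: "(\<lambda>n. real n * ?t (a + 1) n) sums (y * clifford (a + 2) y)"
    using sums_Suc_imp[of "\<lambda>n. real n * ?t (a + 1) n", OF _ 1] by simp
  have "(\<lambda>n. (a + 1) * ?t (a + 1) n + real n * ?t (a + 1) n) sums
          ((a + 1) * clifford (a + 1) y + y * clifford (a + 2) y)"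
    by (intro sums_add sums_mult clifford_sums 2)
  moreover have "(a + 1) * ?t (a + 1) n + real n * ?t (a + 1) n = ?t a n" for n
  proof -
    have "(a + real n + 1) * rGamma (a + real n + 1 + 1) = rGamma (a + real n + 1)"
      by (rule rGamma_plus1)
    moreover have "(a + 1) * ?t (a + 1) n + real n * ?t (a + 1) n
        = (a + real n + 1) * rGamma (a + real n + 1 + 1) / fact n * y ^ n"
      by (simp add: add_divide_distrib algebra_simps)
    ultimately show ?thesis by simp
  qed
  ultimately have "?t a sums ((a + 1) * clifford (a + 1) y + y * clifford (a + 2) y)" by simp
  from sums_unique2[OF clifford_sums this] show ?thesis .
qed

lemma bessel_I_norm_clifford: "bessel_I_norm a z = clifford a (z\<^sup>2 / 4)"
  unfolding bessel_I_norm_def clifford_def power_mult power_divide[of z 2 2] by simp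

lemma bessel_J_norm_clifford: "bessel_J_norm a z = clifford a (- (z\<^sup>2 / 4))"
proof -
  have "(-1) ^ n * rGamma (a + real n + 1) / fact n * (z / 2) ^ (2 * n)
      = rGamma (a + real n + 1) / fact n * (- (z\<^sup>2 / 4)) ^ n" for n
    
    unfolding power_mult power_divide[of z 2 2] power_minus[of "z\<^sup>2/4" n] by (simp add: mult_ac)
  then show ?thesis unfolding bessel_J_norm_def clifford_def by (simp only:)
qed

text \<open>
  Along \<open>f(y) = E\<^sub>a(-y)\<close> the energy \<open>f\<^sup>2 + y f'\<^sup>2\<close> has the derivative \<open>-(2a+1) f'\<^sup>2\<close>, so it never
  exceeds its value at 0.
\<close>
lemma clifford_neg_bound:
  assumes a: "a \<ge> -1/2" and y: "y \<ge> 0"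
  shows "\<bar>clifford a (- y)\<bar> \<le> rGamma (a + 1)"
proof -
  define h where "h = (\<lambda>y. (clifford a (- y))\<^sup>2 + y * (clifford (a + 1) (- y))\<^sup>2)"
  have "h y \<le> h 0"
  proof (rule DERIV_nonpos_imp_nonincreasing[OF y])
    fix x :: real assume x: "0 \<le> x"
    have low: "clifford a (- x) = (a + 1) * clifford (a + 1) (- x) - x * clifford (a + 2) (- x)"
      using clifford_lower[of a "- x"] by simp
    have "(h has_real_derivative
       (2 * clifford a (- x) * (- clifford (a + 1) (- x)) + (clifford (a + 1) (- x))\<^sup>2
         + x * (2 * clifford (a + 1) (- x) * (- clifford (a + 2) (- x))))) (at x)"
      unfolding h_def by (auto intro!: derivative_eq_intros simp: power2_eq_square algebra_simps)
    moreover have "(2 * clifford a (- x) * (- clifford (a + 1) (- x)) + (clifford (a + 1) (- x))\<^sup>2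
         + x * (2 * clifford (a + 1) (- x) * (- clifford (a + 2) (- x))))
        = - (2 * a + 1) * (clifford (a + 1) (- x))\<^sup>2"
      unfolding low by (simp add: power2_eq_square algebra_simps)
    moreover have "- (2 * a + 1) * (clifford (a + 1) (- x))\<^sup>2 \<le> 0"
      using a by (intro mult_nonpos_nonneg) auto
    ultimately show "\<exists>d. (h has_real_derivative d) (at x) \<and> d \<le> 0" by metis
  qed
  then have "(clifford a (- y))\<^sup>2 + y * (clifford (a + 1) (- y))\<^sup>2 \<le> (rGamma (a + 1))\<^sup>2"
    by (simp add: h_def)
  moreover have "y * (clifford (a + 1) (- y))\<^sup>2 \<ge> 0" using y by simp
  ultimately have "(clifford a (- y))\<^sup>2 \<le> (rGamma (a + 1))\<^sup>2" by linarith
  moreover have "rGamma (a + 1) \<ge> 0"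
    using a Gamma_real_pos[of "a + 1"] by (simp add: rGamma_inverse_Gamma)
  ultimately show ?thesis by (simp add: abs_le_square_iff[symmetric])
qed

lemma clifford_pos:
  assumes "a > -1" "y \<ge> 0" shows "clifford a y > 0"
proof -
  have r: "rGamma (a + real n + 1) > 0" for n
    using assms Gamma_real_pos[of "a + real n + 1"] by (simp add: rGamma_inverse_Gamma)
  have "clifford a y \<ge> (\<Sum>n<1. rGamma (a + real n + 1) / fact n * y ^ n)"
    unfolding clifford_def
    by (intro sum_le_suminf clifford_summable) (use less_imp_le[OF r] assms in auto)
  with r[of 0] show ?thesis by simp
qed

section \<open>Integration on the half-line\<close>

text \<open>
  As a measure space of its own, the half-line contains positive points only, so that integrands
  need no indicator functions.
\<close>
abbreviation lpos :: "real measure" where "lpos \<equiv> restrict_space lborel {0<..}"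

lemma space_lpos: "space lpos = {0<..}" by (simp add: space_restrict_space)

lemma sets_lpos: "sets lpos = sets (restrict_space borel {0<..})"
  by (intro sets_restrict_space_cong) simp

lemma measurable_lposI: "continuous_on {0<..} f \<Longrightarrow> f \<in> borel_measurable lpos"
  using borel_measurable_continuous_on_restrict[of "{0<..}" f]
  by (simp cong: measurable_cong_sets add: measurable_cong_sets[OF sets_lpos refl])

lemma integrable_lpos_iff: "integrable lpos f \<longleftrightarrow> set_integrable lborel {0<..} f"
  for f :: "real \<Rightarrow> 'a :: {banach, second_countable_topology}"
  by (simp add: integrable_restrict_space set_integrable_def)

lemma integral_lpos_eq: "integral\<^sup>L lpos f = (LBINT x:{0<..}. f x)"
  for f :: "real \<Rightarrow> 'a :: {banach, second_countable_topology}"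
  by (simp add: integral_restrict_space set_lebesgue_integral_def)

lemma integrable_lpos_bound:
  fixes f g :: "real \<Rightarrow> real"
  assumes "integrable lpos g" "continuous_on {0<..} f" "\<And>x. x > 0 \<Longrightarrow> \<bar>f x\<bar> \<le> g x"
  shows "integrable lpos f"
proof (rule Bochner_Integration.integrable_bound[OF assms(1) measurable_lposI[OF assms(2)]], rule AE_I2)
  fix x assume "x \<in> space lpos"
  then have "x > 0" by (simp add: space_lpos)
  then show "norm (f x) \<le> norm (g x)" using assms(3)[of x] by simp
qed

lemma integral_tendsto_dominated:
  fixes f :: "real \<Rightarrow> 'a \<Rightarrow> real"
  assumes meas: "\<And>x. x \<in> S \<Longrightarrow> f x \<in> borel_measurable M"
    and g: "g \<in> borel_measurable M"
    and w: "integrable M w"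
    and bound: "\<And>x s. x \<in> S \<Longrightarrow> s \<in> space M \<Longrightarrow> \<bar>f x s\<bar> \<le> w s"
    and lim: "\<And>s. s \<in> space M \<Longrightarrow> ((\<lambda>x. f x s) \<longlongrightarrow> g s) (at x0 within S)"
  shows "((\<lambda>x. \<integral>s. f x s \<partial>M) \<longlongrightarrow> (\<integral>s. g s \<partial>M)) (at x0 within S)"
  unfolding tendsto_at_iff_sequentially
proof (intro allI impI)
  fix X :: "nat \<Rightarrow> real" assume X: "\<forall>i. X i \<in> S - {x0}" "X \<longlonglongrightarrow> x0"
  have "(\<lambda>i. \<integral>s. f (X i) s \<partial>M) \<longlonglongrightarrow> (\<integral>s. g s \<partial>M)"
  proof (rule integral_dominated_convergence[OF g _ w])
    show "AE s in M. (\<lambda>i. f (X i) s) \<longlonglongrightarrow> g s"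
      using lim X unfolding tendsto_at_iff_sequentially o_def by (intro AE_I2) blast
    show "AE s in M. norm (f (X i) s) \<le> w s" for i
      using bound X(1) by (intro AE_I2) auto
  qed (use meas X(1) in auto)
  then show "((\<lambda>x. \<integral>s. f x s \<partial>M) \<circ> X) \<longlonglongrightarrow> (\<integral>s. g s \<partial>M)" by (simp add: o_def)
qed

text \<open>
  The mean value inequality bounds the difference quotients by \<open>w\<close>. The derivative is taken
  within a convex set so that one-sided derivatives at end points are included.
\<close>
lemma has_derivative_integral_dominated:
  fixes f f' :: "real \<Rightarrow> 'a \<Rightarrow> real"
  assumes S: "convex S" "x0 \<in> S"
    and int: "\<And>x. x \<in> S \<Longrightarrow> integrable M (f x)"
    and meas: "f' x0 \<in> borel_measurable M"
    and w: "integrable M w"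
    and der: "\<And>x s. x \<in> S \<Longrightarrow> s \<in> space M \<Longrightarrow> ((\<lambda>x. f x s) has_real_derivative f' x s) (at x within S)"
    and bound: "\<And>x s. x \<in> S \<Longrightarrow> s \<in> space M \<Longrightarrow> \<bar>f' x s\<bar> \<le> w s"
  shows "((\<lambda>x. \<integral>s. f x s \<partial>M) has_real_derivative (\<integral>s. f' x0 s \<partial>M)) (at x0 within S)"
  unfolding has_field_derivative_iff
proof -
  have "((\<lambda>x. \<integral>s. (f x s - f x0 s) / (x - x0) \<partial>M) \<longlongrightarrow> (\<integral>s. f' x0 s \<partial>M)) (at x0 within S)"
  proof (rule integral_tendsto_dominated[OF _ meas w])
    show "(\<lambda>s. (f x s - f x0 s) / (x - x0)) \<in> borel_measurable M" if "x \<in> S" for x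
      using int[OF that] int[OF S(2)] by (intro borel_measurable_divide borel_measurable_diff) auto
    show "((\<lambda>x. (f x s - f x0 s) / (x - x0)) \<longlongrightarrow> f' x0 s) (at x0 within S)" if "s \<in> space M" for s
      using der[OF S(2) that] unfolding has_field_derivative_iff .
    show "\<bar>(f x s - f x0 s) / (x - x0)\<bar> \<le> w s" if "x \<in> S" "s \<in> space M" for x s
    proof (cases "x = x0")
      case True
      then show ?thesis using bound[OF S(2) that(2)] by simp
    next
      case False
      have "norm (f x s - f x0 s) \<le> w s * norm (x - x0)"
        by (rule field_differentiable_bound[OF S(1) der]) (use that S bound in auto)
      with False show ?thesis by (simp add: abs_divide pos_divide_le_eq)
    qed
  qed
  moreover have "(\<integral>s. (f x s - f x0 s) / (x - x0) \<partial>M) = ((\<integral>s. f x s \<partial>M) - (\<integral>s. f x0 s \<partial>M)) / (x - x0)"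
    if "x \<in> S" for x
    using int[OF that] int[OF S(2)] by simp
  ultimately show "((\<lambda>x. ((\<integral>s. f x s \<partial>M) - (\<integral>s. f x0 s \<partial>M)) / (x - x0)) \<longlongrightarrow> (\<integral>s. f' x0 s \<partial>M)) (at x0 within S)"
    by (subst Lim_cong_within[OF refl refl refl, where g = "\<lambda>x. \<integral>s. (f x s - f x0 s) / (x - x0) \<partial>M"]) metis+
qed

lemma integral_lpos_FTC:
  fixes F f :: "real \<Rightarrow> real"
  assumes F: "\<And>s. s > 0 \<Longrightarrow> (F has_real_derivative f s) (at s)"
    and f: "continuous_on {0<..} f" "integrable lpos f"
    and A: "(F \<longlongrightarrow> A) (at_right 0)" and B: "(F \<longlongrightarrow> B) at_top"
  shows "(\<integral>s. f s \<partial>lpos) = B - A"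
proof -
  have "(LBINT s=ereal 0..\<infinity>. f s) = B - A"
  proof (rule interval_integral_FTC_integrable)
    show "((F \<circ> real_of_ereal) \<longlongrightarrow> A) (at_right (ereal 0))" "((F \<circ> real_of_ereal) \<longlongrightarrow> B) (at_left \<infinity>)"
      using A B by (simp_all add: ereal_tendsto_simps)
    show "isCont f x" if "ereal 0 < ereal x" for x
      using f(1) that by (simp add: continuous_on_eq_continuous_at)
    show "(F has_vector_derivative f x) (at x)" if "ereal 0 < ereal x" for x
      using F[of x] that by (simp add: has_real_derivative_iff_has_vector_derivative)
    show "set_integrable lborel (einterval (ereal 0) \<infinity>) f"
      unfolding einterval_eq integrable_lpos_iff[symmetric] by (rule f)
  qed auto
  then show ?thesis
    by (simp only: interval_lebesgue_integral_le_eq[of "ereal 0" \<infinity>] ereal_less_eq einterval_eq integral_lpos_eq)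
qed

lemma lpos_integral_from_has_integral:
  fixes f :: "real \<Rightarrow> real"
  assumes f: "continuous_on {0<..} f" and nn: "\<And>x. x > 0 \<Longrightarrow> f x \<ge> 0"
    and I: "(f has_integral I) {0<..}"
  shows "integrable lpos f" "(\<integral>x. f x \<partial>lpos) = I"
proof -
  have m: "(\<lambda>x. indicator {0<..} x * f x) \<in> borel_measurable borel"
    using borel_measurable_continuous_on_indicator[OF _ f] by simp
  have I': "((\<lambda>x. indicator {0<..} x * f x) has_integral I) UNIV"
    using I has_integral_restrict_UNIV[of "{0<..}" f I]
    by (simp add: indicator_times_eq_if)
  have nn': "0 \<le> indicator {0<..} x * f x" for x using nn[of x] by (auto simp: indicator_def)
  have "(\<integral>\<^sup>+ x. indicator {0<..} x * f x \<partial>lborel) = I"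
    by (rule nn_integral_has_integral_lborel[OF m nn' I'])
  moreover have "I \<ge> 0" using has_integral_nonneg[OF I'] nn' by simp
  ultimately have "has_bochner_integral lborel (\<lambda>x. indicator {0<..} x * f x) I"
    using m nn' by (intro has_bochner_integral_nn_integral) auto
  then show "integrable lpos f" "(\<integral>x. f x \<partial>lpos) = I"
    by (simp_all add: has_bochner_integral_iff integrable_restrict_space integral_restrict_space)
qed

lemma lpos_Gamma:
  assumes "p > -1"
  shows "integrable lpos (\<lambda>s. exp (- s) * s powr p)" "(\<integral>s. exp (- s) * s powr p \<partial>lpos) = Gamma (p + 1)"
proof -
  have "((\<lambda>t. t powr (p + 1 - 1) / exp t) has_integral Gamma (p + 1)) {0..}"
    using assms by (intro Gamma_integral_real) simp
  then have "((\<lambda>s. exp (- s) * s powr p) has_integral Gamma (p + 1)) {0..}"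
    by (simp add: exp_minus divide_inverse mult_ac)
  then have I: "((\<lambda>s. exp (- s) * s powr p) has_integral Gamma (p + 1)) {0<..}"
    by (subst has_integral_spike_set_eq[of _ "{0..}"]) (auto intro: negligible_subset[of "{0}"])
  show "integrable lpos (\<lambda>s. exp (- s) * s powr p)" "(\<integral>s. exp (- s) * s powr p \<partial>lpos) = Gamma (p + 1)"
    by (rule lpos_integral_from_has_integral[OF _ _ I]; auto intro!: continuous_intros)+
qed

text \<open>
  Applied to \<open>exp (- (w / s))\<close>, this trades the essential singularity at \<open>s = 0\<close> for a power of
  \<open>s\<close> and gains decay in \<open>w\<close>.
\<close>
lemma exp_decay_powr:
  fixes p :: real assumes "p \<ge> 0"
  obtains C where "C > 0" "\<And>x. x > 0 \<Longrightarrow> exp (- x) \<le> C * x powr (- p)"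
proof -
  obtain n :: nat where n: "p \<le> real n" using real_arch_simple by blast
  have "exp (- x) \<le> (1 + fact n) * x powr (- p)" if x: "x > 0" for x :: real
  proof -
    have "x powr p \<le> 1 + x ^ n"
    proof (cases "x \<le> 1")
      case True
      then have "x powr p \<le> 1" using x assms by (intro powr_le1) auto
      moreover have "x ^ n \<ge> 0" using x by simp
      ultimately show ?thesis by linarith
    next
      case False
      then have "x powr p \<le> x powr real n" using n by (intro powr_mono) auto
      then show ?thesis using x by (simp add: powr_realpow)
    qed
    also have "x ^ n \<le> fact n * exp x"
    proof -
      have "(\<Sum>k\<in>{n}. x ^ k /\<^sub>R fact k) \<le> (\<Sum>k. x ^ k /\<^sub>R fact k)"
        using x by (intro sum_le_suminf summable_exp_generic) auto
      then show ?thesis by (simp add: exp_def field_simps)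
    qed
    also have "1 \<le> exp x" using x by simp
    finally have "x powr p \<le> (1 + fact n) * exp x" by (simp add: algebra_simps)
    then show ?thesis using x by (simp add: exp_minus powr_minus field_simps)
  qed
  then show thesis using that[of "1 + fact n"] by (smt (verit) fact_gt_zero)
qed

section \<open>Macdonald functions as integrals\<close>

abbreviation kint_kernel :: "real \<Rightarrow> real \<Rightarrow> real \<Rightarrow> real" where
  "kint_kernel b w s \<equiv> exp (- s - w / s) * s powr (- b - 1)"

text \<open>
  This integral is regular in the order \<open>b\<close>, in contrast to the quotient that defines \<open>K\<close> and is
  indeterminate at integers.
\<close>
definition kint :: "real \<Rightarrow> real \<Rightarrow> real" where
  "kint b w = (\<integral>s. kint_kernel b w s \<partial>lpos)"

lemma kint_kernel_bound:
  fixes q :: real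
  assumes "q \<ge> 0"
  shows "\<exists>C>0. \<forall>b s w. s > 0 \<longrightarrow> w > 0 \<longrightarrow>
    kint_kernel b w s \<le> C * w powr (- q) * (exp (- s) * s powr (q - b - 1))"
proof -
  obtain C where C: "C > 0" "\<And>x. x > 0 \<Longrightarrow> exp (- x) \<le> C * x powr (- q)"
    using exp_decay_powr[OF assms] by blast
  have "kint_kernel b w s \<le> C * w powr (- q) * (exp (- s) * s powr (q - b - 1))"
    if "s > 0" "w > 0" for b s w :: real
  proof -
    have "exp (- s - w / s) = exp (- (w / s)) * exp (- s)"
      by (simp add: exp_add[symmetric])
    then have "kint_kernel b w s = exp (- (w / s)) * (exp (- s) * s powr (- b - 1))"
      by simp
    also have "\<dots> \<le> C * (w / s) powr (- q) * (exp (- s) * s powr (- b - 1))"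
      using that by (intro mult_right_mono C) auto
    also have "(w / s) powr (- q) = w powr (- q) * s powr q"
      using that by (simp add: powr_divide powr_minus field_simps)
    also have "C * (w powr (- q) * s powr q) * (exp (- s) * s powr (- b - 1))
        = C * w powr (- q) * (exp (- s) * (s powr q * s powr (- b - 1)))" by (simp add: mult_ac)
    also have "s powr q * s powr (- b - 1) = s powr (q - b - 1)"
      by (simp add: powr_add[symmetric] algebra_simps)
    finally show ?thesis .
  qed
  with C(1) show ?thesis by blast
qed

lemma kint_kernel_cont: "continuous_on {0<..} (\<lambda>s::real. exp (- s - w / s) * s powr p)"
  by (auto intro!: continuous_intros)

lemma kint_kernel_integrable:
  assumes "w > 0"
  shows "integrable lpos (\<lambda>s. kint_kernel b w s)"
proof -
  have "\<bar>b\<bar> + 1 \<ge> 0" by simp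
  from kint_kernel_bound[OF this] obtain C where C: "C > 0" "\<And>s. s > 0 \<Longrightarrow> kint_kernel b w s
      \<le> C * w powr (- (\<bar>b\<bar> + 1)) * (exp (- s) * s powr (\<bar>b\<bar> + 1 - b - 1))"
    using assms by blast
  show ?thesis
  proof (rule integrable_lpos_bound[OF _ kint_kernel_cont])
    show "integrable lpos (\<lambda>s. C * w powr (- (\<bar>b\<bar> + 1)) * (exp (- s) * s powr (\<bar>b\<bar> + 1 - b - 1)))"
      by (intro integrable_mult_right lpos_Gamma) auto
  qed (use C(2) assms in auto)
qed

lemma kint_nonneg: "kint b w \<ge> 0"
  unfolding kint_def by (intro Bochner_Integration.integral_nonneg) auto

text \<open>
  Replacing \<open>exp (- (w / s))\<close> by a multiple of \<open>(w / s) powr (- p)\<close> leaves the integral for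
  \<open>Gamma (p - b)\<close>.
\<close>
lemma kint_bound:
  assumes "p \<ge> 0" "p > b"
  shows "\<exists>C\<ge>0. \<forall>w>0. kint b w \<le> C * w powr (- p)"
proof -
  obtain C where C: "C > 0" "\<And>s w. s > 0 \<Longrightarrow> w > 0 \<Longrightarrow> kint_kernel b w s
      \<le> C * w powr (- p) * (exp (- s) * s powr (p - b - 1))"
    using kint_kernel_bound[OF assms(1)] by blast
  have "kint b w \<le> (C * Gamma (p - b)) * w powr (- p)" if w: "w > 0" for w
  proof -
    have "kint b w \<le> (\<integral>s. C * w powr (- p) * (exp (- s) * s powr (p - b - 1)) \<partial>lpos)"
      unfolding kint_def using assms C(2) w
      by (intro integral_mono kint_kernel_integrable integrable_mult_right lpos_Gamma)
         (auto simp: space_lpos)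
    also have "\<dots> = C * w powr (- p) * (\<integral>s. exp (- s) * s powr (p - b - 1) \<partial>lpos)" by simp
    also have "(\<integral>s. exp (- s) * s powr (p - b - 1) \<partial>lpos) = Gamma (p - b)"
      using assms by (subst lpos_Gamma) auto
    finally show ?thesis by (simp add: mult_ac)
  qed
  moreover have "C * Gamma (p - b) \<ge> 0" using C(1) assms Gamma_real_pos[of "p - b"] by simp
  ultimately show ?thesis by blast
qed

lemma kint_has_derivative:
  assumes w: "w > 0"
  shows "(kint b has_real_derivative - kint (b + 1) w) (at w)"
proof -
  have "((\<lambda>x. \<integral>s. kint_kernel b x s \<partial>lpos) has_real_derivative
      (\<integral>s. - (kint_kernel (b + 1) w s) \<partial>lpos)) (at w within {w/2<..})"
  proof (rule has_derivative_integral_dominated[where w = "\<lambda>s. kint_kernel (b + 1) (w/2) s"])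
    fix x s assume x: "x \<in> {w/2<..}" and "s \<in> space lpos"
    then have s: "s > 0" by (simp add: space_lpos)
    have "s powr (- b - 1) / s = s powr (- (b + 1) - 1)"
      using s powr_diff[of s "- b - 1" 1] by (simp add: diff_diff_eq add.commute)
    then show "((\<lambda>x. kint_kernel b x s) has_real_derivative
        - (kint_kernel (b + 1) x s)) (at x within {w/2<..})"
      using s by (auto intro!: derivative_eq_intros simp: field_simps)
    have "exp (- s - x / s) \<le> exp (- s - (w / 2) / s)"
      using x s divide_right_mono[of "w / 2" x s] by simp
    then show "\<bar>- (kint_kernel (b + 1) x s)\<bar> \<le> kint_kernel (b + 1) (w/2) s"
      by (simp add: abs_mult mult_right_mono)
  next
    show "(\<lambda>s. - (kint_kernel (b + 1) w s)) \<in> borel_measurable lpos"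
      by (intro measurable_lposI continuous_intros) auto
    show "integrable lpos (\<lambda>s. kint_kernel (b + 1) (w/2) s)"
      using w by (intro kint_kernel_integrable) simp
  qed (use w in \<open>auto intro!: kint_kernel_integrable\<close>)
  then show ?thesis
    using w unfolding kint_def[abs_def] by (simp add: at_within_open[of _ "{w/2<..}"])
qed

lemma kint_has_derivative' [derivative_intros]:
  assumes "(f has_real_derivative f') (at x within S)" "f x > 0"
  shows "((\<lambda>x. kint b (f x)) has_real_derivative - kint (b + 1) (f x) * f') (at x within S)"
  using DERIV_chain2[OF kint_has_derivative assms(1)] assms(2) by blast

lemma continuous_on_kint: "continuous_on {0<..} (kint b)"
  by (rule DERIV_continuous_on) (auto intro: has_field_derivative_at_within kint_has_derivative)

lemma exp_powr_tendsto_0: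
  assumes "p > 0"
  shows "((\<lambda>s::real. exp (- s) * s powr p) \<longlongrightarrow> 0) (at_right 0)"
    and "((\<lambda>s::real. exp (- s) * s powr p) \<longlongrightarrow> 0) at_top"
proof -
  have "((\<lambda>s::real. s powr p) \<longlongrightarrow> 0 powr p) (at_right 0)"
    using assms by (intro tendsto_powr') (auto simp: eventually_at_filter)
  then have "((\<lambda>s::real. exp (- s) * s powr p) \<longlongrightarrow> exp (- 0) * 0) (at_right 0)"
    using assms by (intro tendsto_intros) auto
  then show "((\<lambda>s::real. exp (- s) * s powr p) \<longlongrightarrow> 0) (at_right 0)" by simp
  obtain C where C: "C > 0" "\<And>x. x > 0 \<Longrightarrow> exp (- x) \<le> C * x powr (- (p + 1))"
    using exp_decay_powr[of "p + 1"] assms by auto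
  show "((\<lambda>s::real. exp (- s) * s powr p) \<longlongrightarrow> 0) at_top"
  proof (rule tendsto_sandwich[of "\<lambda>_. 0" _ _ "\<lambda>s. C * inverse s"])
    show "\<forall>\<^sub>F s in at_top. exp (- s) * s powr p \<le> C * inverse s"
      using eventually_gt_at_top[of 0]
    proof eventually_elim
      case (elim s)
      have "exp (- s) * s powr p \<le> C * s powr (- (p + 1)) * s powr p"
        using elim by (intro mult_right_mono C) auto
      also have "\<dots> = C * (s powr (- (p + 1)) * s powr p)" by simp
      also have "s powr (- (p + 1)) * s powr p = s powr (- 1)"
        by (simp add: powr_add[symmetric])
      finally show ?case using elim by (simp add: powr_minus)
    qed
    show "((\<lambda>s. C * inverse s) \<longlongrightarrow> 0) at_top"
      by (intro tendsto_mult_right_zero tendsto_inverse_0_at_top filterlim_ident)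
  qed auto
qed

text \<open>
  The derivative of the kernel in \<open>s\<close> has integral 0.
\<close>
lemma kint_lower:
  assumes w: "w > 0"
  shows "w * kint (b + 2) w = (b + 1) * kint (b + 1) w + kint b w"
proof -
  let ?K = "\<lambda>p s. kint_kernel p w s"
  have "\<bar>b\<bar> + 2 \<ge> 0" by simp
  from kint_kernel_bound[OF this] obtain C where C: "C > 0" "\<And>s. s > 0 \<Longrightarrow> kint_kernel b w s
      \<le> C * w powr (- (\<bar>b\<bar> + 2)) * (exp (- s) * s powr ((\<bar>b\<bar> + 2) - b - 1))"
    using w by blast
  have lim: "(?K b \<longlongrightarrow> 0) F"
    if F: "\<forall>\<^sub>F s in F. s > 0" "((\<lambda>s::real. exp (- s) * s powr ((\<bar>b\<bar> + 2) - b - 1)) \<longlongrightarrow> 0) F" for F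
  proof (rule tendsto_sandwich[OF _ _ tendsto_const])
    show "((\<lambda>s. C * w powr (- (\<bar>b\<bar> + 2)) * (exp (- s) * s powr ((\<bar>b\<bar> + 2) - b - 1))) \<longlongrightarrow> 0) F"
      by (intro tendsto_mult_right_zero F)
    show "\<forall>\<^sub>F s in F. ?K b s \<le> C * w powr (- (\<bar>b\<bar> + 2)) * (exp (- s) * s powr ((\<bar>b\<bar> + 2) - b - 1))"
      using F(1) by eventually_elim (use C(2) w in auto)
  qed auto
  have int: "integrable lpos (?K p)" for p using w by (rule kint_kernel_integrable)
  have eq: "(- 1 + w / s\<^sup>2 - (b + 1) / s) * ?K b s = - ?K b s + w * ?K (b + 2) s - (b + 1) * ?K (b + 1) s"
    if "s > 0" for s
  proof -
    have "- (b + 2) - 1 = (- b - 1) - 2" "- (b + 1) - 1 = (- b - 1) - 1" by simp_all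
    then have "s powr (- (b + 2) - 1) = s powr (- b - 1) / s powr 2" "s powr (- (b + 1) - 1) = s powr (- b - 1) / s powr 1"
      by (simp_all only: powr_diff)
    moreover have "s powr 2 = s\<^sup>2" "s powr 1 = s" using that by simp_all
    ultimately have p: "s powr (- (b + 2) - 1) = s powr (- b - 1) / s\<^sup>2" "s powr (- (b + 1) - 1) = s powr (- b - 1) / s"
      by (simp_all only:)
    show ?thesis unfolding p by (simp add: divide_inverse algebra_simps)
  qed
  have "(\<integral>s. - ?K b s + w * ?K (b + 2) s - (b + 1) * ?K (b + 1) s \<partial>lpos) = 0 - 0"
  proof (rule integral_lpos_FTC[where F = "?K b"])
    fix s :: real assume s: "s > 0"
    have "(?K b has_real_derivative (exp (- s - w / s) * (- 1 + w / (s * s))) * s powr (- b - 1)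
        + ((- b - 1) * s powr (- b - 1 - 1)) * exp (- s - w / s)) (at s)"
      using s by (auto intro!: derivative_eq_intros)
    moreover have "s powr (- b - 1 - 1) = s powr (- b - 1) / s"
      using s powr_diff[of s "- b - 1" 1] by (simp only: powr_one)
    ultimately have "(?K b has_real_derivative (- 1 + w / s\<^sup>2 - (b + 1) / s) * ?K b s) (at s)"
      by (simp add: algebra_simps power2_eq_square add_divide_distrib)
    then show "(?K b has_real_derivative - ?K b s + w * ?K (b + 2) s - (b + 1) * ?K (b + 1) s) (at s)"
      using eq[OF s] by simp
  next
    show "(?K b \<longlongrightarrow> 0) (at_right 0)" "(?K b \<longlongrightarrow> 0) at_top"
      by (intro lim exp_powr_tendsto_0; auto simp: eventually_at_filter eventually_gt_at_top)+
  next
    show "integrable lpos (\<lambda>s. - ?K b s + w * ?K (b + 2) s - (b + 1) * ?K (b + 1) s)"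
      by (intro Bochner_Integration.integrable_add Bochner_Integration.integrable_diff integrable_minus
          integrable_mult_right int)
  qed (auto intro!: continuous_intros)
  moreover have "(\<integral>s. - ?K b s + w * ?K (b + 2) s - (b + 1) * ?K (b + 1) s \<partial>lpos)
      = - kint b w + w * kint (b + 2) w - (b + 1) * kint (b + 1) w"
    unfolding kint_def using int[of b] int[of "b+1"] int[of "b+2"] by simp
  ultimately show ?thesis by simp
qed

lemma kint_tendsto_0:
  assumes "b < 0"
  shows "(kint b \<longlongrightarrow> Gamma (- b)) (at_right 0)"
proof -
  have "((\<lambda>w. \<integral>s. kint_kernel b w s \<partial>lpos) \<longlongrightarrow>
      (\<integral>s. exp (- s) * s powr (- b - 1) \<partial>lpos)) (at 0 within {0<..})"
  proof (rule integral_tendsto_dominated[where w = "\<lambda>s. exp (- s) * s powr (- b - 1)"])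
    fix s assume "s \<in> space lpos"
    then have s: "s > 0" by (simp add: space_lpos)
    have "((\<lambda>w. kint_kernel b w s) \<longlongrightarrow> kint_kernel b 0 s) (at 0 within {0<..})"
      using s by (intro tendsto_intros) auto
    then show "((\<lambda>w. kint_kernel b w s) \<longlongrightarrow> exp (- s) * s powr (- b - 1)) (at 0 within {0<..})"
      by simp
    fix w :: real assume "w \<in> {0<..}"
    then show "\<bar>kint_kernel b w s\<bar> \<le> exp (- s) * s powr (- b - 1)"
      using s by (simp add: abs_mult mult_right_mono)
  qed (use assms in \<open>auto intro!: measurable_lposI lpos_Gamma continuous_intros\<close>)
  then show ?thesis
    using assms lpos_Gamma(2)[of "- b - 1"] unfolding kint_def[abs_def] by simp
qed

lemma lpos_iff_absolutely_integrable:
  fixes h :: "real \<Rightarrow> real"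
  assumes "continuous_on {0<..} h"
  shows "h absolutely_integrable_on {0<..} \<and> integral {0<..} h = I \<longleftrightarrow> integrable lpos h \<and> integral\<^sup>L lpos h = I"
proof -
  have m: "(\<lambda>x. indicator {0<..} x *\<^sub>R h x) \<in> borel_measurable lborel"
    using borel_measurable_continuous_on_indicator[OF _ assms] by simp
  have "h absolutely_integrable_on {0<..} \<longleftrightarrow> integrable lpos h"
    unfolding integrable_lpos_iff set_integrable_def by (rule integrable_completion[OF m])
  moreover have "integral {0<..} h = integral\<^sup>L lpos h" if "integrable lpos h"
    using that by (simp add: integrable_lpos_iff integral_lpos_eq set_borel_integral_eq_integral)
  ultimately show ?thesis by auto
qed

lemma lpos_substitution:
  fixes f g g' :: "real \<Rightarrow> real"
  assumes g: "\<And>x. x > 0 \<Longrightarrow> (g has_real_derivative g' x) (at x)" "inj_on g {0<..}" "g ` {0<..} = {0<..}"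
    and f: "continuous_on {0<..} f" "integrable lpos f" and g': "continuous_on {0<..} g'"
  shows "integrable lpos (\<lambda>x. \<bar>g' x\<bar> * f (g x)) \<and> (\<integral>x. \<bar>g' x\<bar> * f (g x) \<partial>lpos) = (\<integral>x. f x \<partial>lpos)"
proof -
  have cg: "continuous_on {0<..} g"
    using g(1) by (intro DERIV_continuous_on) (auto intro: has_field_derivative_at_within)
  have "continuous_on {0<..} (\<lambda>x. f (g x))"
    by (rule continuous_on_compose2[OF f(1) cg]) (use g(3) in auto)
  then have c: "continuous_on {0<..} (\<lambda>x. \<bar>g' x\<bar> * f (g x))"
    by (intro continuous_intros g')
  have "f absolutely_integrable_on (g ` {0<..}) \<and> integral (g ` {0<..}) f = integral\<^sup>L lpos f"
    using lpos_iff_absolutely_integrable[OF f(1)] f(2) g(3) by auto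
  then have "(\<lambda>x. \<bar>g' x\<bar> * f (g x)) absolutely_integrable_on {0<..} \<and>
      integral {0<..} (\<lambda>x. \<bar>g' x\<bar> * f (g x)) = integral\<^sup>L lpos f"
    by (subst has_absolute_integral_change_of_variables_1')
       (auto intro: has_field_derivative_at_within g)
  then show ?thesis using lpos_iff_absolutely_integrable[OF c] by blast
qed

lemma kint_inversion:
  assumes w: "w > 0"
  shows "kint c w = w powr (- c) * kint (- c) w"
proof -
  let ?f = "\<lambda>s. kint_kernel c w s"
  let ?g' = "\<lambda>r. - (w / r\<^sup>2)"
  have "integrable lpos (\<lambda>r. \<bar>?g' r\<bar> * ?f (w / r)) \<and> (\<integral>r. \<bar>?g' r\<bar> * ?f (w / r) \<partial>lpos) = (\<integral>x. ?f x \<partial>lpos)"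
  proof (rule lpos_substitution)
    show "((\<lambda>r. w / r) has_real_derivative ?g' r) (at r)" if "r > 0" for r
      using that by (auto intro!: derivative_eq_intros simp: power2_eq_square)
    show "inj_on (\<lambda>r. w / r) {0<..}" using w by (auto simp: inj_on_def field_simps)
    show "(\<lambda>r. w / r) ` {0<..} = {0<..}"
    proof (intro equalityI subsetI)
      fix x assume "x \<in> {0::real<..}"
      then have "x = w / (w / x)" "w / x \<in> {0<..}" using w by auto
      then show "x \<in> (\<lambda>r. w / r) ` {0<..}" by blast
    qed (use w in auto)
    show "continuous_on {0<..} ?g'" by (auto intro!: continuous_intros)
  qed (use w in \<open>auto intro!: kint_kernel_cont kint_kernel_integrable\<close>)
  moreover have "\<bar>?g' r\<bar> * ?f (w / r) = w powr (- c) * (kint_kernel (- c) w r)"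
    if r: "r > 0" for r
  proof -
    have "(w / r) powr (- c - 1) = w powr (- c - 1) * r powr (c + 1)"
    proof -
      have "- c - 1 = - (c + 1)" by simp
      then have "r powr (- c - 1) = inverse (r powr (c + 1))" by (simp only: powr_minus)
      moreover have "(w / r) powr (- c - 1) = w powr (- c - 1) / r powr (- c - 1)"
        using w r by (simp add: powr_divide)
      ultimately show ?thesis by (simp only: divide_inverse inverse_inverse_eq)
    qed
    also have "\<dots> = (w powr (- c) / w) * (r powr (c - 1) * r\<^sup>2)"
    proof -
      have "c + 1 = (c - 1) + 2" by simp
      then have "r powr (c + 1) = r powr (c - 1) * r powr 2" by (simp only: powr_add)
      then show ?thesis using w r powr_diff[of w "- c" 1] by simp
    qed
    finally have p: "(w / r) powr (- c - 1) = w powr (- c) / w * (r powr (c - 1) * r\<^sup>2)" .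
    have "\<bar>?g' r\<bar> = w / r\<^sup>2" "- (w / r) - w / (w / r) = - r - w / r" "- (- c) - 1 = c - 1"
      using w r by simp_all
    then show ?thesis unfolding p using w r by (simp only:) (simp add: mult_ac)
  qed
  then have "(\<integral>r. \<bar>?g' r\<bar> * ?f (w / r) \<partial>lpos) =
      (\<integral>r. w powr (- c) * (kint_kernel (- c) w r) \<partial>lpos)"
    by (intro Bochner_Integration.integral_cong) (auto simp: space_lpos)
  ultimately show ?thesis by (simp add: kint_def)
qed

text \<open>
  The quotient in the definition of \<open>K\<close>, rescaled and written in the variable \<open>w = z\<^sup>2/4\<close>.
\<close>
definition kseries :: "real \<Rightarrow> real \<Rightarrow> real" where
  "kseries b w = pi / sin (b * pi) * (w powr (- b) * clifford (- b) w - clifford b w)"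

lemma powr_clifford_has_derivative:
  assumes w: "w > 0"
  shows "((\<lambda>w. w powr (- b) * clifford (- b) w) has_real_derivative
     w powr (- (b + 1)) * clifford (- (b + 1)) w) (at w)"
proof -
  have "((\<lambda>w. w powr (- b) * clifford (- b) w) has_real_derivative
     (- b * w powr (- b - 1)) * clifford (- b) w + w powr (- b) * clifford (- b + 1) w) (at w)"
    using w by (auto intro!: derivative_eq_intros simp: field_simps)
  moreover have p: "w powr (- b) = w powr (- (b + 1)) * w"
    using w powr_add[of w "- (b + 1)" 1] by simp
  moreover have "- b - 1 = - (b + 1)" by simp
  moreover have c: "clifford (- (b + 1)) w = - b * clifford (- b) w + w * clifford (- b + 1) w"
    using clifford_lower[of "- (b + 1)" w] by (simp add: algebra_simps)
  have "(- b * w powr (- (b + 1))) * clifford (- b) w + w powr (- (b + 1)) * w * clifford (- b + 1) w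
     = w powr (- (b + 1)) * clifford (- (b + 1)) w"
    unfolding c by (simp only: algebra_simps)
  ultimately show ?thesis by (simp only:)
qed

lemma kseries_has_derivative:
  assumes w: "w > 0"
  shows "(kseries b has_real_derivative - kseries (b + 1) w) (at w)"
proof -
  have s: "pi / sin ((b + 1) * pi) = - (pi / sin (b * pi))" by (simp add: distrib_right)
  have "(kseries b has_real_derivative pi / sin (b * pi) *
      (w powr (- (b + 1)) * clifford (- (b + 1)) w - clifford (b + 1) w)) (at w)"
    unfolding kseries_def[abs_def]
    by (intro DERIV_cmult DERIV_diff powr_clifford_has_derivative[OF w] clifford_has_derivative)
  then show ?thesis unfolding kseries_def s by simp
qed

lemma kseries_lower:
  assumes w: "w > 0"
  shows "w * kseries (b + 2) w = (b + 1) * kseries (b + 1) w + kseries b w"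
proof -
  have s: "sin ((b + 1) * pi) = - sin (b * pi)" "sin ((b + 2) * pi) = sin (b * pi)"
    by (simp_all add: distrib_right sin_add)
  have p: "w powr (- b) = w powr (- b - 2) * w\<^sup>2" "w powr (- (b + 1)) = w powr (- b - 2) * w"
    using w powr_add[of w "- b - 2" 2] powr_add[of w "- b - 2" 1] by (simp_all add: algebra_simps)
  have c: "clifford (- (b + 2)) w = - (b + 1) * clifford (- (b + 1)) w + w * clifford (- b) w"
    using clifford_lower[of "- (b + 2)" w] by (simp add: algebra_simps)
  have c': "w * clifford (b + 2) w = clifford b w - (b + 1) * clifford (b + 1) w"
    using clifford_lower[of b w] by simp
  let ?P = "w powr (- b - 2)"
  have "w * (w powr (- (b + 2)) * clifford (- (b + 2)) w - clifford (b + 2) w)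
     = w * ?P * clifford (- (b + 2)) w - w * clifford (b + 2) w" by (simp add: algebra_simps)
  also have "\<dots> = (w powr (- b) * clifford (- b) w - clifford b w)
      - (b + 1) * (w powr (- (b + 1)) * clifford (- (b + 1)) w - clifford (b + 1) w)"
    unfolding c c' p by (simp add: algebra_simps power2_eq_square)
  finally have "w * (w powr (- (b + 2)) * clifford (- (b + 2)) w - clifford (b + 2) w) =
     (w powr (- b) * clifford (- b) w - clifford b w)
      - (b + 1) * (w powr (- (b + 1)) * clifford (- (b + 1)) w - clifford (b + 1) w)" .
  then have "c * (w * (w powr (- (b + 2)) * clifford (- (b + 2)) w - clifford (b + 2) w)) =
     c * ((w powr (- b) * clifford (- b) w - clifford b w)
      - (b + 1) * (w powr (- (b + 1)) * clifford (- (b + 1)) w - clifford (b + 1) w))" for c by (simp only:)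
  from this[of "pi / sin (b * pi)"] show ?thesis
    unfolding kseries_def s minus_divide_right[symmetric]
    by (simp only: algebra_simps mult_minus_left mult_minus_right mult_1)
qed

lemma const_from_limit:
  fixes h :: "real \<Rightarrow> real"
  assumes d: "\<And>w. w > 0 \<Longrightarrow> (h has_real_derivative 0) (at w)" and l: "(h \<longlongrightarrow> L) (at_right 0)" and w: "w > 0"
  shows "h w = L"
proof -
  obtain c where c: "\<And>x. x > 0 \<Longrightarrow> h x = c"
    using has_field_derivative_zero_constant[of "{0<..}" h] d by (auto intro: has_field_derivative_at_within)
  have "(h \<longlongrightarrow> c) (at_right 0)"
    by (rule Lim_transform_eventually[OF tendsto_const]) (auto simp: eventually_at_filter c)
  with l have "L = c" by (intro tendsto_unique) auto
  then show ?thesis using c w by simp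
qed

lemma Gamma_reflection_real: "Gamma z * Gamma (1 - z) = pi / sin (z * pi)" for z :: real
proof -
  have "Gamma (complex_of_real z) * Gamma (complex_of_real (1 - z)) = of_real pi / sin (complex_of_real (z * pi))"
    using Gamma_reflection_complex[of "of_real z"] by (simp add: mult.commute)
  then have "complex_of_real (Gamma z * Gamma (1 - z)) = complex_of_real (pi / sin (z * pi))"
    unfolding sin_of_real by (simp only: Gamma_complex_of_real of_real_mult of_real_divide)
  then show ?thesis by (simp only: of_real_eq_iff)
qed

text \<open>
  The difference \<open>d\<close> of the two sides solves the same Bessel equation as the function
  \<open>clifford b\<close>, which is positive on the half-line. The Wronskian, weighted to be constant, tends to 0 at 0: for orders between
  \<open>-1\<close> and \<open>0\<close>, both the values and the weighted derivatives of the two sides have equal limits, by the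
  reflection formula for \<open>Gamma\<close>. Hence \<open>d / clifford b\<close> is constant, and it tends to 0 as well.
\<close>
lemma kint_eq_kseries_base:
  assumes b: "-1 < b" "b < 0" and w: "w > 0"
  shows "kint b w = kseries b w"
proof -
  define d where "d = (\<lambda>w. kint b w - kseries b w)"
  define e where "e = (\<lambda>w. kint (b + 1) w - kseries (b + 1) w)"
  let ?y = "clifford b" and ?y1 = "clifford (b + 1)"
  have d': "(d has_real_derivative - e w) (at w)" if "w > 0" for w
    unfolding d_def e_def using that
    by (auto intro!: derivative_eq_intros kint_has_derivative kseries_has_derivative)
  have e': "(e has_real_derivative - (((b + 1) * e w + d w) / w)) (at w)" if w: "w > 0" for w
  proof -
    have "(e has_real_derivative (- kint (b + 1 + 1) w - (- kseries (b + 1 + 1) w))) (at w)"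
      unfolding e_def using that
      by (intro derivative_intros kint_has_derivative kseries_has_derivative)
    moreover have "w * (- kint (b + 1 + 1) w - (- kseries (b + 1 + 1) w)) = - ((b + 1) * e w + d w)"
      using kint_lower[OF w, of b] kseries_lower[OF w, of b] unfolding d_def e_def
      by (simp add: algebra_simps)
    then have "(- kint (b + 1 + 1) w - (- kseries (b + 1 + 1) w)) = - (((b + 1) * e w + d w) / w)"
      using w by (simp add: field_simps)
    ultimately show ?thesis by simp
  qed
  have y0: "?y w > 0" if "w > 0" for w using clifford_pos[of b w] b that by simp
  have lp: "((\<lambda>w::real. w powr p) \<longlongrightarrow> 0) (at_right 0)" if "p > 0" for p
    using that by (intro tendsto_eq_rhs[OF tendsto_powr'[where a = 0 and b = p]])
                  (auto simp: eventually_at_filter)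
  have lc: "(clifford a \<longlongrightarrow> rGamma (a + 1)) (at_right 0)" for a
    using clifford_has_derivative[of a 0, THEN DERIV_isCont] unfolding isCont_def
    by (auto intro: tendsto_within_subset)
  have rg: "rGamma x * Gamma x = 1" if "x > 0" for x :: real
    using Gamma_real_pos[OF that] by (simp add: rGamma_inverse_Gamma)
  have dl: "(d \<longlongrightarrow> 0) (at_right 0)"
  proof -
    have "(kseries b \<longlongrightarrow> pi / sin (b * pi) * (0 * rGamma (- b + 1) - rGamma (b + 1))) (at_right 0)"
      unfolding kseries_def[abs_def] using b by (intro tendsto_intros lp lc) auto
    also have "pi / sin (b * pi) * (0 * rGamma (- b + 1) - rGamma (b + 1)) = Gamma (- b)"
    proof -
      have "pi / sin (b * pi) = - (Gamma (b + 1) * Gamma (- b))"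
        using Gamma_reflection_real[of "b + 1"] by (simp add: distrib_right minus_divide_right[symmetric])
      then have "pi / sin (b * pi) * (0 * rGamma (- b + 1) - rGamma (b + 1)) =
          (rGamma (b + 1) * Gamma (b + 1)) * Gamma (- b)"
        by (simp add: algebra_simps)
      then show ?thesis using rg[of "b + 1"] b by simp
    qed
    finally show ?thesis unfolding d_def using tendsto_diff[OF kint_tendsto_0[OF b(2)]] by fastforce
  qed
  have el: "((\<lambda>w. w powr (b + 1) * e w) \<longlongrightarrow> 0) (at_right 0)"
  proof -
    have "((\<lambda>w. pi / sin ((b + 1) * pi) * (clifford (- (b + 1)) w - w powr (b + 1) * clifford (b + 1) w))
        \<longlongrightarrow> pi / sin ((b + 1) * pi) * (rGamma (- (b + 1) + 1) - 0 * rGamma (b + 1 + 1))) (at_right 0)"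
      using b by (intro tendsto_intros lp lc) auto
    also have "pi / sin ((b + 1) * pi) * (rGamma (- (b + 1) + 1) - 0 * rGamma (b + 1 + 1)) = Gamma (b + 1)"
    proof -
      have "pi / sin ((b + 1) * pi) * (rGamma (- (b + 1) + 1) - 0 * rGamma (b + 1 + 1))
          = Gamma (b + 1) * (rGamma (- b) * Gamma (- b))"
        unfolding Gamma_reflection_real[of "b + 1", symmetric] by simp
      then show ?thesis using rg[of "- b"] b by simp
    qed
    finally have "((\<lambda>w. kint (- (b + 1)) w - pi / sin ((b + 1) * pi) *
        (clifford (- (b + 1)) w - w powr (b + 1) * clifford (b + 1) w)) \<longlongrightarrow>
        Gamma (- (- (b + 1))) - Gamma (b + 1)) (at_right 0)"
      using b by (intro tendsto_diff kint_tendsto_0) auto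
    then have "((\<lambda>w. kint (- (b + 1)) w - pi / sin ((b + 1) * pi) *
        (clifford (- (b + 1)) w - w powr (b + 1) * clifford (b + 1) w)) \<longlongrightarrow> 0) (at_right 0)"
      by (simp only: minus_minus diff_self)
    moreover have "kint (- (b + 1)) w - pi / sin ((b + 1) * pi) *
        (clifford (- (b + 1)) w - w powr (b + 1) * clifford (b + 1) w) = w powr (b + 1) * e w"
      if w: "w > 0" for w
    proof -
      have 1: "w powr (b + 1) * w powr (- (b + 1)) = 1"
        unfolding powr_minus using w by simp
      have "w powr (b + 1) * e w = (w powr (b + 1) * w powr (- (b + 1))) * kint (- (b + 1)) w
        - pi / sin ((b + 1) * pi) * ((w powr (b + 1) * w powr (- (b + 1))) * clifford (- (b + 1)) w
            - w powr (b + 1) * clifford (b + 1) w)"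
        unfolding e_def kseries_def kint_inversion[OF w, of "b + 1"]
        by (simp only: algebra_simps)
      then show ?thesis unfolding 1 by simp
    qed
    ultimately show ?thesis
      by (rule_tac Lim_transform_eventually) (auto simp: eventually_at_filter)
  qed
  define W where "W = (\<lambda>w. w powr (b + 1) * (d w * ?y1 w + e w * ?y w))"
  have "W w = 0" if "w > 0" for w
  proof (rule const_from_limit[OF _ _ that])
    fix w :: real assume w: "w > 0"
    have y2: "clifford (b + 2) w = (?y w - (b + 1) * ?y1 w) / w"
      using clifford_lower[of b w] w by (simp add: field_simps)
    have pw: "w powr b = w powr (b + 1) / w" using w by (simp add: powr_add)
    show "(W has_real_derivative 0) (at w)" unfolding W_def
      by (rule derivative_eq_intros refl d' e' clifford_has_derivative w)+
         (use w in \<open>simp add: y2 pw field_simps\<close>)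
  next
    have "((\<lambda>w. w powr (b + 1) * (d w * ?y1 w) + (w powr (b + 1) * e w) * ?y w) \<longlongrightarrow>
       0 * (0 * rGamma (b + 1 + 1)) + 0 * rGamma (b + 1)) (at_right 0)"
      using b by (intro tendsto_intros dl el lc lp) auto
    then show "(W \<longlongrightarrow> 0) (at_right 0)" unfolding W_def by (simp add: algebra_simps)
  qed
  then have W0: "d w * ?y1 w + e w * ?y w = 0" if "w > 0" for w
    using that unfolding W_def by auto
  have "d w / ?y w = 0"
  proof (rule const_from_limit[OF _ _ w])
    fix w :: real assume w: "w > 0"
    show "((\<lambda>w. d w / ?y w) has_real_derivative 0) (at w)"
      by (rule derivative_eq_intros refl d' clifford_has_derivative w)+
         (use y0[OF w] W0[OF w] in auto)
  next
    have "rGamma (b + 1) \<noteq> 0" using rg[of "b + 1"] b by auto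
    then have "((\<lambda>w. d w / ?y w) \<longlongrightarrow> 0 / rGamma (b + 1)) (at_right 0)"
      by (intro tendsto_intros dl lc)
    then show "((\<lambda>w. d w / ?y w) \<longlongrightarrow> 0) (at_right 0)" by simp
  qed
  then show ?thesis using y0[OF w] by (simp add: d_def)
qed

lemma kint_eq_kseries_shift:
  assumes "\<And>w. w > 0 \<Longrightarrow> kint b w = kseries b w" "w > 0"
  shows "kint (b + 1) w = kseries (b + 1) w"
proof -
  have "(kint b has_real_derivative - kseries (b + 1) w) (at w)"
    using kseries_has_derivative[OF assms(2), of b]
    by (rule has_field_derivative_transform_within_open[of _ _ _ "{0<..}"]) (use assms in auto)
  from DERIV_unique[OF this kint_has_derivative[OF assms(2)]] show ?thesis by simp
qed

text \<open>
  Differentiation raises the order by one on both sides, so the orders in \<open>(-1, 0)\<close> suffice.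
\<close>
lemma kint_eq_kseries:
  assumes "b > -1" "b \<notin> \<int>" "w > 0"
  shows "kint b w = kseries b w"
proof -
  define c where "c = frac b - 1"
  have "frac b \<noteq> 0" using assms(2) by (simp add: frac_eq_0_iff)
  then have c: "-1 < c" "c < 0"
    using frac_lt_1[of b] frac_ge_0[of b] unfolding c_def by linarith+
  have "kint (c + real n) w = kseries (c + real n) w" if "w > 0" for n w
    using that
  proof (induction n arbitrary: w)
    case 0
    then show ?case using kint_eq_kseries_base[OF c] by simp
  next
    case (Suc n)
    from kint_eq_kseries_shift[OF Suc(1) Suc(2)] show ?case by (simp add: add_ac)
  qed
  moreover have "b = c + real (nat (\<lfloor>b\<rfloor> + 1))"
    using assms(1) unfolding c_def frac_def by (simp add: of_nat_nat) linarith
  ultimately show ?thesis using assms(3) by metis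
qed

lemma kint_tendsto_order:
  assumes w: "w > 0"
  shows "((\<lambda>b. kint b w) \<longlongrightarrow> kint a w) (at a)"
proof -
  have "((\<lambda>b. \<integral>s. kint_kernel b w s \<partial>lpos) \<longlongrightarrow>
      (\<integral>s. kint_kernel a w s \<partial>lpos)) (at a within {a-1<..<a+1})"
  proof (rule integral_tendsto_dominated[where w = "\<lambda>s. kint_kernel (a - 1) w s
        + kint_kernel (a + 1) w s"])
    fix s assume "s \<in> space lpos"
    then have s: "s > 0" by (simp add: space_lpos)
    show "((\<lambda>b. kint_kernel b w s) \<longlongrightarrow> kint_kernel a w s)
        (at a within {a-1<..<a+1})"
      using s by (intro tendsto_intros) auto
    fix b :: real assume b: "b \<in> {a-1<..<a+1}"
    have "s powr (- b - 1) \<le> s powr (- (a - 1) - 1) + s powr (- (a + 1) - 1)"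
    proof (cases "s \<ge> 1")
      case True
      then have "s powr (- b - 1) \<le> s powr (- (a - 1) - 1)" using b by (intro powr_mono) auto
      then show ?thesis using powr_ge_zero[of s "- (a + 1) - 1"] by linarith
    next
      case False
      then have "s powr (- b - 1) \<le> s powr (- (a + 1) - 1)" using b s by (intro powr_mono') auto
      then show ?thesis using powr_ge_zero[of s "- (a - 1) - 1"] by linarith
    qed
    then have "kint_kernel b w s \<le>
        exp (- s - w / s) * (s powr (- (a - 1) - 1) + s powr (- (a + 1) - 1))"
      by (intro mult_left_mono) auto
    then show "\<bar>kint_kernel b w s\<bar> \<le> kint_kernel (a - 1) w s
        + kint_kernel (a + 1) w s"
      by (simp add: abs_mult distrib_left)
  next
    show "integrable lpos (\<lambda>s. kint_kernel (a - 1) w s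
        + kint_kernel (a + 1) w s)"
      using w by (intro Bochner_Integration.integrable_add kint_kernel_integrable)
  qed (auto intro!: measurable_lposI continuous_intros)
  then show ?thesis unfolding kint_def[symmetric] by (simp add: at_within_open[of _ "{a-1<..<a+1}"])
qed

text \<open>
  At an integer order \<open>K\<close> is a limit over neighbouring orders, and \<open>kint\<close> is continuous in the order.
\<close>
lemma bessel_K_norm_eq_kint:
  assumes b: "b > -1" and z: "z > 0"
  shows "bessel_K_norm b z = kint b (z\<^sup>2 / 4) / 2"
proof -
  define w where "w = z\<^sup>2 / 4"
  have w: "w > 0" using z by (simp add: w_def)
  have wz: "w powr p = (z / 2) powr (2 * p)" for p
    using z powr_powr[of "z / 2" 2 p] by (simp add: w_def power2_eq_square field_simps)
  define F where "F = (\<lambda>\<beta>. pi / 2 * ((bessel_I (- \<beta>) z - bessel_I \<beta> z) / sin (\<beta> * pi)))"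
  have I: "bessel_I \<beta> z = (z / 2) powr \<beta> * clifford \<beta> w" for \<beta>
    using bessel_I_norm_pos[OF z, of \<beta>] z unfolding bessel_I_norm_clifford w_def
    by (simp add: powr_minus field_simps)
  have F: "F \<beta> = (z / 2) powr \<beta> * (kint \<beta> w / 2)" if "\<beta> \<notin> \<int>" "\<beta> > -1" for \<beta>
  proof -
    have e: "(z / 2) powr \<beta> * w powr (- \<beta>) = (z / 2) powr (- \<beta>)"
      unfolding wz by (simp add: powr_add[symmetric])
    have "F \<beta> = pi / (2 * sin (\<beta> * pi)) * ((z / 2) powr (- \<beta>) * clifford (- \<beta>) w
        - (z / 2) powr \<beta> * clifford \<beta> w)"
      unfolding F_def I by simp
    also have "\<dots> = (z / 2) powr \<beta> * (pi / sin (\<beta> * pi) * (w powr (- \<beta>) * clifford (- \<beta>) w - clifford \<beta> w) / 2)"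
      unfolding e[symmetric] by (simp add: algebra_simps)
    finally show ?thesis unfolding kint_eq_kseries[OF that(2,1) w] kseries_def .
  qed
  have "bessel_K b z = (z / 2) powr b * (kint b w / 2)"
  proof (cases "b \<in> \<int>")
    case False
    then show ?thesis using F[OF False b] unfolding bessel_K_def F_def by simp
  next
    case True
    have "((\<lambda>\<beta>. (z / 2) powr \<beta> * (kint \<beta> w / 2)) \<longlongrightarrow> (z / 2) powr b * (kint b w / 2)) (at b)"
      using z by (intro tendsto_intros kint_tendsto_order w) auto
    moreover have "\<forall>\<^sub>F \<beta> in at b. (z / 2) powr \<beta> * (kint \<beta> w / 2) = F \<beta>"
    proof -
      have "\<forall>\<^sub>F \<beta> in at b. \<beta> \<in> {b - 1 <..< b + 1}" by (intro eventually_at_in_open') auto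
      moreover have "\<forall>\<^sub>F \<beta> in at b. \<beta> > -1" using b by (intro order_tendstoD(1)[OF tendsto_ident_at])
      moreover have "\<forall>\<^sub>F \<beta> in at b. \<beta> \<noteq> b" by (simp add: eventually_at_filter)
      ultimately show ?thesis
      proof eventually_elim
        case (elim \<beta>)
        have "\<beta> \<notin> \<int>"
        proof
          assume "\<beta> \<in> \<int>"
          with True obtain m n where "\<beta> = of_int m" "b = of_int n" by (auto elim!: Ints_cases)
          with elim show False by auto
        qed
        with elim F show ?case by simp
      qed
    qed
    ultimately have "(F \<longlongrightarrow> (z / 2) powr b * (kint b w / 2)) (at b)"
      by (rule Lim_transform_eventually)
    then have "Lim (at b) F = (z / 2) powr b * (kint b w / 2)" by (intro tendsto_Lim) auto
    with True show ?thesis unfolding bessel_K_def F_def by simp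
  qed
  then show ?thesis using z unfolding bessel_K_norm_def w_def by (simp add: powr_minus field_simps)
qed

section \<open>Gegenbauer polynomials\<close>

unbundle no vec_syntax
unbundle fps_syntax

text \<open>
  Derivative of a family of power series in a parameter, coefficient by coefficient; convergence
  of the series is not involved.
\<close>
definition has_coeff_deriv :: "(real \<Rightarrow> real fps) \<Rightarrow> real fps \<Rightarrow> real \<Rightarrow> bool" where
  "has_coeff_deriv F F' x \<longleftrightarrow> (\<forall>n. ((\<lambda>x. F x $ n) has_real_derivative F' $ n) (at x))"

lemma has_coeff_deriv_const: "has_coeff_deriv (\<lambda>_. F) 0 x"
  by (simp add: has_coeff_deriv_def)

lemma has_coeff_deriv_mult:
  assumes "has_coeff_deriv F F' x" "has_coeff_deriv G G' x"
  shows "has_coeff_deriv (\<lambda>x. F x * G x) (F' * G x + F x * G') x"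
  unfolding has_coeff_deriv_def
proof
  fix n
  show "((\<lambda>x. (F x * G x) $ n) has_real_derivative (F' * G x + F x * G') $ n) (at x)"
    using assms unfolding has_coeff_deriv_def fps_mult_nth fps_add_nth sum.distrib[symmetric]
    by (auto intro!: derivative_eq_intros simp: add.commute mult.commute)
qed

lemma has_coeff_deriv_power:
  assumes "has_coeff_deriv F F' x"
  shows "has_coeff_deriv (\<lambda>x. F x ^ n) (of_nat n * F x ^ (n - 1) * F') x"
proof (induction n)
  case 0
  then show ?case using has_coeff_deriv_const[of 1] by simp
next
  case (Suc n)
  have "F' * F x ^ n + F x * (of_nat n * F x ^ (n - 1) * F') = of_nat (Suc n) * F x ^ (Suc n - 1) * F'"
    by (cases n) (simp_all add: algebra_simps)
  with has_coeff_deriv_mult[OF assms Suc] show ?case by simp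
qed

lemma fps_power_nth_below: "i > n \<Longrightarrow> W $ 0 = 0 \<Longrightarrow> (W ^ i) $ n = 0" for W :: "real fps"
  using startsby_zero_power_prefix[of W i] by auto

text \<open>
  Since \<open>W x\<close> has no constant term, each coefficient of the composition is a finite sum, and the
  product rule applies to its terms.
\<close>
lemma has_coeff_deriv_compose:
  assumes B: "has_coeff_deriv B B' x" and W: "has_coeff_deriv W W' x"
    and W0: "W x $ 0 = 0" "W' $ 0 = 0"
  shows "has_coeff_deriv (\<lambda>x. B x oo W x) ((B' oo W x) + (fps_deriv (B x) oo W x) * W') x"
  unfolding has_coeff_deriv_def
proof
  fix n
  let ?W = "W x"
  have "((\<lambda>x. B x $ i * (W x ^ i) $ n) has_real_derivative
      B' $ i * (?W ^ i) $ n + B x $ i * (of_nat i * ?W ^ (i - 1) * W') $ n) (at x)" for i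
    using B has_coeff_deriv_power[OF W, of i] unfolding has_coeff_deriv_def
    by (auto intro!: derivative_eq_intros)
  then have "((\<lambda>x. (B x oo W x) $ n) has_real_derivative
      (\<Sum>i=0..n. B' $ i * (?W ^ i) $ n + B x $ i * (of_nat i * ?W ^ (i - 1) * W') $ n)) (at x)"
    unfolding fps_compose_nth by (intro DERIV_sum)
  moreover have "((fps_deriv (B x) oo ?W) * W') $ n = (\<Sum>i=0..n. B x $ i * (of_nat i * ?W ^ (i - 1) * W') $ n)"
  proof -
    have nth: "(fps_deriv (B x) oo ?W) $ k = (\<Sum>i=0..n. of_nat (Suc i) * B x $ Suc i * (?W ^ i) $ k)" if "k \<le> n" for k
      unfolding fps_compose_nth using that
      by (intro sum.mono_neutral_cong_left) (auto simp: fps_power_nth_below W0)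
    have "((fps_deriv (B x) oo ?W) * W') $ n
        = (\<Sum>k=0..n. \<Sum>i=0..n. of_nat (Suc i) * B x $ Suc i * ((?W ^ i) $ k * W' $ (n - k)))"
      unfolding fps_mult_nth by (intro sum.cong refl) (simp add: nth sum_distrib_right mult.assoc)
    also have "\<dots> = (\<Sum>i=0..n. of_nat (Suc i) * B x $ Suc i * (?W ^ i * W') $ n)"
      by (subst sum.swap) (simp add: sum_distrib_left fps_mult_nth)
    also have "\<dots> = (\<Sum>i=0..n. B x $ Suc i * (of_nat (Suc i) * ?W ^ (Suc i - 1) * W') $ n)"
      by (intro sum.cong refl) (simp add: mult.assoc fps_of_nat[symmetric] del: of_nat_Suc)
    also have "\<dots> = (\<Sum>i=Suc 0..Suc n. B x $ i * (of_nat i * ?W ^ (i - 1) * W') $ n)"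
      by (subst sum.shift_bounds_cl_Suc_ivl) simp
    also have "\<dots> = (\<Sum>i=0..n. B x $ i * (of_nat i * ?W ^ (i - 1) * W') $ n)"
    proof -
      have "(?W ^ n * W') $ n = 0"
        unfolding fps_mult_nth
      proof (intro sum.neutral ballI)
        fix k assume k: "k \<in> {0..n}"
        show "(?W ^ n) $ k * W' $ (n - k) = 0"
          using k W0 fps_power_nth_below[of k n ?W] by (cases "k = n") auto
      qed
      then have z: "(of_nat (Suc n) * ?W ^ (Suc n - 1) * W') $ n = 0"
        by (simp add: mult.assoc fps_of_nat[symmetric] del: of_nat_Suc)
      have "(\<Sum>i=Suc 0..Suc n. B x $ i * (of_nat i * ?W ^ (i - 1) * W') $ n)
          = (\<Sum>i=Suc 0..n. B x $ i * (of_nat i * ?W ^ (i - 1) * W') $ n)"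
        using z by (simp del: of_nat_Suc)
      also have "\<dots> = (\<Sum>i=0..n. B x $ i * (of_nat i * ?W ^ (i - 1) * W') $ n)"
        by (simp add: sum.atLeast_Suc_atMost[of 0 n])
      finally show ?thesis .
    qed
    finally show ?thesis .
  qed
  ultimately show "((\<lambda>x. (B x oo W x) $ n) has_real_derivative
      ((B' oo W x) + (fps_deriv (B x) oo W x) * W') $ n) (at x)"
    by (simp add: sum.distrib fps_compose_nth)
qed

text \<open>
  The generating function \<open>(1 - 2xt + t\<^sup>2) powr (-l)\<close> is the series of \<open>(1 - t) powr (-l)\<close> composed
  with \<open>2xt - t\<^sup>2\<close>.
\<close>
definition geg_arg :: "real \<Rightarrow> real fps" where
  "geg_arg x = fps_const (2 * x) * fps_X - fps_X ^ 2"

definition geg_base :: "real \<Rightarrow> real fps" where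
  "geg_base l = Abs_fps (\<lambda>n. pochhammer l n / fact n)"

lemma geg_arg_power_nth:
  "(geg_arg x ^ m) $ n =
     (if m \<le> n \<and> n - m \<le> m then (-1) ^ (n - m) * of_nat (m choose (n - m)) * (2 * x) ^ (m - (n - m)) else 0)"
proof -
  have "geg_arg x = fps_X * (fps_const (2 * x) - fps_X)"
    unfolding geg_arg_def by (simp add: algebra_simps power2_eq_square)
  then have 1: "(geg_arg x ^ m) $ n = (if n < m then 0 else ((- fps_X + fps_const (2 * x)) ^ m) $ (n - m))"
    by (simp add: power_mult_distrib fps_X_power_mult_nth)
  have 2: "((- fps_X + fps_const c) ^ m) $ k = (if k \<le> m then (-1) ^ k * of_nat (m choose k) * c ^ (m - k) else 0)"
    for c :: real and k
  proof -
    have "(- fps_X + fps_const c) ^ m = (\<Sum>k\<le>m. fps_const (of_nat (m choose k) * (-1) ^ k * c ^ (m - k)) * fps_X ^ k)"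
      unfolding binomial_ring
    proof (intro sum.cong refl)
      fix k
      have "(- fps_X :: real fps) ^ k = fps_const ((-1) ^ k) * fps_X ^ k"
        by (subst power_minus) (simp flip: fps_const_power)
      then show "of_nat (m choose k) * (- fps_X) ^ k * fps_const c ^ (m - k)
          = fps_const (of_nat (m choose k) * (-1) ^ k * c ^ (m - k)) * fps_X ^ k"
        by (simp add: fps_of_nat[symmetric] fps_const_power mult_ac flip: fps_const_mult)
    qed
    then have "((- fps_X + fps_const c) ^ m) $ k
        = (\<Sum>i\<le>m. if k = i then of_nat (m choose i) * (-1) ^ i * c ^ (m - i) else 0)"
      by (simp only: fps_sum_nth fps_mult_left_const_nth fps_X_power_nth) (rule sum.cong[OF refl], simp)
    then show ?thesis by (simp add: mult_ac)
  qed
  then show ?thesis unfolding 1 2 by simp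
qed

text \<open>
  The binomial expansion of the powers of \<open>t (2x - t)\<close>, reindexed by \<open>k = n - m\<close>.
\<close>
lemma gegenbauer_fps: "gegenbauer n l x = (geg_base l oo geg_arg x) $ n"
proof -
  let ?t = "\<lambda>m. pochhammer l m / fact m * (geg_arg x ^ m) $ n"
  have "(geg_base l oo geg_arg x) $ n = (\<Sum>m=0..n. ?t m)"
    by (simp add: fps_compose_nth geg_base_def)
  also have "\<dots> = (\<Sum>k=0..n. ?t (n - k))"
    by (subst sum.atLeastAtMost_rev) (auto intro!: sum.cong)
  also have "\<dots> = (\<Sum>k\<le>n div 2. ?t (n - k))"
    by (rule sum.mono_neutral_right) (auto simp: geg_arg_power_nth)
  also have "\<dots> = gegenbauer n l x" unfolding gegenbauer_def
  proof (intro sum.cong refl)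
    fix k assume "k \<in> {..n div 2}"
    then have k: "2 * k \<le> n" by auto
    have c: "real (n - k choose k) = fact (n - k) / (fact k * fact (n - 2 * k))"
      using k by (subst binomial_fact) (auto simp: diff_diff_left mult_2)
    have e: "n - (n - k) = k" "n - k - k = n - 2 * k" "n - k \<le> n" "k \<le> n - k" using k by auto
    show "?t (n - k) = (-1) ^ k * pochhammer l (n - k) / (fact k * fact (n - 2 * k)) * (2 * x) ^ (n - 2 * k)"
      unfolding geg_arg_power_nth e c using e by simp
  qed
  finally show ?thesis by simp
qed

text \<open>
  With \<open>q = 1 - 2xt + t\<^sup>2\<close>, the generating function \<open>F\<close> satisfies \<open>q D = l F\<close>; both the
  \<open>t\<close>-derivative and the \<open>x\<close>-derivative of \<open>F\<close> are elementary multiples of \<open>D\<close>. All relations between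
  the polynomials follow from this.
\<close>
context
  fixes l x :: real
begin

private definition "F = geg_base l oo geg_arg x"
private definition "D = fps_deriv (geg_base l) oo geg_arg x"
private definition "q = 1 - fps_const (2 * x) * fps_X + fps_X ^ 2"

private lemma arg0: "geg_arg x $ 0 = 0" by (simp add: geg_arg_def)

private lemma qD: "q * D = fps_const l * F"
proof -
  have "(1 - fps_X) * fps_deriv (geg_base l) = fps_const l * geg_base l"
  proof (rule fps_ext)
    fix n
    show "((1 - fps_X) * fps_deriv (geg_base l)) $ n = (fps_const l * geg_base l) $ n"
      by (cases n) (simp_all add: geg_base_def left_diff_distrib pochhammer_Suc divide_simps,
           simp_all add: algebra_simps)
  qed
  then have "((1 - fps_X) * fps_deriv (geg_base l)) oo geg_arg x = (fps_const l * geg_base l) oo geg_arg x"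
    by simp
  moreover have "fps_X oo geg_arg x = geg_arg x"
    using arg0 by (auto simp: fps_X_fps_compose fps_eq_iff)
  moreover have "1 - geg_arg x = q" by (simp add: q_def geg_arg_def)
  ultimately show ?thesis
    by (simp add: fps_compose_mult_distrib[OF arg0] fps_compose_sub_distrib F_def D_def)
qed

private lemma F_deriv: "fps_deriv F = D * (fps_const (2 * x) - 2 * fps_X)"
  unfolding F_def D_def
  by (subst fps_compose_deriv[OF arg0]) (simp add: geg_arg_def power2_eq_square algebra_simps)

private lemma F_nth: "F $ n = gegenbauer n l x"
  by (simp add: F_def gegenbauer_fps)

private lemma rec_fps: "q * fps_deriv F = fps_const l * (fps_const (2 * x) - 2 * fps_X) * F"
proof -
  have "q * fps_deriv F = (q * D) * (fps_const (2 * x) - 2 * fps_X)"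
    unfolding F_deriv by (simp only: mult.assoc)
  then show ?thesis unfolding qD by (simp only: mult_ac)
qed

lemma gegenbauer_rec:
  "2 * (real n + 1 + l) * x * gegenbauer (n + 1) l x =
     (real n + 2) * gegenbauer (n + 2) l x + (real n + 2 * l) * gegenbauer n l x"
proof -
  have "(q * fps_deriv F) $ (n + 1) = (fps_const l * (fps_const (2 * x) - 2 * fps_X) * F) $ (n + 1)"
    by (simp only: rec_fps)
  moreover have "(q * fps_deriv F) $ (n + 1) = (real n + 2) * gegenbauer (n + 2) l x
     - 2 * x * (real n + 1) * gegenbauer (n + 1) l x + real n * gegenbauer n l x"
  proof -
    have *: "q * fps_deriv F = fps_deriv F - fps_const (2 * x) * (fps_X * fps_deriv F) + fps_X * (fps_X * fps_deriv F)"
      by (simp add: q_def algebra_simps power2_eq_square)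
    show ?thesis unfolding *
      by (cases n) (simp_all add: F_nth algebra_simps)
  qed
  moreover have "(fps_const l * (fps_const (2 * x) - 2 * fps_X) * F) $ (n + 1)
     = 2 * l * x * gegenbauer (n + 1) l x - 2 * l * gegenbauer n l x"
  proof -
    have "fps_const l * (fps_const (2 * x) - 2 * fps_X) * F
        = fps_const (2 * l * x) * F - fps_const (2 * l) * (fps_X * F)"
      by (simp add: algebra_simps fps_numeral_fps_const flip: fps_const_mult)
    then show ?thesis by (simp add: F_nth)
  qed
  ultimately show ?thesis by (simp add: algebra_simps)
qed

text \<open>
  After multiplication by \<open>q\<close>, the generating functions of both sides are the same multiple of
  \<open>F\<close>, and \<open>q\<close> can be cancelled.
\<close>
lemma gegenbauer_has_derivative:
  "\<exists>d. ((\<lambda>x. gegenbauer n l x) has_real_derivative d) (at x) \<and>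
     (1 - x\<^sup>2) * d = (real n + 2 * l) * x * gegenbauer n l x - (real n + 1) * gegenbauer (n + 1) l x"
proof -
  have "has_coeff_deriv geg_arg (fps_const 2 * fps_X) x"
    unfolding has_coeff_deriv_def geg_arg_def by (auto intro!: derivative_eq_intros)
  from has_coeff_deriv_compose[OF has_coeff_deriv_const this arg0, of "geg_base l"]
  have d: "has_coeff_deriv (\<lambda>x. geg_base l oo geg_arg x) (D * (fps_const 2 * fps_X)) x"
    unfolding D_def by (simp del: fps_compose_0_right)
  have "q * (fps_const (1 - x\<^sup>2) * (D * (fps_const 2 * fps_X)))
      = fps_const (2 * (1 - x\<^sup>2) * l) * fps_X * F"
  proof -
    have "q * (fps_const (1 - x\<^sup>2) * (D * (fps_const 2 * fps_X))) = fps_const (1 - x\<^sup>2) * (fps_const 2 * fps_X) * (q * D)"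
      by (simp only: mult_ac)
    also have "\<dots> = fps_const (1 - x\<^sup>2) * fps_const 2 * fps_const l * fps_X * F"
      unfolding qD by (simp only: mult_ac)
    also have "fps_const (1 - x\<^sup>2) * fps_const 2 * fps_const l = fps_const (2 * (1 - x\<^sup>2) * l)"
      by (simp add: mult_ac)
    finally show ?thesis .
  qed
  also have "\<dots> = q * (fps_const x * fps_X * fps_deriv F + fps_const (2 * l * x) * F - fps_deriv F)"
  proof -
    have "q * (fps_const x * fps_X * fps_deriv F + fps_const (2 * l * x) * F - fps_deriv F)
       = (fps_const x * fps_X - 1) * (q * fps_deriv F) + fps_const (2 * l * x) * q * F"
      by (simp add: algebra_simps)
    also have "\<dots> = (fps_const x * fps_X - 1) * (fps_const l * (fps_const (2 * x) - 2 * fps_X)) * F + fps_const (2 * l * x) * q * F"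
      unfolding rec_fps by (simp only: mult.assoc)
    also have "\<dots> = fps_const (2 * (1 - x\<^sup>2) * l) * fps_X * F"
    proof -
      have c: "fps_const (2 * x) = 2 * fps_const x" "fps_const (2 * l * x) = 2 * fps_const l * fps_const x"
        "fps_const (2 * (1 - x\<^sup>2) * l) = 2 * (1 - fps_const x ^ 2) * fps_const l"
        by (simp_all add: fps_numeral_fps_const fps_const_power flip: fps_const_mult fps_const_sub fps_const_1_eq_1)
      show ?thesis unfolding q_def c by algebra
    qed
    finally show ?thesis by simp
  qed
  finally have eq: "fps_const (1 - x\<^sup>2) * (D * (fps_const 2 * fps_X))
      = fps_const x * fps_X * fps_deriv F + fps_const (2 * l * x) * F - fps_deriv F"
  proof -
    assume *: "q * (fps_const (1 - x\<^sup>2) * (D * (fps_const 2 * fps_X)))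
      = q * (fps_const x * fps_X * fps_deriv F + fps_const (2 * l * x) * F - fps_deriv F)"
    have "q $ 0 = 1" by (simp add: q_def)
    then have "q \<noteq> 0" by auto
    with * show ?thesis by (metis mult_left_cancel)
  qed
  have "(1 - x\<^sup>2) * (D * (fps_const 2 * fps_X)) $ n
      = (fps_const x * (fps_X * fps_deriv F) + fps_const (2 * l * x) * F - fps_deriv F) $ n"
    using arg_cong[OF eq, of "\<lambda>f. f $ n"] by (simp add: mult.assoc)
  also have "\<dots> = (real n + 2 * l) * x * gegenbauer n l x - (real n + 1) * gegenbauer (n + 1) l x"
    by (cases n) (simp_all add: F_nth algebra_simps)
  finally have "(1 - x\<^sup>2) * (D * (fps_const 2 * fps_X)) $ n
      = (real n + 2 * l) * x * gegenbauer n l x - (real n + 1) * gegenbauer (n + 1) l x" .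
  moreover have "((\<lambda>x. gegenbauer n l x) has_real_derivative (D * (fps_const 2 * fps_X)) $ n) (at x)"
    using d unfolding has_coeff_deriv_def gegenbauer_fps by blast
  ultimately show ?thesis by blast
qed

end

text \<open>
  With \<open>Gamma l\<close> moved into the sum, all terms are continuous at \<open>l = 0\<close> if \<open>n \<ge> 1\<close>. So the limit
  that defines the normalized polynomial at \<open>l = 0\<close> is the value of this sum.
\<close>
definition geg_hat :: "nat \<Rightarrow> real \<Rightarrow> real \<Rightarrow> real" where
  "geg_hat n l x =
     (\<Sum>k\<le>n div 2. (-1) ^ k * Gamma (l + real (n - k)) / (fact k * fact (n - 2 * k)) * (2 * x) ^ (n - 2 * k))"

definition geg_hat' :: "nat \<Rightarrow> real \<Rightarrow> real \<Rightarrow> real" where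
  "geg_hat' n l x =
     (\<Sum>k\<le>n div 2. (-1) ^ k * Gamma (l + real (n - k)) / (fact k * fact (n - 2 * k)) *
        (real (n - 2 * k) * (2 * x) ^ (n - 2 * k - 1) * 2))"

lemma geg_hat_has_derivative: "(geg_hat n l has_real_derivative geg_hat' n l x) (at x)"
  unfolding geg_hat_def[abs_def] geg_hat'_def
proof (intro DERIV_sum DERIV_cmult)
  fix k
  have "((\<lambda>x. 2 * x) has_real_derivative 2) (at x)" by (auto intro!: derivative_eq_intros)
  from DERIV_power[OF this, of "n - 2 * k"]
  show "((\<lambda>x. (2 * x) ^ (n - 2 * k)) has_real_derivative real (n - 2 * k) * (2 * x) ^ (n - 2 * k - 1) * 2) (at x)"
    by (simp only: mult_ac diff_Suc_1 One_nat_def)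
qed

lemma geg_hat_eq: 
  assumes "l \<notin> \<int>\<^sub>\<le>\<^sub>0"
  shows "geg_hat n l x = Gamma l * gegenbauer n l x"
proof -
  have "Gamma (l + real m) = Gamma l * pochhammer l m" for m
    using assms by (simp add: pochhammer_Gamma Gamma_eq_zero_iff)
  then show ?thesis
    unfolding geg_hat_def gegenbauer_def sum_distrib_left
    by (intro sum.cong refl) (simp add: mult_ac del: of_nat_diff)
qed

lemma geg_hat_tendsto:
  assumes "l > 0 \<or> l = 0 \<and> n \<ge> 1"
  shows "((\<lambda>s. geg_hat n s x) \<longlongrightarrow> geg_hat n l x) (at l)" "((\<lambda>s. geg_hat' n s x) \<longlongrightarrow> geg_hat' n l x) (at l)"
proof -
  have "l + real (n - k) \<notin> \<int>\<^sub>\<le>\<^sub>0" if "k \<le> n div 2" for k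
  proof -
    have "l + real (n - k) > 0" using assms that by auto
    then show ?thesis by (auto elim!: nonpos_Ints_cases)
  qed
  then show "((\<lambda>s. geg_hat n s x) \<longlongrightarrow> geg_hat n l x) (at l)" "((\<lambda>s. geg_hat' n s x) \<longlongrightarrow> geg_hat' n l x) (at l)"
    unfolding geg_hat_def geg_hat'_def by (auto intro!: tendsto_intros)
qed

lemma gegenbauer_norm_eq_geg_hat:
  assumes "l > 0 \<or> l = 0 \<and> n \<ge> 1"
  shows "gegenbauer_norm n l x = geg_hat n l x"
proof (cases "l = 0")
  case False
  then have "l \<notin> \<int>\<^sub>\<le>\<^sub>0" using assms by (auto elim!: nonpos_Ints_cases)
  with False show ?thesis by (simp add: gegenbauer_norm_def geg_hat_eq)
next
  case True
  have "\<forall>\<^sub>F s in at 0. s \<in> {-1<..<1::real} - {0}" by (intro eventually_at_in_open) auto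
  then have "\<forall>\<^sub>F s in at 0. geg_hat n s x = Gamma s * gegenbauer n s x"
  proof eventually_elim
    case (elim s)
    have "s \<notin> \<int>\<^sub>\<le>\<^sub>0"
    proof
      assume "s \<in> \<int>\<^sub>\<le>\<^sub>0"
      then obtain k where "s = of_int k" by (auto elim!: nonpos_Ints_cases)
      with elim show False by auto
    qed
    then show ?case by (rule geg_hat_eq)
  qed
  from Lim_transform_eventually[OF _ this] geg_hat_tendsto(1)[of 0 n x] assms True
  have "((\<lambda>s. Gamma s * gegenbauer n s x) \<longlongrightarrow> geg_hat n 0 x) (at 0)" by auto
  then have "Lim (at 0) (\<lambda>s. Gamma s * gegenbauer n s x) = geg_hat n 0 x"
    by (intro tendsto_Lim) auto
  with True show ?thesis by (simp add: gegenbauer_norm_def)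
qed

text \<open>
  Carries identities between Gegenbauer polynomials from \<open>l > 0\<close> over to \<open>l = 0\<close>.
\<close>
lemma eq_at_zero_by_limit:
  fixes f :: "real \<Rightarrow> real"
  assumes "\<And>l. l > 0 \<Longrightarrow> f l = 0" "(f \<longlongrightarrow> f 0) (at 0)"
  shows "f 0 = 0"
proof -
  have "(f \<longlongrightarrow> f 0) (at_right 0)" using assms(2) by (rule tendsto_within_subset) auto
  moreover have "(f \<longlongrightarrow> 0) (at_right 0)"
    by (rule Lim_transform_eventually[OF tendsto_const]) (auto simp: eventually_at_filter assms(1))
  ultimately show ?thesis by (intro tendsto_unique) auto
qed

lemma geg_hat_rec:
  assumes "l > 0 \<or> l = 0 \<and> n \<ge> 1"
  shows "2 * (real n + 1 + l) * x * geg_hat (n + 1) l x =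
     (real n + 2) * geg_hat (n + 2) l x + (real n + 2 * l) * geg_hat n l x"
proof -
  let ?f = "\<lambda>l. 2 * (real n + 1 + l) * x * geg_hat (n + 1) l x -
     ((real n + 2) * geg_hat (n + 2) l x + (real n + 2 * l) * geg_hat n l x)"
  have pos: "?f l = 0" if "l > 0" for l
  proof -
    have "l \<notin> \<int>\<^sub>\<le>\<^sub>0" using that by (auto elim!: nonpos_Ints_cases)
    then have "?f l = Gamma l * (2 * (real n + 1 + l) * x * gegenbauer (n + 1) l x -
     ((real n + 2) * gegenbauer (n + 2) l x + (real n + 2 * l) * gegenbauer n l x))"
      unfolding geg_hat_eq[OF \<open>l \<notin> \<int>\<^sub>\<le>\<^sub>0\<close>] by (simp only: algebra_simps)
    then show ?thesis by (simp only: gegenbauer_rec) simp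
  qed
  have "?f 0 = 0" if "n \<ge> 1"
    by (rule eq_at_zero_by_limit[of ?f, OF pos])
       (assumption, intro tendsto_diff tendsto_add tendsto_mult tendsto_const tendsto_ident_at geg_hat_tendsto, use that in auto)
  with pos assms show ?thesis by (metis eq_iff_diff_eq_0)
qed

lemma geg_hat'_eq:
  assumes "l > 0 \<or> l = 0 \<and> n \<ge> 1"
  shows "(1 - x\<^sup>2) * geg_hat' n l x = (real n + 2 * l) * x * geg_hat n l x - (real n + 1) * geg_hat (n + 1) l x"
proof -
  let ?f = "\<lambda>l. (1 - x\<^sup>2) * geg_hat' n l x - ((real n + 2 * l) * x * geg_hat n l x - (real n + 1) * geg_hat (n + 1) l x)"
  have pos: "?f l = 0" if "l > 0" for l
  proof -
    have l: "l \<notin> \<int>\<^sub>\<le>\<^sub>0" using that by (auto elim!: nonpos_Ints_cases)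
    obtain d where d: "((\<lambda>x. gegenbauer n l x) has_real_derivative d) (at x)"
     "(1 - x\<^sup>2) * d = (real n + 2 * l) * x * gegenbauer n l x - (real n + 1) * gegenbauer (n + 1) l x"
      using gegenbauer_has_derivative by blast
    have "(geg_hat n l has_real_derivative Gamma l * d) (at x)"
      using DERIV_cmult[OF d(1), of "Gamma l"] geg_hat_eq[OF l] by (simp add: ext[of "geg_hat n l"])
    from DERIV_unique[OF this geg_hat_has_derivative] have "geg_hat' n l x = Gamma l * d" by simp
    then have "(1 - x\<^sup>2) * geg_hat' n l x = Gamma l * ((1 - x\<^sup>2) * d)" by simp
    then show ?thesis unfolding d(2) geg_hat_eq[OF l] by (simp add: algebra_simps)
  qed
  have "?f 0 = 0" if "n \<ge> 1"
    by (rule eq_at_zero_by_limit[of ?f, OF pos])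
       (assumption, intro tendsto_diff tendsto_add tendsto_mult tendsto_const tendsto_ident_at geg_hat_tendsto, use that in auto)
  with pos assms show ?thesis by (metis eq_iff_diff_eq_0)
qed

section \<open>Recursion of the eigenfunctions\<close>

text \<open>
  \<open>F\<close> agrees with the Taylor expansion of \<open>f\<close> at 0 up to order \<open>n\<close>. Only smoothness of \<open>f\<close> on
  \<open>t < 1\<close> enters, so that compositions reduce to the chain rule and need no convergence.
\<close>
primrec jetn :: "nat \<Rightarrow> (real \<Rightarrow> real) \<Rightarrow> real fps \<Rightarrow> bool" where
  "jetn 0 f F \<longleftrightarrow> f 0 = F $ 0"
| "jetn (Suc n) f F \<longleftrightarrow> f 0 = F $ 0 \<and>
     (\<exists>f'. (\<forall>t<1. (f has_real_derivative f' t) (at t)) \<and> jetn n f' (fps_deriv F))"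

lemma jetn_SucI:
  "f 0 = F $ 0 \<Longrightarrow> (\<And>t. t < 1 \<Longrightarrow> (f has_real_derivative f' t) (at t)) \<Longrightarrow> jetn n f' (fps_deriv F) \<Longrightarrow> jetn (Suc n) f F"
  unfolding jetn.simps by (rule conjI, assumption, rule exI[of _ f']) simp

lemma jetn_SucE:
  assumes "jetn (Suc n) f F"
  obtains f' where "f 0 = F $ 0" "\<And>t. t < 1 \<Longrightarrow> (f has_real_derivative f' t) (at t)" "jetn n f' (fps_deriv F)"
  using assms unfolding jetn.simps by blast

lemma jetn_Suc_D: "jetn (Suc n) f F \<Longrightarrow> jetn n f F"
proof (induction n arbitrary: f F)
  case (Suc n)
  from Suc.prems show ?case
  proof (rule jetn_SucE)
    fix f' assume "f 0 = F $ 0" "\<And>t. t < 1 \<Longrightarrow> (f has_real_derivative f' t) (at t)" "jetn (Suc n) f' (fps_deriv F)"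
    then show ?thesis using jetn_SucI[OF _ _ Suc.IH] by metis
  qed
qed simp

lemma jetn_0_D: "jetn n f F \<Longrightarrow> f 0 = F $ 0"
  by (cases n) auto

lemma jetn_const: "jetn n (\<lambda>_. c) (fps_const c)"
proof (induction n arbitrary: c)
  case (Suc n)
  have "jetn n (\<lambda>_. 0) (fps_deriv (fps_const c))" using Suc[of 0] by simp
  then show ?case by (intro jetn_SucI[of _ _ "\<lambda>_. 0"]) auto
qed simp

lemma jetn_ident: "jetn n (\<lambda>t. t) fps_X"
proof (cases n)
  case (Suc m)
  have "jetn m (\<lambda>_. 1) (fps_deriv fps_X)" using jetn_const[of m 1] by simp
  then show ?thesis unfolding Suc by (intro jetn_SucI[of _ _ "\<lambda>_. 1"]) auto
qed simp

lemma jetn_add: "jetn n f F \<Longrightarrow> jetn n g G \<Longrightarrow> jetn n (\<lambda>t. f t + g t) (F + G)"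
proof (induction n arbitrary: f g F G)
  case (Suc n)
  obtain f' where f: "f 0 = F $ 0" "\<And>t. t < 1 \<Longrightarrow> (f has_real_derivative f' t) (at t)" "jetn n f' (fps_deriv F)"
    using Suc.prems(1) by (rule jetn_SucE) blast
  obtain g' where g: "g 0 = G $ 0" "\<And>t. t < 1 \<Longrightarrow> (g has_real_derivative g' t) (at t)" "jetn n g' (fps_deriv G)"
    using Suc.prems(2) by (rule jetn_SucE) blast
  show ?case
    by (rule jetn_SucI[OF _ DERIV_add[OF f(2) g(2)]]) (simp_all add: f g Suc.IH)
qed simp

lemma jetn_mult: "jetn n f F \<Longrightarrow> jetn n g G \<Longrightarrow> jetn n (\<lambda>t. f t * g t) (F * G)"
proof (induction n arbitrary: f g F G)
  case (Suc n)
  obtain f' where f: "f 0 = F $ 0" "\<And>t. t < 1 \<Longrightarrow> (f has_real_derivative f' t) (at t)" "jetn n f' (fps_deriv F)"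
    using Suc.prems(1) by (rule jetn_SucE) blast
  obtain g' where g: "g 0 = G $ 0" "\<And>t. t < 1 \<Longrightarrow> (g has_real_derivative g' t) (at t)" "jetn n g' (fps_deriv G)"
    using Suc.prems(2) by (rule jetn_SucE) blast
  have "jetn n (\<lambda>t. f' t * g t + g' t * f t) (fps_deriv F * G + fps_deriv G * F)"
    by (rule jetn_add[OF Suc.IH[OF f(3) jetn_Suc_D[OF Suc.prems(2)]] Suc.IH[OF g(3) jetn_Suc_D[OF Suc.prems(1)]]])
  then show ?case
    by (intro jetn_SucI[OF _ DERIV_mult[OF f(2) g(2)]]) (simp_all add: f g mult.commute add.commute)
qed simp

lemma jetn_power: "jetn n f F \<Longrightarrow> jetn n (\<lambda>t. f t ^ k) (F ^ k)"
proof (induction k)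
  case 0
  then show ?case using jetn_const[of n 1] by simp
next
  case (Suc k)
  then show ?case using jetn_mult[of n f F "\<lambda>t. f t ^ k" "F ^ k"] by simp
qed

text \<open>
  Induction on \<open>n\<close> for all \<open>i\<close> at once: the derivative of \<open>h i (g t)\<close> is \<open>h (Suc i) (g t)\<close> times
  that of \<open>g\<close>.
\<close>
lemma jetn_compose:
  assumes h: "\<And>i z. z \<in> T \<Longrightarrow> (h i has_real_derivative h (Suc i) z) (at z)"
    and g: "\<And>t. t < 1 \<Longrightarrow> g t \<in> T" "\<And>n. jetn n (\<lambda>t. g t - c) G" and G: "G $ 0 = 0"
  shows "jetn n (\<lambda>t. h i (g t)) (Abs_fps (\<lambda>k. h (i + k) c / fact k) oo G)"
proof (induction n arbitrary: i)
  case 0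
  show ?case using jetn_0_D[OF g(2)[of 0]] G by simp
next
  case (Suc n)
  obtain g' where g': "\<And>t. t < 1 \<Longrightarrow> ((\<lambda>t. g t - c) has_real_derivative g' t) (at t)"
    "jetn n g' (fps_deriv G)" using g(2)[of "Suc n"] by (rule jetn_SucE) blast
  have dg: "(g has_real_derivative g' t) (at t)" if "t < 1" for t
    using DERIV_add[OF g'(1)[OF that] DERIV_const[of c]] by simp
  have "fps_deriv (Abs_fps (\<lambda>k. h (i + k) c / fact k)) = Abs_fps (\<lambda>k. h (Suc i + k) c / fact k)"
    by (rule fps_ext) (simp add: divide_simps)
  then have "fps_deriv (Abs_fps (\<lambda>k. h (i + k) c / fact k) oo G)
      = (Abs_fps (\<lambda>k. h (Suc i + k) c / fact k) oo G) * fps_deriv G"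
    by (simp add: fps_compose_deriv[OF G])
  moreover have "jetn n (\<lambda>t. h (Suc i) (g t) * g' t) ((Abs_fps (\<lambda>k. h (Suc i + k) c / fact k) oo G) * fps_deriv G)"
    by (intro jetn_mult Suc.IH g'(2))
  ultimately show ?case
    using jetn_0_D[OF g(2)[of 0]] G
    by (intro jetn_SucI[OF _ DERIV_chain2[OF h[OF g(1)] dg]]) simp_all
qed

definition geom :: "real fps" where "geom = Abs_fps (\<lambda>_. 1)"

lemma geom_deriv: "fps_deriv geom = geom ^ 2"
  by (rule fps_ext) (simp add: geom_def power2_eq_square fps_mult_nth)

lemma geom_mult: "geom * (1 - fps_X) = 1"
proof (rule fps_ext)
  fix n show "(geom * (1 - fps_X)) $ n = 1 $ n"
    by (cases n) (simp_all add: geom_def right_diff_distrib fps_X_mult_right_nth)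
qed

lemma jetn_geom: "jetn n (\<lambda>t. 1 / (1 - t)) geom"
proof (induction n)
  case (Suc n)
  have "jetn n (\<lambda>t. (1 / (1 - t)) ^ 2) (fps_deriv geom)"
    unfolding geom_deriv by (intro jetn_power Suc)
  then show ?case
    by (rule jetn_SucI[rotated 2]) (auto intro!: derivative_eq_intros simp: power2_eq_square geom_def)
qed (simp add: geom_def)

lemma higher_deriv_cong_lt:
  fixes f g :: "real \<Rightarrow> real"
  assumes "\<And>t. t < c \<Longrightarrow> f t = g t" "t < c"
  shows "(deriv ^^ n) f t = (deriv ^^ n) g t"
  using assms(2)
proof (induction n arbitrary: t)
  case (Suc n)
  have "\<forall>\<^sub>F s in nhds t. s \<in> {..<c}" using Suc.prems by (intro eventually_nhds_in_open) auto
  then have "\<forall>\<^sub>F s in nhds t. (deriv ^^ n) f s = (deriv ^^ n) g s"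
    by eventually_elim (use Suc.IH in auto)
  then show ?case by (simp add: deriv_cong_ev)
qed (simp add: assms)

lemma jetn_higher_deriv: "jetn n f F \<Longrightarrow> (deriv ^^ n) f 0 = fact n * F $ n"
proof (induction n arbitrary: f F)
  case (Suc n)
  obtain f' where f': "\<And>t. t < 1 \<Longrightarrow> (f has_real_derivative f' t) (at t)" "jetn n f' (fps_deriv F)"
    using Suc.prems by (rule jetn_SucE) blast
  have "(deriv ^^ Suc n) f 0 = (deriv ^^ n) (deriv f) 0" by (simp add: funpow_swap1)
  also have "\<dots> = (deriv ^^ n) f' 0"
    by (rule higher_deriv_cong_lt[of 1]) (use f' DERIV_imp_deriv in auto)
  also have "\<dots> = fact n * (fps_deriv F) $ n" by (rule Suc.IH[OF f'(2)])
  finally show ?case by (simp add: mult_ac)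
qed simp

text \<open>
  Taylor expansions of the two Bessel factors of the generating function, about 0 and about \<open>y\<close>.
  Their arguments \<open>y t\<^sup>2/(1-t)\<^sup>2\<close> and \<open>y/(1-t)\<^sup>2\<close> differ from these points by the series \<open>cl_arg y\<close> and \<open>k_arg y\<close>
  below, which have no constant term.
\<close>
definition cl_jet :: "real \<Rightarrow> real fps" where
  "cl_jet a = Abs_fps (\<lambda>k. clifford (a + real k) 0 / fact k)"

definition k_jet :: "real \<Rightarrow> real \<Rightarrow> real fps" where
  "k_jet b y = Abs_fps (\<lambda>k. (-1) ^ k * kint (b + real k) y / fact k)"

definition cl_arg :: "real \<Rightarrow> real fps" where
  "cl_arg y = fps_const y * (fps_X ^ 2 * geom ^ 2)"

definition k_arg :: "real \<Rightarrow> real fps" where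
  "k_arg y = fps_const y * (geom ^ 2 - 1)"

lemma cl_arg_0 [simp]: "cl_arg y $ 0 = 0" and k_arg_0 [simp]: "k_arg y $ 0 = 0"
  by (simp_all add: cl_arg_def k_arg_def geom_def power2_eq_square fps_mult_nth)

lemma cl_jet_deriv: "fps_deriv (cl_jet a) = cl_jet (a + 1)"
  by (rule fps_ext) (simp add: cl_jet_def divide_simps add_ac)

lemma k_jet_deriv: "fps_deriv (k_jet b y) = - k_jet (b + 1) y"
  by (rule fps_ext) (simp add: k_jet_def divide_simps add_ac)

lemma cl_jet_ode: "fps_X * cl_jet (a + 2) + fps_const (a + 1) * cl_jet (a + 1) = cl_jet a"
proof (rule fps_ext)
  fix n
  have l: "rGamma (a + real n + 1) = (a + real n + 1) * rGamma (a + real n + 1 + 1)"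
    using rGamma_plus1[of "a + real n + 1"] by simp
  show "(fps_X * cl_jet (a + 2) + fps_const (a + 1) * cl_jet (a + 1)) $ n = cl_jet a $ n"
  proof (cases n)
    case 0
    then show ?thesis using l by (simp add: cl_jet_def add_ac)
  next
    case (Suc m)
    have f: "1 / fact m = real n / (fact n :: real)" using Suc by (simp add: divide_simps)
    have "(fps_X * cl_jet (a + 2) + fps_const (a + 1) * cl_jet (a + 1)) $ n
       = rGamma (a + real n + 1 + 1) * (1 / fact m) + (a + 1) * (rGamma (a + real n + 1 + 1) / fact n)"
      unfolding fps_add_nth fps_mult_left_const_nth by (simp add: Suc cl_jet_def add_ac)
    also have "\<dots> = (a + real n + 1) * rGamma (a + real n + 1 + 1) / fact n"
      unfolding f by (simp add: divide_inverse algebra_simps)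
    finally show ?thesis using l by (simp add: cl_jet_def)
  qed
qed

lemma k_jet_ode:
  assumes "y > 0"
  shows "(fps_const y + fps_X) * k_jet (b + 2) y = fps_const (b + 1) * k_jet (b + 1) y + k_jet b y"
proof (rule fps_ext)
  fix n
  have l: "y * kint (b + real n + 2) y = (b + real n + 1) * kint (b + real n + 1) y + kint (b + real n) y"
    using kint_lower[OF assms] .
  show "((fps_const y + fps_X) * k_jet (b + 2) y) $ n = (fps_const (b + 1) * k_jet (b + 1) y + k_jet b y) $ n"
  proof (cases n)
    case 0
    then show ?thesis using l by (simp add: k_jet_def distrib_right)
  next
    case (Suc m)
    have e: "b + 2 + real n = b + real n + 2" "b + 2 + real m = b + real n + 1" "b + 1 + real n = b + real n + 1"
      using Suc by simp_all
    have f: "1 / fact m = real n / (fact n :: real)" using Suc by (simp add: divide_simps)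
    have "((fps_const y + fps_X) * k_jet (b + 2) y) $ n
        = (-1) ^ n * (y * kint (b + real n + 2) y) / fact n - (-1) ^ n * kint (b + real n + 1) y * (1 / fact m)"
    proof -
      have "k_jet (b + 2) y $ n = (-1) ^ n * kint (b + real n + 2) y / fact n"
        by (simp only: k_jet_def fps_nth_Abs_fps e)
      moreover have "k_jet (b + 2) y $ m = - ((-1) ^ n * kint (b + real n + 1) y * (1 / fact m))"
        by (simp only: k_jet_def fps_nth_Abs_fps e) (simp add: Suc)
      ultimately show ?thesis by (simp add: distrib_right Suc)
    qed
    also have "\<dots> = (b + 1) * ((-1) ^ n * kint (b + real n + 1) y / fact n) + (-1) ^ n * kint (b + real n) y / fact n"
      unfolding f l by (simp add: divide_inverse algebra_simps)
    finally show ?thesis by (simp add: k_jet_def e)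
  qed
qed

text \<open>
  The computation behind the recursion, freed of power series. The letters \<open>g\<close>, \<open>p\<close>, \<open>r\<close>, \<open>s\<close> stand for
  the products of a power of \<open>V\<close> with the two Bessel factors or their derivatives (none, first, second, both).
  The hypotheses express derivatives in \<open>t\<close>, with second derivatives of the factors eliminated by Bessel's
  equation. \<open>X p'\<close> occurs instead of \<open>p'\<close> because the equation of the first factor is singular at \<open>X = 0\<close>.
\<close>
lemma jet_ring_identity:
  fixes X V y a b k g p r s g1 Xp1 r1 g2 T T1 :: "'a :: idom"
  assumes V: "V * (1 - X) = 1" and k: "k = a + b + 1"
    and g1: "g1 = k * V * g + 2 * y * X * V ^ 3 * p - 2 * y * V ^ 3 * r"
    and Xp1: "Xp1 = k * V * X * p + 2 * V * (g - (a + 1) * p) - 2 * y * X * V ^ 3 * s"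
    and r1: "r1 = k * V * r + 2 * y * X * V ^ 3 * s - 2 * V * (g + (b + 1) * r)"
    and g2: "g2 = k * (V ^ 2 * g + V * g1) + 2 * y * (V ^ 3 * p + 3 * X * V ^ 4 * p + V ^ 3 * Xp1) - 2 * y * (3 * V ^ 4 * r + V ^ 3 * r1)"
    and T: "T = 2 * y * (X ^ 2 * V ^ 2 * p - V ^ 2 * r) + k * g"
    and T1: "T1 = 2 * y * (2 * X * V ^ 3 * p + X * V ^ 2 * Xp1 - 2 * V ^ 3 * r - V ^ 2 * r1) + k * g1"
  shows "(1 - X ^ 2) * (X * g2 + g1) + (2 * a - (2 * a + 2) * X ^ 2) * g1 - ((a + 1) ^ 2 - b ^ 2) * X * g = 2 * X * T1 + (2 * a + 1) * T"
  using V unfolding T1 g2 r1 Xp1 g1 T k by algebra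

definition P_ser :: "real \<Rightarrow> real \<Rightarrow> real fps" where "P_ser a y = cl_jet a oo cl_arg y"
definition Q_ser :: "real \<Rightarrow> real \<Rightarrow> real fps" where "Q_ser b y = k_jet b y oo k_arg y"

lemma geom_X: "fps_X * geom = geom - 1"
  using geom_mult by (simp add: algebra_simps)

lemma cl_arg_deriv: "fps_deriv (cl_arg y) = fps_const y * (2 * fps_X * geom ^ 3)"
proof -
  have "fps_deriv (cl_arg y) = fps_const y * (2 * fps_X * geom ^ 2 + fps_X ^ 2 * (2 * geom * geom ^ 2))"
    unfolding cl_arg_def by (simp add: fps_deriv_power geom_deriv power2_eq_square algebra_simps)
  also have "2 * fps_X * geom ^ 2 + fps_X ^ 2 * (2 * geom * geom ^ 2) = 2 * fps_X * geom ^ 2 * (1 + fps_X * geom)"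
    by (simp add: algebra_simps power2_eq_square)
  also have "\<dots> = 2 * fps_X * geom ^ 3" unfolding geom_X by (simp add: power2_eq_square power3_eq_cube)
  finally show ?thesis .
qed

lemma k_arg_deriv: "fps_deriv (k_arg y) = fps_const y * (2 * geom ^ 3)"
  unfolding k_arg_def by (simp add: geom_deriv power2_eq_square power3_eq_cube algebra_simps)

lemma P_ser_deriv: "fps_deriv (P_ser a y) = P_ser (a + 1) y * (fps_const y * (2 * fps_X * geom ^ 3))"
  unfolding P_ser_def by (simp only: fps_compose_deriv[OF cl_arg_0] cl_jet_deriv cl_arg_deriv)

lemma Q_ser_deriv: "fps_deriv (Q_ser b y) = - Q_ser (b + 1) y * (fps_const y * (2 * geom ^ 3))"
  unfolding Q_ser_def by (simp only: fps_compose_deriv[OF k_arg_0] k_jet_deriv k_arg_deriv fps_compose_uminus)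

lemma fps_X_compose: "G $ 0 = 0 \<Longrightarrow> fps_X oo G = (G :: real fps)"
  by (auto simp: fps_X_fps_compose fps_eq_iff)

lemma P_ser_ode:
  "fps_const y * (fps_X ^ 2 * geom ^ 2) * P_ser (a + 2) y = P_ser a y - fps_const (a + 1) * P_ser (a + 1) y"
proof -
  have "(fps_X * cl_jet (a + 2) + fps_const (a + 1) * cl_jet (a + 1)) oo cl_arg y = cl_jet a oo cl_arg y"
    by (simp only: cl_jet_ode)
  then have "cl_arg y * P_ser (a + 2) y + fps_const (a + 1) * P_ser (a + 1) y = P_ser a y"
    by (simp only: fps_compose_add_distrib fps_compose_mult_distrib[OF cl_arg_0] fps_X_compose[OF cl_arg_0]
        fps_const_compose P_ser_def)
  then show ?thesis unfolding cl_arg_def by (simp add: algebra_simps)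
qed

lemma Q_ser_ode:
  assumes "y > 0"
  shows "fps_const y * geom ^ 2 * Q_ser (b + 2) y = Q_ser b y + fps_const (b + 1) * Q_ser (b + 1) y"
proof -
  have "((fps_const y + fps_X) * k_jet (b + 2) y) oo k_arg y = (fps_const (b + 1) * k_jet (b + 1) y + k_jet b y) oo k_arg y"
    by (simp only: k_jet_ode[OF assms])
  then have "(fps_const y + k_arg y) * Q_ser (b + 2) y = fps_const (b + 1) * Q_ser (b + 1) y + Q_ser b y"
    by (simp only: fps_compose_add_distrib fps_compose_mult_distrib[OF k_arg_0] fps_X_compose[OF k_arg_0]
        fps_const_compose Q_ser_def)
  moreover have "fps_const y + k_arg y = fps_const y * geom ^ 2" by (simp add: k_arg_def algebra_simps)
  ultimately show ?thesis by simp
qed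

lemma P_ser_coeff_deriv: "has_coeff_deriv (P_ser a) (P_ser (a + 1) y * (fps_X ^ 2 * geom ^ 2)) y"
proof -
  have W: "has_coeff_deriv cl_arg (fps_X ^ 2 * geom ^ 2) y"
    unfolding has_coeff_deriv_def cl_arg_def by (auto intro!: derivative_eq_intros)
  have W0: "(fps_X ^ 2 * geom ^ 2 :: real fps) $ 0 = 0" by (simp add: power2_eq_square)
  from has_coeff_deriv_compose[OF has_coeff_deriv_const[of "cl_jet a"] W cl_arg_0 W0]
  have "has_coeff_deriv (\<lambda>y. cl_jet a oo cl_arg y) (0 + (cl_jet (a + 1) oo cl_arg y) * (fps_X ^ 2 * geom ^ 2)) y"
    by (simp only: fps_compose_0 cl_jet_deriv)
  then show ?thesis unfolding P_ser_def[abs_def] by simp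
qed

lemma Q_ser_coeff_deriv:
  assumes "y > 0"
  shows "has_coeff_deriv (Q_ser b) (- Q_ser (b + 1) y * geom ^ 2) y"
proof -
  have B: "has_coeff_deriv (k_jet b) (- k_jet (b + 1) y) y"
    unfolding has_coeff_deriv_def k_jet_def
    using assms by (auto intro!: derivative_eq_intros simp: add_ac)
  have W: "has_coeff_deriv k_arg (geom ^ 2 - 1) y"
    unfolding has_coeff_deriv_def k_arg_def by (auto intro!: derivative_eq_intros)
  have W0: "(geom ^ 2 - 1 :: real fps) $ 0 = 0" by (simp add: geom_def power2_eq_square)
  from has_coeff_deriv_compose[OF B W k_arg_0 W0]
  have "has_coeff_deriv (\<lambda>y. k_jet b y oo k_arg y)
      (- Q_ser (b + 1) y + (- Q_ser (b + 1) y) * (geom ^ 2 - 1)) y"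
    by (simp only: fps_compose_uminus k_jet_deriv Q_ser_def)
  then show ?thesis unfolding Q_ser_def[abs_def] by (simp add: algebra_simps)
qed

definition gen_ser :: "nat \<Rightarrow> real \<Rightarrow> real \<Rightarrow> real \<Rightarrow> real fps" where
  "gen_ser N a b y = geom ^ (N + 1) * (P_ser a y * Q_ser b y)"

definition Lam :: "nat \<Rightarrow> real \<Rightarrow> real \<Rightarrow> nat \<Rightarrow> real \<Rightarrow> real" where
  "Lam N a b j y = gen_ser N a b y $ j / 2"

lemma Lam_0: "Lam N a b 0 y = rGamma (a + 1) * kint b y / 2"
  by (simp add: Lam_def gen_ser_def P_ser_def Q_ser_def geom_def cl_jet_def k_jet_def fps_power_zeroth)

lemma gen_ser_coeff_deriv:
  assumes "y > 0"
  shows "has_coeff_deriv (gen_ser N a b)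
    (geom ^ (N + 1) * (P_ser (a + 1) y * (fps_X ^ 2 * geom ^ 2) * Q_ser b y - P_ser a y * (Q_ser (b + 1) y * geom ^ 2))) y"
proof -
  from has_coeff_deriv_mult[OF has_coeff_deriv_const[of "geom ^ (N + 1)"]
      has_coeff_deriv_mult[OF P_ser_coeff_deriv Q_ser_coeff_deriv[OF assms]], of a b]
  show ?thesis unfolding gen_ser_def[abs_def] by simp
qed

text \<open>
  \<open>T\<close> is the image of the generating function \<open>G\<close> under \<open>2y d/dy + N + 1\<close>. The Bessel equations of the
  two factors combine to an equation that is only of first order in \<open>y\<close>; this is what makes the recursion possible.
\<close>
lemma gen_ser_pde:
  assumes y: "y > 0" and ab: "a + b = real N"
  defines "G \<equiv> gen_ser N a b y"
    and "T \<equiv> 2 * fps_const y * (geom ^ (N + 1) * (P_ser (a + 1) y * (fps_X ^ 2 * geom ^ 2) * Q_ser b y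
           - P_ser a y * (Q_ser (b + 1) y * geom ^ 2))) + fps_const (real N + 1) * gen_ser N a b y"
  shows "(1 - fps_X ^ 2) * (fps_X * fps_deriv (fps_deriv G) + fps_deriv G)
     + (2 * fps_const a - (2 * fps_const a + 2) * fps_X ^ 2) * fps_deriv G
     - ((fps_const a + 1) ^ 2 - fps_const b ^ 2) * fps_X * G
     = 2 * fps_X * fps_deriv T + (2 * fps_const a + 1) * T"
proof -
  let ?V = geom and ?X = "fps_X :: real fps" and ?y = "fps_const y" and ?k = "fps_const (real N + 1)"
  define Z where "Z = geom ^ (N + 1)"
  define P0 P1 P2 Q0 Q1 Q2 where "P0 = P_ser a y" "P1 = P_ser (a + 1) y" "P2 = P_ser (a + 2) y"
    "Q0 = Q_ser b y" "Q1 = Q_ser (b + 1) y" "Q2 = Q_ser (b + 2) y"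
  note defs = this
  define g p r s where "g = Z * P0 * Q0" "p = Z * P1 * Q0" "r = Z * P0 * Q1" "s = Z * P1 * Q1"
  note gdefs = this
  have dZ: "fps_deriv Z = ?k * ?V * Z"
  proof -
    have "fps_deriv Z = ?k * fps_deriv ?V * ?V ^ N"
      unfolding Z_def fps_deriv_power by (simp add: fps_of_nat[symmetric] add.commute)
    also have "\<dots> = ?k * ?V * Z" unfolding Z_def geom_deriv by (simp add: power2_eq_square mult_ac)
    finally show ?thesis .
  qed
  have dP0: "fps_deriv P0 = P1 * (?y * (2 * ?X * ?V ^ 3))" and dQ0: "fps_deriv Q0 = - Q1 * (?y * (2 * ?V ^ 3))"
    unfolding defs by (rule P_ser_deriv, rule Q_ser_deriv)
  have dP1: "fps_deriv P1 = P2 * (?y * (2 * ?X * ?V ^ 3))" and dQ1: "fps_deriv Q1 = - Q2 * (?y * (2 * ?V ^ 3))"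
    unfolding defs P_ser_deriv Q_ser_deriv by (simp_all add: add.assoc)
  have odeP: "?y * (?X ^ 2 * ?V ^ 2) * P2 = P0 - (fps_const a + 1) * P1"
    using P_ser_ode[of y a] unfolding defs by (simp flip: fps_const_add)
  have odeQ: "?y * ?V ^ 2 * Q2 = Q0 + (fps_const b + 1) * Q1"
    using Q_ser_ode[OF y, of b] unfolding defs by (simp flip: fps_const_add)
  have G: "G = g" unfolding G_def gen_ser_def gdefs defs Z_def by (simp add: mult_ac)
  have g1: "fps_deriv g = ?k * ?V * g + 2 * ?y * ?X * ?V ^ 3 * p - 2 * ?y * ?V ^ 3 * r"
    unfolding gdefs by (simp add: dZ dP0 dQ0 algebra_simps)
  have p1: "?X * fps_deriv p = ?k * ?V * ?X * p + 2 * ?V * (g - (fps_const a + 1) * p) - 2 * ?y * ?X * ?V ^ 3 * s"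
  proof -
    have "?X * fps_deriv p = ?k * ?V * ?X * p + 2 * ?V * (?y * (?X ^ 2 * ?V ^ 2) * P2) * Z * Q0 - 2 * ?y * ?X * ?V ^ 3 * s"
      unfolding gdefs by (simp add: dZ dP1 dQ0 algebra_simps power2_eq_square power3_eq_cube)
    then show ?thesis unfolding odeP gdefs by (simp add: algebra_simps)
  qed
  have r1: "fps_deriv r = ?k * ?V * r + 2 * ?y * ?X * ?V ^ 3 * s - 2 * ?V * (g + (fps_const b + 1) * r)"
  proof -
    have "fps_deriv r = ?k * ?V * r + 2 * ?y * ?X * ?V ^ 3 * s - 2 * ?V * (?y * ?V ^ 2 * Q2) * Z * P0"
      unfolding gdefs by (simp add: dZ dP0 dQ1 algebra_simps power2_eq_square power3_eq_cube)
    then show ?thesis unfolding odeQ gdefs by (simp add: algebra_simps)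
  qed
  have V2: "fps_deriv (?V ^ 2) = 2 * ?V ^ 3" "fps_deriv (?V ^ 3) = 3 * ?V ^ 4"
    unfolding fps_deriv_power geom_deriv by (simp_all add: numeral_eq_Suc algebra_simps fps_numeral_fps_const)
  have g2: "fps_deriv (fps_deriv g) = ?k * (?V ^ 2 * g + ?V * fps_deriv g)
     + 2 * ?y * (?V ^ 3 * p + 3 * ?X * ?V ^ 4 * p + ?V ^ 3 * (?X * fps_deriv p))
     - 2 * ?y * (3 * ?V ^ 4 * r + ?V ^ 3 * fps_deriv r)"
    by (subst g1) (simp add: V2 geom_deriv algebra_simps)
  have T: "T = 2 * ?y * (?X ^ 2 * ?V ^ 2 * p - ?V ^ 2 * r) + ?k * g"
    unfolding T_def G_def[symmetric] G unfolding gdefs defs Z_def by (simp add: algebra_simps)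
  have T1: "fps_deriv T = 2 * ?y * (2 * ?X * ?V ^ 3 * p + ?X * ?V ^ 2 * (?X * fps_deriv p) - 2 * ?V ^ 3 * r - ?V ^ 2 * fps_deriv r)
     + ?k * fps_deriv g"
  proof -
    have "fps_deriv (?X ^ 2 * ?V ^ 2) = 2 * ?X * ?V ^ 3"
      using cl_arg_deriv[of 1] by (simp add: cl_arg_def)
    then have "fps_deriv (?X ^ 2 * ?V ^ 2 * p) = 2 * ?X * ?V ^ 3 * p + ?X ^ 2 * ?V ^ 2 * fps_deriv p"
      by (simp only: fps_deriv_mult) (simp add: algebra_simps)
    then show ?thesis unfolding T
      by (simp only: fps_deriv_add fps_deriv_sub fps_deriv_mult fps_deriv_numeral fps_deriv_const V2)
         (simp add: algebra_simps power2_eq_square)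
  qed
  have k: "?k = fps_const a + fps_const b + 1"
    using ab by (simp add: add.commute flip: ab)
  show ?thesis unfolding G
    by (rule jet_ring_identity[OF geom_mult k g1 p1 r1 g2 T T1])
qed

text \<open>
  The coefficient of \<open>t\<close> to the power \<open>j\<close> in the preceding equation.
\<close>
theorem Lam_recursion:
  assumes y: "y > 0" and ab: "a + b = real N"
  shows "\<exists>d. (Lam N a b j has_real_derivative d) (at y) \<and>
    (real j + 1) * (real j + 1 + 2 * a) * Lam N a b (j + 1) y =
      (2 * real j + 2 * a + 1) * (2 * y * d + (real N + 1) * Lam N a b j y)
      + (if j = 0 then 0 else (real j + a + b) * (real j + a - b) * Lam N a b (j - 1) y)"
proof -
  let ?G = "gen_ser N a b y"
  define D where "D = geom ^ (N + 1) * (P_ser (a + 1) y * (fps_X ^ 2 * geom ^ 2) * Q_ser b y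
           - P_ser a y * (Q_ser (b + 1) y * geom ^ 2))"
  define T where "T = 2 * fps_const y * D + fps_const (real N + 1) * ?G"
  have d: "(Lam N a b j has_real_derivative D $ j / 2) (at y)"
    unfolding Lam_def[abs_def] using gen_ser_coeff_deriv[OF y, of N a b] unfolding has_coeff_deriv_def D_def
    by (auto intro!: derivative_eq_intros)
  have T_nth: "T $ n = 2 * y * D $ n + (real N + 1) * ?G $ n" for n
    unfolding T_def by (simp add: mult.assoc fps_numeral_fps_const)
  have pde: "(1 - fps_X ^ 2) * (fps_X * fps_deriv (fps_deriv ?G) + fps_deriv ?G)
     + (2 * fps_const a - (2 * fps_const a + 2) * fps_X ^ 2) * fps_deriv ?G
     - ((fps_const a + 1) ^ 2 - fps_const b ^ 2) * fps_X * ?G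
     = 2 * fps_X * fps_deriv T + (2 * fps_const a + 1) * T"
    unfolding T_def D_def by (rule gen_ser_pde[OF y ab])
  define A where "A = fps_X * fps_deriv (fps_deriv ?G) + fps_deriv ?G"
  have A: "A $ n = (real n + 1) ^ 2 * ?G $ (n + 1)" for n
    unfolding A_def by (cases n) (simp_all add: algebra_simps power2_eq_square)
  have L: "A - fps_X * (fps_X * A) + fps_const (2 * a) * fps_deriv ?G
     - fps_const (2 * a + 2) * (fps_X * (fps_X * fps_deriv ?G)) - fps_const ((a + 1) ^ 2 - b ^ 2) * (fps_X * ?G)
     = fps_const 2 * (fps_X * fps_deriv T) + fps_const (2 * a + 1) * T"
  proof -
    have c: "fps_const (2 * a) = 2 * fps_const a" "fps_const (2 * a + 2) = 2 * fps_const a + 2"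
       "fps_const ((a + 1) ^ 2 - b ^ 2) = (fps_const a + 1) ^ 2 - fps_const b ^ 2"
       "fps_const (2 * a + 1) = 2 * fps_const a + 1" "(fps_const 2 :: real fps) = 2"
      by (simp_all add: fps_numeral_fps_const flip: fps_const_add fps_const_sub fps_const_power)
    have "A - fps_X * (fps_X * A) + 2 * fps_const a * fps_deriv ?G
     - (2 * fps_const a + 2) * (fps_X * (fps_X * fps_deriv ?G)) - ((fps_const a + 1) ^ 2 - fps_const b ^ 2) * (fps_X * ?G)
     = (1 - fps_X ^ 2) * A + (2 * fps_const a - (2 * fps_const a + 2) * fps_X ^ 2) * fps_deriv ?G
     - ((fps_const a + 1) ^ 2 - fps_const b ^ 2) * fps_X * ?G"
      by (simp add: algebra_simps power2_eq_square)
    also have "\<dots> = 2 * fps_X * fps_deriv T + (2 * fps_const a + 1) * T"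
      unfolding A_def by (rule pde)
    finally show ?thesis unfolding c by (simp only: mult.assoc)
  qed
  have "(real j + 1) * (real j + 1 + 2 * a) * ?G $ (j + 1) =
      (2 * real j + 2 * a + 1) * T $ j + (if j = 0 then 0 else (real j + a + b) * (real j + a - b) * ?G $ (j - 1))"
  proof (cases j)
    case 0
    then show ?thesis using arg_cong[OF L, of "\<lambda>f. f $ 0"] A[of 0] by (simp add: algebra_simps)
  next
    case (Suc m)
    have "A $ j - (fps_X * A) $ m + 2 * a * (real j + 1) * ?G $ (j + 1) - (2 * a + 2) * (fps_X * fps_deriv ?G) $ m
       - ((a + 1) ^ 2 - b ^ 2) * ?G $ m = 2 * real j * T $ j + (2 * a + 1) * T $ j"
    proof -
      have X: "(fps_X * F) $ j = F $ m" for F :: "real fps" by (simp add: Suc)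
      have D: "fps_deriv ?G $ j = (real j + 1) * ?G $ (j + 1)" "fps_deriv T $ m = real j * T $ j" by (simp_all add: Suc)
      show ?thesis
        using arg_cong[OF L, of "\<lambda>f. f $ j"]
        unfolding fps_add_nth fps_sub_nth fps_mult_left_const_nth X D by (simp only: mult.assoc)
    qed
    moreover have "(fps_X * A) $ m = (real m) ^ 2 * ?G $ m" "(fps_X * fps_deriv ?G) $ m = real m * ?G $ m"
      by (cases m; simp add: A)+
    ultimately show ?thesis unfolding A using Suc
      by (simp add: algebra_simps power2_eq_square)
  qed
  then show ?thesis using d unfolding T_nth Lam_def
    by (intro exI[of _ "D $ j / 2"]) (auto simp: field_simps)
qed

lemma Lambda_eq_Lam:
  fixes \<mu> \<nu> :: int
  assumes ab: "real_of_int (\<mu> + \<nu>) = 2 * real N" and nu: "\<nu> \<ge> -1" and x: "x > 0"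
  shows "Lambda \<mu> \<nu> j x = Lam N (of_int \<mu> / 2) (of_int \<nu> / 2) j (x\<^sup>2 / 4)"
proof -
  define a b y where "a = real_of_int \<mu> / 2" "b = real_of_int \<nu> / 2" "y = x\<^sup>2 / 4"
  note defs = this
  have y: "y > 0" using x by (simp add: defs)
  have jv: "jetn n (\<lambda>t. 1 / (1 - t)) geom" for n by (rule jetn_geom)
  have gP: "jetn n (\<lambda>t. y * (t ^ 2 * (1 / (1 - t)) ^ 2) - 0) (cl_arg y)" for n
    unfolding cl_arg_def diff_zero by (intro jetn_mult jetn_const jetn_power jetn_ident jv)
  have gQ: "jetn n (\<lambda>t. y * (1 / (1 - t)) ^ 2 - y) (k_arg y)" for n
  proof -
    have "jetn n (\<lambda>t. y * (1 / (1 - t)) ^ 2 + (- y)) (fps_const y * geom ^ 2 + fps_const (- y))"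
      by (intro jetn_add jetn_mult jetn_const jetn_power jv)
    then show ?thesis by (simp add: k_arg_def algebra_simps flip: fps_const_neg)
  qed
  have hP: "(clifford (a + real i) has_real_derivative clifford (a + real (Suc i)) z) (at z)" for i z
    using clifford_has_derivative[of "a + real i" z] by (simp add: add_ac)
  have hQ: "((\<lambda>z. (-1) ^ i * kint (b + real i) z) has_real_derivative (-1) ^ Suc i * kint (b + real (Suc i)) z) (at z)"
    if "z \<in> {0<..}" for i z
    using that by (auto intro!: derivative_eq_intros simp: add_ac)
  have jP: "jetn n (\<lambda>t. clifford a (y * (t ^ 2 * (1 / (1 - t)) ^ 2))) (P_ser a y)" for n
    using jetn_compose[of UNIV "\<lambda>i. clifford (a + real i)", OF hP _ gP cl_arg_0, of n 0]
    by (simp add: P_ser_def cl_jet_def)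
  have jQ: "jetn n (\<lambda>t. kint b (y * (1 / (1 - t)) ^ 2)) (Q_ser b y)" for n
    using jetn_compose[of "{0<..}" "\<lambda>i z. (-1) ^ i * kint (b + real i) z", OF hQ _ gQ k_arg_0, of n 0] y
    by (simp add: Q_ser_def k_jet_def)
  let ?g = "\<lambda>t. 1 / 2 * ((1 / (1 - t)) ^ (N + 1) * (clifford a (y * (t ^ 2 * (1 / (1 - t)) ^ 2)) * kint b (y * (1 / (1 - t)) ^ 2)))"
  have "jetn j ?g
     (fps_const (1 / 2) * gen_ser N a b y)"
    unfolding gen_ser_def by (intro jetn_mult jetn_const jetn_power jv jP jQ)
  then have "(deriv ^^ j) ?g 0
     = fact j * Lam N a b j y"
    by (drule_tac jetn_higher_deriv) (simp add: Lam_def)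
  moreover have "Lambda_gen \<mu> \<nu> x t = ?g t"
    if t: "t < 1" for t
  proof -
    have e: "real_of_int (\<mu> + \<nu> + 2) / 2 = real (N + 1)" using ab by simp
    have A: "(1 - t) powr (real_of_int (\<mu> + \<nu> + 2) / 2) = (1 - t) ^ (N + 1)"
      unfolding e using t by (intro powr_realpow) simp
    have B: "bessel_I_norm a (t * x / (1 - t)) = clifford a (y * (t ^ 2 * (1 / (1 - t)) ^ 2))"
      unfolding bessel_I_norm_clifford defs by (simp add: power_mult_distrib power_divide mult_ac)
    have C: "bessel_K_norm b (x / (1 - t)) = kint b (y * (1 / (1 - t)) ^ 2) / 2"
      using t x nu by (subst bessel_K_norm_eq_kint) (auto simp: defs power_divide mult.commute)
    show ?thesis unfolding Lambda_gen_def defs(1,2)[symmetric] A B C by (simp add: power_divide)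
  qed
  ultimately show ?thesis
    unfolding Lambda_def using higher_deriv_cong_lt[of 1 "Lambda_gen \<mu> \<nu> x" _ 0 j] by (simp add: defs)
qed

section \<open>The double Hankel transform\<close>

text \<open>
  A space that contains all \<open>L\<^sub>j\<close> and is stable under \<open>y d/dy\<close>. Its members are bounded by multiples of
  \<open>y powr (- p)\<close> for all \<open>p \<ge> 0\<close> with \<open>p > b\<close>, which settles all questions of integrability and all boundary terms.
\<close>
inductive kspan :: "real \<Rightarrow> (real \<Rightarrow> real) \<Rightarrow> bool" for b where
  base: "kspan b (\<lambda>y. y ^ i * kint (b + real i) y)"
| lin: "kspan b f \<Longrightarrow> kspan b g \<Longrightarrow> kspan b (\<lambda>y. c * f y + d * g y)"
| cong: "kspan b f \<Longrightarrow> (\<And>y. y > 0 \<Longrightarrow> g y = f y) \<Longrightarrow> kspan b g"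

lemma kspan_kint: "kspan b (kint b)"
  using kspan.base[of b 0] by simp

lemma kspan_derivative:
  assumes "kspan b f"
  shows "\<exists>g. kspan b g \<and> (\<forall>y>0. (f has_real_derivative g y / y) (at y))"
  using assms
proof induction
  case (base i)
  let ?g = "\<lambda>y. real i * (y ^ i * kint (b + real i) y) + (- 1) * (y ^ Suc i * kint (b + real (Suc i)) y)"
  have "kspan b ?g" by (intro kspan.lin kspan.base)
  moreover have "((\<lambda>y. y ^ i * kint (b + real i) y) has_real_derivative ?g y / y) (at y)" if y: "y > 0" for y
  proof -
    have "((\<lambda>y. y ^ i * kint (b + real i) y) has_real_derivative
       real i * y ^ (i - 1) * kint (b + real i) y - y ^ i * kint (b + real i + 1) y) (at y)"
      using y by (auto intro!: derivative_eq_intros)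
    also have "real i * y ^ (i - 1) * kint (b + real i) y - y ^ i * kint (b + real i + 1) y = ?g y / y"
      using y by (cases i) (simp_all add: field_simps add_ac)
    finally show ?thesis .
  qed
  ultimately show ?case by blast
next
  case (lin f g c d)
  then obtain f' g' where "kspan b f'" "\<forall>y>0. (f has_real_derivative f' y / y) (at y)"
    "kspan b g'" "\<forall>y>0. (g has_real_derivative g' y / y) (at y)" by blast
  then show ?case
    by (intro exI[of _ "\<lambda>y. c * f' y + d * g' y"])
       (auto intro!: kspan.lin derivative_eq_intros simp: add_divide_distrib mult.commute)
next
  case (cong f g)
  then obtain f' where f': "kspan b f'" "\<forall>y>0. (f has_real_derivative f' y / y) (at y)" by blast
  have "(g has_real_derivative f' y / y) (at y)" if y: "y > 0" for y
  proof (rule has_field_derivative_transform_within_open)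
    show "(f has_real_derivative f' y / y) (at y)" using f' y by blast
  qed (use y cong in \<open>auto intro: open_greaterThan\<close>)
  with f' show ?case by blast
qed

lemma kspan_continuous: "kspan b f \<Longrightarrow> continuous_on {0<..} f"
  by (drule kspan_derivative, elim exE conjE, rule DERIV_continuous_on)
     (auto intro: has_field_derivative_at_within)

lemma kspan_bound:
  assumes "kspan b f" "p \<ge> 0" "p > b"
  shows "\<exists>C\<ge>0. \<forall>y>0. \<bar>f y\<bar> \<le> C * y powr (- p)"
  using assms(1)
proof induction
  case (base i)
  obtain C where C: "C \<ge> 0" "\<And>y. y > 0 \<Longrightarrow> kint (b + real i) y \<le> C * y powr (- (p + real i))"
    using kint_bound[of "p + real i" "b + real i"] assms by auto
  have "\<bar>y ^ i * kint (b + real i) y\<bar> \<le> C * y powr (- p)" if y: "y > 0" for y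
  proof -
    have "\<bar>y ^ i * kint (b + real i) y\<bar> = y ^ i * kint (b + real i) y"
      using y kint_nonneg by (simp add: abs_mult)
    also have "\<dots> \<le> y ^ i * (C * y powr (- (p + real i)))"
      using y by (intro mult_left_mono C) auto
    also have "\<dots> = C * (y powr real i * y powr (- (p + real i)))" using y by (simp add: powr_realpow)
    also have "y powr real i * y powr (- (p + real i)) = y powr (- p)" by (simp add: powr_add[symmetric])
    finally show ?thesis .
  qed
  with C(1) show ?case by blast
next
  case (lin f g c d)
  then obtain C D where CD: "C \<ge> 0" "\<And>y. y > 0 \<Longrightarrow> \<bar>f y\<bar> \<le> C * y powr (- p)"
    "D \<ge> 0" "\<And>y. y > 0 \<Longrightarrow> \<bar>g y\<bar> \<le> D * y powr (- p)" by blast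
  have "\<bar>c * f y + d * g y\<bar> \<le> (\<bar>c\<bar> * C + \<bar>d\<bar> * D) * y powr (- p)" if y: "y > 0" for y
  proof -
    have "\<bar>c * f y + d * g y\<bar> \<le> \<bar>c\<bar> * \<bar>f y\<bar> + \<bar>d\<bar> * \<bar>g y\<bar>"
      using abs_triangle_ineq[of "c * f y" "d * g y"] by (simp add: abs_mult)
    also have "\<dots> \<le> \<bar>c\<bar> * (C * y powr (- p)) + \<bar>d\<bar> * (D * y powr (- p))"
      using CD y by (intro add_mono mult_left_mono) auto
    finally show ?thesis by (simp add: algebra_simps)
  qed
  with CD show ?case by (intro exI[of _ "\<bar>c\<bar> * C + \<bar>d\<bar> * D"]) auto
next
  case (cong f g)
  then show ?case by auto
qed

lemma integrable_lpos_of_power_bounds: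
  fixes f :: "real \<Rightarrow> real"
  assumes f: "continuous_on {0<..} f"
    and q: "q0 > -1" "q1 < -1"
    and bound: "\<And>y. y > 0 \<Longrightarrow> \<bar>f y\<bar> \<le> C0 * y powr q0" "\<And>y. y > 0 \<Longrightarrow> \<bar>f y\<bar> \<le> C1 * y powr q1"
  shows "integrable lpos f"
proof -
  have *: "integrable lborel (\<lambda>y. indicator S y * y powr q)"
    if "(\<lambda>y. y powr q) integrable_on S" "S \<in> sets borel" for S and q :: real
  proof -
    have "(\<lambda>y. y powr q) absolutely_integrable_on S"
      using that(1) by (intro nonnegative_absolutely_integrable_1) auto
    then show ?thesis
      using that(2) unfolding set_integrable_def by (subst (asm) integrable_completion) auto
  qed
  let ?D = "\<lambda>y. C0 * (indicator {0..1} y * y powr q0) + C1 * (indicator {1..} y * y powr q1)"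
  have "integrable lborel ?D"
    using has_integral_powr_from_0[OF q(1), of 1] has_integral_powr_to_inf[OF q(2), of 1]
    by (intro Bochner_Integration.integrable_add integrable_mult_right *) (auto simp: integrable_on_def)
  then have "integrable lpos ?D"
    using integrable_mult_indicator[of "{0<..}" lborel ?D] by (subst integrable_restrict_space) simp_all
  then show ?thesis
  proof (rule integrable_lpos_bound[OF _ f])
    fix y :: real assume y: "y > 0"
    have "0 \<le> C0 * y powr q0" "0 \<le> C1 * y powr q1" using bound[OF y] by linarith+
    with bound[OF y] show "\<bar>f y\<bar> \<le> ?D y" using y by (auto simp: indicator_def)
  qed
qed

lemma kspan_weighted_bound:
  assumes "kspan b f" "p \<ge> 0" "p > b"
  shows "\<exists>C\<ge>0. \<forall>y>0. \<bar>f y * y ^ n\<bar> \<le> C * y powr (real n - p)"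
proof -
  obtain C where C: "C \<ge> 0" "\<And>y. y > 0 \<Longrightarrow> \<bar>f y\<bar> \<le> C * y powr (- p)" using kspan_bound[OF assms] by blast
  have "\<bar>f y * y ^ n\<bar> \<le> C * y powr (real n - p)" if y: "y > 0" for y
  proof -
    have "\<bar>f y * y ^ n\<bar> \<le> C * y powr (- p) * y powr real n"
      using y by (simp add: abs_mult powr_realpow C(2) mult_right_mono)
    also have "\<dots> = C * y powr (real n - p)" by (simp add: powr_add[symmetric])
    finally show ?thesis .
  qed
  with C(1) show ?thesis by blast
qed

lemma kspan_integrable:
  assumes f: "kspan b f" and n: "b < real n + 1"
    and h: "continuous_on {0<..} h" "\<And>y. y > 0 \<Longrightarrow> \<bar>h y\<bar> \<le> M"
  shows "integrable lpos (\<lambda>y. f y * y ^ n * h y)"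
proof -
  \<comment> \<open>\<open>p0\<close> is small enough for integrability at 0, and \<open>p1\<close> large enough at infinity.\<close>
  define p0 where "p0 = (max b 0 + (real n + 1)) / 2"
  define p1 where "p1 = real n + 2 + \<bar>b\<bar>"
  have p: "p0 \<ge> 0" "p0 > b" "p0 < real n + 1" "p1 \<ge> 0" "p1 > b" "p1 > real n + 1"
    using n unfolding p0_def p1_def by auto
  obtain C0 C1 where C: "C0 \<ge> 0" "\<And>y. y > 0 \<Longrightarrow> \<bar>f y * y ^ n\<bar> \<le> C0 * y powr (real n - p0)"
      "C1 \<ge> 0" "\<And>y. y > 0 \<Longrightarrow> \<bar>f y * y ^ n\<bar> \<le> C1 * y powr (real n - p1)"
    using kspan_weighted_bound[OF f] p by meson
  have M: "M \<ge> 0" using h(2)[of 1] by simp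
  show ?thesis
  proof (rule integrable_lpos_of_power_bounds)
    show "continuous_on {0<..} (\<lambda>y. f y * y ^ n * h y)"
      by (intro continuous_intros kspan_continuous[OF f] h)
    show "\<bar>f y * y ^ n * h y\<bar> \<le> (C0 * M) * y powr (real n - p0)" if "y > 0" for y
      using mult_mono[OF C(2)[OF that] h(2)[OF that]] C(1) by (simp add: abs_mult mult_ac)
    show "\<bar>f y * y ^ n * h y\<bar> \<le> (C1 * M) * y powr (real n - p1)" if "y > 0" for y
      using mult_mono[OF C(4)[OF that] h(2)[OF that]] C(3) by (simp add: abs_mult mult_ac)
  qed (use p in auto)
qed

lemma powr_tendsto_0_at_right: "p > 0 \<Longrightarrow> ((\<lambda>w::real. w powr p) \<longlongrightarrow> 0) (at_right 0)"
  by (intro tendsto_eq_rhs[OF tendsto_powr'[where a = 0 and b = p]]) (auto simp: eventually_at_filter)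

lemma kspan_tendsto_0:
  assumes f: "kspan b f" and h: "\<And>y. y > 0 \<Longrightarrow> \<bar>h y\<bar> \<le> M"
  shows "((\<lambda>y. f y * y ^ n * h y) \<longlongrightarrow> 0) at_top"
    and "b < real n \<Longrightarrow> n > 0 \<Longrightarrow> ((\<lambda>y. f y * y ^ n * h y) \<longlongrightarrow> 0) (at_right 0)"
proof -
  have M: "M \<ge> 0" using h[of 1] by simp
  have *: "((\<lambda>y. f y * y ^ n * h y) \<longlongrightarrow> 0) F"
    if p: "p \<ge> 0" "p > b" and F: "\<forall>\<^sub>F y in F. y > 0" "((\<lambda>y. y powr (real n - p)) \<longlongrightarrow> 0) F" for p F
  proof -
    obtain C where C: "C \<ge> 0" "\<And>y. y > 0 \<Longrightarrow> \<bar>f y * y ^ n\<bar> \<le> C * y powr (real n - p)"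
      using kspan_weighted_bound[OF f p] by blast
    show ?thesis
    proof (rule Lim_null_comparison)
      show "\<forall>\<^sub>F y in F. norm (f y * y ^ n * h y) \<le> (C * M) * y powr (real n - p)"
        using F(1)
      proof eventually_elim
        case (elim y)
        then show ?case
          using mult_mono[OF C(2)[OF elim] h[OF elim]] C(1) by (simp add: abs_mult mult_ac)
      qed
      show "((\<lambda>y. (C * M) * y powr (real n - p)) \<longlongrightarrow> 0) F"
        by (intro tendsto_mult_right_zero F(2))
    qed
  qed
  show "((\<lambda>y. f y * y ^ n * h y) \<longlongrightarrow> 0) at_top"
  proof (rule *[of "real n + 1 + \<bar>b\<bar>"])
    show "((\<lambda>y. y powr (real n - (real n + 1 + \<bar>b\<bar>))) \<longlongrightarrow> 0) at_top"
      by (intro tendsto_neg_powr filterlim_ident) auto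
  qed (auto simp: eventually_gt_at_top)
  show "((\<lambda>y. f y * y ^ n * h y) \<longlongrightarrow> 0) (at_right 0)" if "b < real n" "n > 0"
    by (rule *[of "(max b 0 + real n) / 2"])
       (use that in \<open>auto intro!: powr_tendsto_0_at_right simp: eventually_at_filter max_def\<close>)
qed

definition clprod :: "real \<Rightarrow> real \<Rightarrow> real \<Rightarrow> real \<Rightarrow> real \<Rightarrow> real" where
  "clprod a b A B y = clifford a (- (A * y)) * clifford b (- (B * y))"

lemma clprod_bound:
  assumes "a \<ge> -1/2" "b \<ge> -1/2" "A \<ge> 0" "B \<ge> 0" "y > 0"
  shows "\<bar>clprod a b A B y\<bar> \<le> rGamma (a + 1) * rGamma (b + 1)"
proof -
  have "\<bar>clifford a (- (A * y))\<bar> \<le> rGamma (a + 1)" "\<bar>clifford b (- (B * y))\<bar> \<le> rGamma (b + 1)"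
    using assms by (intro clifford_neg_bound; simp)+
  then show ?thesis unfolding clprod_def abs_mult by (intro mult_mono) auto
qed

lemma clprod_continuous: "continuous_on S (clprod a b A B)"
  unfolding clprod_def[abs_def] by (intro continuous_intros)

lemma clprod_commute: "clprod a b A B y = clprod b a B A y"
  by (simp add: clprod_def mult.commute)

text \<open>
  Up to a constant factor, the integral of the theorem in the variable \<open>y = x\<^sup>2/4\<close>.
\<close>
definition htrans :: "nat \<Rightarrow> real \<Rightarrow> real \<Rightarrow> (real \<Rightarrow> real) \<Rightarrow> real \<Rightarrow> real \<Rightarrow> real" where
  "htrans N a b f A B = (\<integral>y. f y * y ^ N * clprod a b A B y \<partial>lpos)"

lemma htrans_commute: "htrans N a b f A B = htrans N b a f B A"
  unfolding htrans_def by (subst clprod_commute) simp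

context
  fixes a b c A B :: real
  assumes ab: "a \<ge> -1/2" "b \<ge> -1/2" and AB: "A \<ge> 0" "B \<ge> 0"
begin

lemma htrans_integrable:
  assumes "kspan c f" "c < real N + 1"
  shows "integrable lpos (\<lambda>y. f y * y ^ N * clprod a b A B y)"
  by (rule kspan_integrable[OF assms clprod_continuous clprod_bound]) (use ab AB in auto)

lemma htrans_lin:
  assumes "kspan c f" "kspan c g" "c < real N + 1"
  shows "htrans N a b (\<lambda>y. p * f y + q * g y) A B = p * htrans N a b f A B + q * htrans N a b g A B"
proof -
  have "htrans N a b (\<lambda>y. p * f y + q * g y) A B =
     (\<integral>y. p * (f y * y ^ N * clprod a b A B y) + q * (g y * y ^ N * clprod a b A B y) \<partial>lpos)"
    unfolding htrans_def by (intro Bochner_Integration.integral_cong) (auto simp: algebra_simps)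
  then show ?thesis unfolding htrans_def
    using htrans_integrable[OF assms(1,3)] htrans_integrable[OF assms(2,3)] by simp
qed

text \<open>
  The function \<open>f y * y ^ (N + 1) * clprod a b A B y\<close> vanishes at 0 and at infinity, so its
  derivative has integral 0.
\<close>
lemma htrans_by_parts:
  assumes f: "kspan c f" and g: "kspan c g" "\<And>y. y > 0 \<Longrightarrow> (f has_real_derivative g y / y) (at y)"
    and N: "c < real N + 1"
  shows "(real N + 1) * htrans N a b f A B + htrans N a b g A B =
     A * htrans (N + 1) (a + 1) b f A B + B * htrans (N + 1) a (b + 1) f A B"
proof -
  have i1: "integrable lpos (\<lambda>y. f y * y ^ N * clprod a b A B y)"
       "integrable lpos (\<lambda>y. g y * y ^ N * clprod a b A B y)"
    using htrans_integrable f g(1) N by auto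
  have i2: "integrable lpos (\<lambda>y. f y * y ^ (N + 1) * clprod (a + 1) b A B y)"
       "integrable lpos (\<lambda>y. f y * y ^ (N + 1) * clprod a (b + 1) A B y)"
    using N ab AB
    by (intro kspan_integrable[OF f _ clprod_continuous clprod_bound]; simp)+
  let ?d = "\<lambda>y. (real N + 1) * (f y * y ^ N * clprod a b A B y) + g y * y ^ N * clprod a b A B y
      - A * (f y * y ^ (N + 1) * clprod (a + 1) b A B y) - B * (f y * y ^ (N + 1) * clprod a (b + 1) A B y)"
  have "(\<integral>y. ?d y \<partial>lpos) = 0 - 0"
  proof (rule integral_lpos_FTC[where F = "\<lambda>y. f y * y ^ (N + 1) * clprod a b A B y"])
    fix y :: real assume y: "y > 0"
    show "((\<lambda>y. f y * y ^ (N + 1) * clprod a b A B y) has_real_derivative ?d y) (at y)"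
    proof -
      have "((\<lambda>y. y ^ (N + 1)) has_real_derivative (real N + 1) * y ^ N) (at y)"
        using DERIV_pow[of "N + 1" y] by (simp add: add.commute)
      moreover have "((\<lambda>y. clprod a b A B y) has_real_derivative
          - A * clprod (a + 1) b A B y - B * clprod a (b + 1) A B y) (at y)"
        unfolding clprod_def by (auto intro!: derivative_eq_intros)
      ultimately have "((\<lambda>y. f y * y ^ (N + 1) * clprod a b A B y) has_real_derivative
          (g y / y * y ^ (N + 1) + (real N + 1) * y ^ N * f y) * clprod a b A B y
          + (- A * clprod (a + 1) b A B y - B * clprod a (b + 1) A B y) * (f y * y ^ (N + 1))) (at y)"
        by (intro DERIV_mult g(2)[OF y])
      moreover have p: "g y / y * y ^ (N + 1) = g y * y ^ N" using y by simp
      have "(g y / y * y ^ (N + 1) + (real N + 1) * y ^ N * f y) * clprod a b A B y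
          + (- A * clprod (a + 1) b A B y - B * clprod a (b + 1) A B y) * (f y * y ^ (N + 1)) = ?d y"
        unfolding p by (simp add: algebra_simps)
      ultimately show ?thesis by (simp only:)
    qed
  next
    show "continuous_on {0<..} ?d"
      by (intro continuous_intros kspan_continuous[OF f] kspan_continuous[OF g(1)] clprod_continuous)
    show "integrable lpos ?d"
      by (intro Bochner_Integration.integrable_add Bochner_Integration.integrable_diff integrable_mult_right i1 i2)
    show "((\<lambda>y. f y * y ^ (N + 1) * clprod a b A B y) \<longlongrightarrow> 0) (at_right 0)"
         "((\<lambda>y. f y * y ^ (N + 1) * clprod a b A B y) \<longlongrightarrow> 0) at_top"
      by (rule kspan_tendsto_0[OF f clprod_bound]; use ab AB N in auto)+
  qed
  then show ?thesis unfolding htrans_def using i1 i2 by simp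
qed

end

text \<open>
  Affine paths cover the two cases in use: \<open>A\<close> varies alone, or \<open>(A, B)\<close> moves along a ray.
\<close>
lemma htrans_has_derivative:
  fixes a b c A0 A1 B0 B1 s :: real
  assumes ab: "a \<ge> -1/2" "b \<ge> -1/2" and AB: "A0 \<ge> 0" "A1 \<ge> 0" "B0 \<ge> 0" "B1 \<ge> 0"
    and f: "kspan c f" "c < real N + 1" and s: "s \<ge> 0"
  shows "((\<lambda>s. htrans N a b f (A0 + s * A1) (B0 + s * B1)) has_real_derivative
     - (A1 * htrans (N + 1) (a + 1) b f (A0 + s * A1) (B0 + s * B1)
       + B1 * htrans (N + 1) a (b + 1) f (A0 + s * A1) (B0 + s * B1))) (at s within {0..})"
proof -
  let ?A = "\<lambda>s. A0 + s * A1" and ?B = "\<lambda>s. B0 + s * B1"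
  let ?d = "\<lambda>s y. - (A1 * (f y * y ^ (N + 1) * clprod (a + 1) b (?A s) (?B s) y)
      + B1 * (f y * y ^ (N + 1) * clprod a (b + 1) (?A s) (?B s) y))"
  have pos: "?A s \<ge> 0" "?B s \<ge> 0" if "s \<ge> 0" for s using that AB by auto
  define M where "M = A1 * (rGamma (a + 1 + 1) * rGamma (b + 1)) + B1 * (rGamma (a + 1) * rGamma (b + 1 + 1))"
  have int1: "integrable lpos (\<lambda>y. f y * y ^ (N + 1) * clprod (a + 1) b (?A s) (?B s) y)"
    and int2: "integrable lpos (\<lambda>y. f y * y ^ (N + 1) * clprod a (b + 1) (?A s) (?B s) y)" if "s \<ge> 0" for s
    using f ab pos[OF that] htrans_integrable[of "a + 1" b "?A s" "?B s" c f "N + 1"]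
      htrans_integrable[of a "b + 1" "?A s" "?B s" c f "N + 1"] by simp_all
  have "((\<lambda>s. \<integral>y. f y * y ^ N * clprod a b (?A s) (?B s) y \<partial>lpos) has_real_derivative
      (\<integral>y. ?d s y \<partial>lpos)) (at s within {0..})"
  proof (rule has_derivative_integral_dominated[where w = "\<lambda>y. \<bar>f y * y ^ (N + 1) * 1\<bar> * M"])
    show "integrable lpos (\<lambda>y. f y * y ^ N * clprod a b (?A s) (?B s) y)" if "s \<in> {0..}" for s
      by (rule htrans_integrable) (use ab f pos that in auto)
    show "?d s \<in> borel_measurable lpos"
      by (intro measurable_lposI continuous_intros kspan_continuous[OF f(1)] clprod_continuous)
    show "integrable lpos (\<lambda>y. \<bar>f y * y ^ (N + 1) * 1\<bar> * M)"
      using f(2) by (intro integrable_mult_left integrable_abs kspan_integrable[OF f(1), where M = 1]) auto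
    fix x y :: real assume x: "x \<in> {0..}" and "y \<in> space lpos"
    then have y: "y > 0" by (simp add: space_lpos)
    show "((\<lambda>x. f y * y ^ N * clprod a b (?A x) (?B x) y) has_real_derivative ?d x y) (at x within {0..})"
      unfolding clprod_def by (auto intro!: derivative_eq_intros simp: algebra_simps)
    have "\<bar>clprod (a + 1) b (?A x) (?B x) y\<bar> \<le> rGamma (a + 1 + 1) * rGamma (b + 1)"
         "\<bar>clprod a (b + 1) (?A x) (?B x) y\<bar> \<le> rGamma (a + 1) * rGamma (b + 1 + 1)"
      using ab pos[of x] x y by (intro clprod_bound; simp)+
    then have "\<bar>A1 * clprod (a + 1) b (?A x) (?B x) y + B1 * clprod a (b + 1) (?A x) (?B x) y\<bar> \<le> M"
      unfolding M_def
      by (intro order_trans[OF abs_triangle_ineq] add_mono) (auto simp: abs_mult AB intro!: mult_left_mono)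
    then have "\<bar>f y * y ^ (N + 1)\<bar> * \<bar>A1 * clprod (a + 1) b (?A x) (?B x) y + B1 * clprod a (b + 1) (?A x) (?B x) y\<bar>
       \<le> \<bar>f y * y ^ (N + 1)\<bar> * M" by (rule mult_left_mono) simp
    moreover have "?d x y = - ((f y * y ^ (N + 1)) * (A1 * clprod (a + 1) b (?A x) (?B x) y + B1 * clprod a (b + 1) (?A x) (?B x) y))"
      by (simp add: algebra_simps)
    ultimately show "\<bar>?d x y\<bar> \<le> \<bar>f y * y ^ (N + 1) * 1\<bar> * M"
      by (simp only: abs_minus_cancel abs_mult mult_1_right)
  qed (use s in auto)
  then show ?thesis unfolding htrans_def using int1[OF s] int2[OF s] by simp
qed

section \<open>The transform for \<open>j = 0\<close> and equal orders\<close>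

text \<open>
  If \<open>A\<close> and \<open>B\<close> are the squares of \<open>sin \<theta> / (cos \<theta> + cos \<phi>)\<close> and \<open>sin \<phi> / (cos \<theta> + cos \<phi>)\<close>, then
  \<open>rho A B = 2 / (cos \<theta> + cos \<phi>)\<close>, \<open>cosX A B = cos \<theta>\<close> and \<open>cosY A B = cos \<phi>\<close>.
\<close>
definition rho :: "real \<Rightarrow> real \<Rightarrow> real" where
  "rho A B = sqrt (1 + 2 * A + 2 * B + (A - B)\<^sup>2)"

definition cosX :: "real \<Rightarrow> real \<Rightarrow> real" where "cosX A B = (1 - A + B) / rho A B"
definition cosY :: "real \<Rightarrow> real \<Rightarrow> real" where "cosY A B = (1 + A - B) / rho A B"

lemma rho_pos: "A \<ge> 0 \<Longrightarrow> B \<ge> 0 \<Longrightarrow> rho A B > 0"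
  unfolding rho_def by (intro real_sqrt_gt_zero) (simp add: add_pos_nonneg)

lemma rho_square: "A \<ge> 0 \<Longrightarrow> B \<ge> 0 \<Longrightarrow> (rho A B)\<^sup>2 = 1 + 2 * A + 2 * B + (A - B)\<^sup>2"
  unfolding rho_def by (intro real_sqrt_pow2) (simp add: add_pos_nonneg)

lemma rho_commute: "rho A B = rho B A"
  by (simp add: rho_def power2_commute add_ac)

lemma rho_has_derivative:
  assumes "A0 + s * A1 \<ge> 0" "B0 + s * B1 \<ge> 0"
  shows "((\<lambda>s. rho (A0 + s * A1) (B0 + s * B1)) has_real_derivative
    (A1 + B1 + (A0 + s * A1 - (B0 + s * B1)) * (A1 - B1)) / rho (A0 + s * A1) (B0 + s * B1)) (at s within S)"
proof -
  let ?q = "\<lambda>s. 1 + 2 * (A0 + s * A1) + 2 * (B0 + s * B1) + (A0 + s * A1 - (B0 + s * B1))\<^sup>2"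
  have cancel: "inverse r / 2 * (2 * z) = z / r" for r z :: real by (simp add: field_simps)
  have pos: "?q s > 0" using assms by (simp add: add_pos_nonneg)
  have "(?q has_real_derivative 2 * (A1 + B1 + (A0 + s * A1 - (B0 + s * B1)) * (A1 - B1))) (at s within S)"
    by (auto intro!: derivative_eq_intros simp: power2_eq_square algebra_simps)
  from DERIV_chain2[OF DERIV_real_sqrt[OF pos] this] show ?thesis
    unfolding rho_def by (rule DERIV_cong) (rule cancel)
qed

text \<open>
  Found with undetermined coefficients: a combination of four products of \<open>k\<^sub>b\<close>, \<open>E\<^sub>b(-Ay)\<close>, \<open>E\<^sub>b(-By)\<close> and
  their derivatives that becomes, after multiplication by \<open>y powr (2b+1)\<close> and differentiation, a combination of the
  two products in \<open>base_telescoper\<close>.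
\<close>
definition telescoper :: "real \<Rightarrow> real \<Rightarrow> real \<Rightarrow> real \<Rightarrow> real" where
  "telescoper b A B y = - (1 + A - B) * kint b y * clprod b b A B y + B * (1 - A + B) * (y * kint b y) * clprod (b + 1) (b + 1) A B y
       - (1 + A + B) * (y * kint (b + 1) y) * clprod (b + 1) b A B y + 2 * B * (y * kint (b + 1) y) * clprod b (b + 1) A B y"

lemma base_telescoper:
  fixes b A B y :: real
  assumes y: "y > 0" and n: "real n = 2 * b + 1"
  shows "((\<lambda>y. y ^ n * telescoper b A B y) has_real_derivative
       (1 + 2 * A + 2 * B + (A - B)\<^sup>2) * (kint b y * y ^ n * clprod (b + 1) b A B y)
         - real n * (1 + A - B) * (kint b y * y ^ (n - 1) * clprod b b A B y)) (at y)"
proof -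
  define k0 k1 where "k0 = kint b" and "k1 = kint (b + 1)"
  note k0_def = this(1) and k1_def = this(2)
  let ?a0 = "\<lambda>y. clifford b (- (A * y))" and ?a1 = "\<lambda>y. clifford (b + 1) (- (A * y))"
  let ?b0 = "\<lambda>y. clifford b (- (B * y))" and ?b1 = "\<lambda>y. clifford (b + 1) (- (B * y))"
  have da0: "(?a0 has_real_derivative - A * ?a1 y) (at y)" and db0: "(?b0 has_real_derivative - B * ?b1 y) (at y)"
    by (auto intro!: derivative_eq_intros)
  have *: "((\<lambda>y. clifford (b + 1) (- (c * y))) has_real_derivative
      (clifford b (- (c * y)) - (b + 1) * clifford (b + 1) (- (c * y))) / y) (at y)" for c
  proof -
    have "((\<lambda>y. clifford (b + 1) (- (c * y))) has_real_derivative clifford (b + 2) (- (c * y)) * - c) (at y)"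
      by (auto intro!: derivative_eq_intros simp: add.assoc)
    moreover have "clifford (b + 2) (- (c * y)) * - c = (clifford b (- (c * y)) - (b + 1) * clifford (b + 1) (- (c * y))) / y"
      using clifford_lower[of b "- (c * y)"] y by (simp add: field_simps)
    ultimately show ?thesis by simp
  qed
  note da1 = *[of A] and db1 = *[of B]
  have dk0: "(k0 has_real_derivative - k1 y) (at y)" unfolding k0_def k1_def by (rule kint_has_derivative[OF y])
  have dk1: "(k1 has_real_derivative - (((b + 1) * k1 y + k0 y) / y)) (at y)"
  proof -
    have "kint (b + 1 + 1) y = ((b + 1) * kint (b + 1) y + kint b y) / y"
      using kint_lower[OF y, of b] y by (simp add: field_simps)
    then show ?thesis unfolding k0_def k1_def using kint_has_derivative[OF y, of "b + 1"] by simp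
  qed
  define u0 u1 v0 v1 p0 p1 where "u0 = ?a0 y" "u1 = ?a1 y" "v0 = ?b0 y" "v1 = ?b1 y" "p0 = k0 y" "p1 = k1 y"
  note ab = this
  let ?psi = "\<lambda>y. - (1 + A - B) * k0 y * (?a0 y * ?b0 y) + B * (1 - A + B) * (y * k0 y) * (?a1 y * ?b1 y)
       - (1 + A + B) * (y * k1 y) * (?a1 y * ?b0 y) + 2 * B * (y * k1 y) * (?a0 y * ?b1 y)"
  have dn: "((\<lambda>y. y ^ n) has_real_derivative real n * y ^ (n - 1)) (at y)"
    using DERIV_pow[of n y] by simp
  define E1 E2 E3 E4 where "E1 = - p1 * (u0 * v0) + p0 * (- A * u1 * v0 - B * u0 * v1)"
    and "E2 = (p0 - y * p1) * (u1 * v1) + p0 * ((u0 - (b + 1) * u1) * v1 + u1 * (v0 - (b + 1) * v1))"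
    and "E3 = (- b * p1 - p0) * (u1 * v0) + p1 * ((u0 - (b + 1) * u1) * v0 - B * y * u1 * v1)"
    and "E4 = (- b * p1 - p0) * (u0 * v1) + p1 * (- A * y * u1 * v1 + u0 * (v0 - (b + 1) * v1))"
  note Es = this
  have dyk0: "((\<lambda>y. y * k0 y) has_real_derivative p0 - y * p1) (at y)"
    using DERIV_mult[OF DERIV_ident dk0] by (simp add: ab mult.commute)
  have dyk1: "((\<lambda>y. y * k1 y) has_real_derivative - b * p1 - p0) (at y)"
    using DERIV_mult[OF DERIV_ident dk1] by (rule DERIV_cong) (use y in \<open>simp add: ab field_simps\<close>)
  have M1: "((\<lambda>y. k0 y * (?a0 y * ?b0 y)) has_real_derivative E1) (at y)"
    using DERIV_mult[OF dk0 DERIV_mult[OF da0 db0]] by (rule DERIV_cong) (simp add: ab Es algebra_simps)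
  have M2: "((\<lambda>y. y * k0 y * (?a1 y * ?b1 y)) has_real_derivative E2) (at y)"
    using DERIV_mult[OF dyk0 DERIV_mult[OF da1 db1]]
    by (rule DERIV_cong) (use y in \<open>simp add: ab Es field_simps\<close>)
  have M3: "((\<lambda>y. y * k1 y * (?a1 y * ?b0 y)) has_real_derivative E3) (at y)"
    using DERIV_mult[OF dyk1 DERIV_mult[OF da1 db0]]
    by (rule DERIV_cong) (use y in \<open>simp add: ab Es field_simps\<close>)
  have M4: "((\<lambda>y. y * k1 y * (?a0 y * ?b1 y)) has_real_derivative E4) (at y)"
    using DERIV_mult[OF dyk1 DERIV_mult[OF da0 db1]]
    by (rule DERIV_cong) (use y in \<open>simp add: ab Es field_simps\<close>)
  let ?E = "- (1 + A - B) * E1 + B * (1 - A + B) * E2 - (1 + A + B) * E3 + 2 * B * E4"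
  have "(?psi has_real_derivative ?E) (at y)"
    using DERIV_add[OF DERIV_diff[OF DERIV_add[OF DERIV_cmult[OF M1, of "- (1 + A - B)"]
        DERIV_cmult[OF M2, of "B * (1 - A + B)"]] DERIV_cmult[OF M3, of "1 + A + B"]] DERIV_cmult[OF M4, of "2 * B"]]
    by (simp only: mult.assoc)
  from DERIV_mult[OF dn this]
  have "((\<lambda>y. y ^ n * ?psi y) has_real_derivative real n * y ^ (n - 1) * ?psi y + ?E * y ^ n) (at y)" .
  moreover have "real n * y ^ (n - 1) * ?psi y + ?E * y ^ n = (1 + 2 * A + 2 * B + (A - B)\<^sup>2) * (p0 * y ^ n * (u1 * v0))
         - real n * (1 + A - B) * (p0 * y ^ (n - 1) * (u0 * v0))"
  proof -
    have yn: "real n * y ^ (n - 1) * y = real n * y ^ n" by (cases n) simp_all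
    define w where "w = real n * y ^ (n - 1)"
    have w: "w * y = (2 * b + 1) * y ^ n" using yn n by (simp add: w_def)
    have psi: "?psi y = - (1 + A - B) * p0 * (u0 * v0) + y * (B * (1 - A + B) * p0 * (u1 * v1)
       - (1 + A + B) * p1 * (u1 * v0) + 2 * B * p1 * (u0 * v1))"
      unfolding ab by (simp add: algebra_simps)
    define z where "z = y ^ n"
    have "w * ?psi y + ?E * z = (1 + 2 * A + 2 * B + (A - B)\<^sup>2) * (p0 * z * (u1 * v0))
         - w * (1 + A - B) * (p0 * (u0 * v0))"
      using w unfolding psi Es z_def[symmetric] by algebra
    then show ?thesis unfolding w_def z_def by (simp add: mult_ac)
  qed
  ultimately show ?thesis unfolding telescoper_def clprod_def ab k0_def k1_def by (simp only:)
qed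

text \<open>
  Integration of the telescoper from 0 to infinity. Only its first term can contribute at 0, namely \<open>L\<close>.
  For \<open>n = 0\<close>, that is \<open>b = -1/2\<close>, the exponent \<open>n - 1\<close> is a truncated difference; the term with it has the factor 0.
\<close>
lemma htrans_telescoped:
  assumes b: "b \<ge> -1/2" and n: "real n = 2 * b + 1" and AB: "A \<ge> 0" "B \<ge> 0"
    and i: "n = 0 \<or> integrable lpos (\<lambda>y. kint b y * y ^ (n - 1) * clprod b b A B y)"
    and L: "((\<lambda>y. kint b y * y ^ n * clprod b b A B y) \<longlongrightarrow> L) (at_right 0)"
  shows "(rho A B)\<^sup>2 * htrans n (b + 1) b (kint b) A B
     = real n * (1 + A - B) * htrans (n - 1) b b (kint b) A B + (1 + A - B) * L"
proof -
  let ?F = "\<lambda>y. y ^ n * telescoper b A B y"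
  let ?u = "\<lambda>y. kint b y * y ^ (n - 1) * clprod b b A B y" and ?v = "\<lambda>y. kint b y * y ^ n * clprod (b + 1) b A B y"
  let ?f = "\<lambda>y. (1 + 2 * A + 2 * B + (A - B)\<^sup>2) * ?v y - real n * (1 + A - B) * ?u y"
  have F: "?F = (\<lambda>y. - (1 + A - B) * (kint b y * y ^ n * clprod b b A B y)
       + B * (1 - A + B) * (kint b y * y ^ (n + 1) * clprod (b + 1) (b + 1) A B y)
       - (1 + A + B) * (kint (b + 1) y * y ^ (n + 1) * clprod (b + 1) b A B y)
       + 2 * B * (kint (b + 1) y * y ^ (n + 1) * clprod b (b + 1) A B y))"
    by (rule ext) (simp add: telescoper_def algebra_simps)
  have bnd: "\<bar>clprod (b + i) (b + j) A B y\<bar> \<le> rGamma (b + i + 1) * rGamma (b + j + 1)"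
    if "i \<ge> 0" "j \<ge> 0" "y > 0" for i j y
    using that AB b by (intro clprod_bound) auto
  note bnds = bnd[of 0 0] bnd[of 1 1] bnd[of 1 0] bnd[of 0 1]
  have i1: "integrable lpos ?v"
    using b n AB by (intro htrans_integrable[OF _ _ _ _ kspan_kint]) auto
  have i0: "integrable lpos (\<lambda>y. real n * (1 + A - B) * ?u y)" using i by auto
  have "(?F \<longlongrightarrow> - (1 + A - B) * 0 + B * (1 - A + B) * 0 - (1 + A + B) * 0 + 2 * B * 0) at_top"
    unfolding F using bnds by (intro tendsto_intros kspan_tendsto_0(1)[OF kspan_kint]) auto
  then have top: "(?F \<longlongrightarrow> 0) at_top" by simp
  have "(?F \<longlongrightarrow> - (1 + A - B) * L + B * (1 - A + B) * 0 - (1 + A + B) * 0 + 2 * B * 0) (at_right 0)"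
    unfolding F using b n bnds by (intro tendsto_intros L kspan_tendsto_0(2)[OF kspan_kint]) auto
  then have bot: "(?F \<longlongrightarrow> - (1 + A - B) * L) (at_right 0)" by simp
  have "(\<integral>y. ?f y \<partial>lpos) = 0 - (- (1 + A - B) * L)"
  proof (rule integral_lpos_FTC[OF base_telescoper[OF _ n] _ _ bot top])
    show "continuous_on {0<..} ?f" by (intro continuous_intros continuous_on_kint clprod_continuous)
    show "integrable lpos ?f" by (rule Bochner_Integration.integrable_diff[OF integrable_mult_right[OF i1] i0])
  qed
  moreover have "(\<integral>y. ?f y \<partial>lpos) = (1 + 2 * A + 2 * B + (A - B)\<^sup>2) * (\<integral>y. ?v y \<partial>lpos)
      - real n * (1 + A - B) * (\<integral>y. ?u y \<partial>lpos)"
    by (subst Bochner_Integration.integral_diff[OF integrable_mult_right[OF i1] i0]) (simp only: integral_mult_right_zero)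
  ultimately show ?thesis unfolding htrans_def rho_square[OF AB] by algebra
qed

lemma htrans_first_order:
  assumes b: "b \<ge> 0" and N: "real N = 2 * b" and AB: "A \<ge> 0" "B \<ge> 0"
  shows "(rho A B)\<^sup>2 * htrans (N + 1) (b + 1) b (kint b) A B = (real N + 1) * (1 + A - B) * htrans N b b (kint b) A B"
proof -
  have "integrable lpos (\<lambda>y. kint b y * y ^ N * clprod b b A B y)"
    using b N AB by (intro htrans_integrable[OF _ _ _ _ kspan_kint]) auto
  moreover have "((\<lambda>y. kint b y * y ^ (N + 1) * clprod b b A B y) \<longlongrightarrow> 0) (at_right 0)"
    by (rule kspan_tendsto_0(2)[OF kspan_kint clprod_bound]) (use b N AB in auto)
  ultimately show ?thesis
    using htrans_telescoped[of b "N + 1" A B 0] b N AB by (simp add: add.commute)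
qed

text \<open>
  By the first-order equation and its mirror image, \<open>rho ^ (N + 1)\<close> times the transform is constant
  along rays from the origin.
\<close>
lemma htrans_base:
  assumes b: "b \<ge> 0" and N: "real N = 2 * b" and AB: "A \<ge> 0" "B \<ge> 0"
  shows "htrans N b b (kint b) A B = htrans N b b (kint b) 0 0 * (1 / rho A B) ^ (N + 1)"
proof -
  let ?T = "\<lambda>s. htrans N b b (kint b) (s * A) (s * B)" and ?r = "\<lambda>s. rho (s * A) (s * B)"
  have "((\<lambda>s. ?T s * ?r s ^ (N + 1)) has_real_derivative 0) (at s within {0..})" if s: "s \<in> {0..}" for s
  proof -
    have p: "s * A \<ge> 0" "s * B \<ge> 0" using s AB by auto
    have r: "?r s > 0" using p by (rule rho_pos)
    let ?T10 = "htrans (N + 1) (b + 1) b (kint b) (s * A) (s * B)"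
    let ?T01 = "htrans (N + 1) b (b + 1) (kint b) (s * A) (s * B)"
    have dT: "(?T has_real_derivative - (A * ?T10 + B * ?T01)) (at s within {0..})"
      using htrans_has_derivative[of b b 0 A 0 B b "kint b" N s] b AB N s kspan_kint by simp
    have dr: "(?r has_real_derivative (A + B + (s * A - s * B) * (A - B)) / ?r s) (at s within {0..})"
      using rho_has_derivative[of 0 s A 0 B] p by simp
    have t10: "(?r s)\<^sup>2 * ?T10 = (real N + 1) * (1 + s * A - s * B) * ?T s"
      by (rule htrans_first_order[OF b N p])
    have t01: "(?r s)\<^sup>2 * ?T01 = (real N + 1) * (1 + s * B - s * A) * ?T s"
      using htrans_first_order[OF b N p(2,1)]
      unfolding htrans_commute[of "N + 1" "b + 1" b "kint b" "s * B"] htrans_commute[of N b b "kint b" "s * B"]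
        rho_commute[of "s * B"] .
    have "((\<lambda>s. ?T s * ?r s ^ (N + 1)) has_real_derivative
        - (A * ?T10 + B * ?T01) * ?r s ^ (N + 1)
         + (real (N + 1) * ?r s ^ N * ((A + B + (s * A - s * B) * (A - B)) / ?r s)) * ?T s) (at s within {0..})"
      using DERIV_mult[OF dT DERIV_power[OF dr, of "N + 1"]] by (simp add: mult_ac)
    moreover have "- (A * ?T10 + B * ?T01) * ?r s ^ (N + 1)
         + (real (N + 1) * ?r s ^ N * ((A + B + (s * A - s * B) * (A - B)) / ?r s)) * ?T s = 0"
    proof -
      have "(?r s) * (- (A * ?T10 + B * ?T01) * ?r s ^ (N + 1)
         + (real (N + 1) * ?r s ^ N * ((A + B + (s * A - s * B) * (A - B)) / ?r s)) * ?T s)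
        = ?r s ^ N * (- (A * ((?r s)\<^sup>2 * ?T10) + B * ((?r s)\<^sup>2 * ?T01))
         + (real N + 1) * (A + B + (s * A - s * B) * (A - B)) * ?T s)"
        using r by (simp add: field_simps power2_eq_square)
      also have "\<dots> = 0" unfolding t10 t01 by (simp add: algebra_simps)
      finally show ?thesis using r by simp
    qed
    ultimately show ?thesis by simp
  qed
  from has_field_derivative_zero_constant[OF convex_real_interval(1) this]
  obtain c where c: "\<And>s. s \<ge> 0 \<Longrightarrow> ?T s * ?r s ^ (N + 1) = c" by auto
  have "rho 0 0 = 1" by (simp add: rho_def)
  then have "htrans N b b (kint b) A B * rho A B ^ (N + 1) = htrans N b b (kint b) 0 0"
    using c[of 0] c[of 1] by simp
  then show ?thesis using rho_pos[OF AB] by (simp add: field_simps)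
qed

text \<open>
  The limit of \<open>kint (- 1 / 2)\<close> at 0 gives a boundary term in place of the divergent integral.
\<close>
lemma htrans_base_half:
  assumes AB: "A \<ge> 0" "B \<ge> 0"
  shows "(rho A B)\<^sup>2 * htrans 0 (1 / 2) (- 1 / 2) (kint (- 1 / 2)) A B
     = (1 + A - B) * (Gamma (1 / 2) * (rGamma (1 / 2) * rGamma (1 / 2)))"
proof -
  let ?b = "- 1 / 2 :: real"
  have "(clprod ?b ?b A B \<longlongrightarrow> clprod ?b ?b A B 0) (at_right 0)"
    using clprod_continuous[of UNIV ?b ?b A B]
    by (auto simp: continuous_on_eq_continuous_at isCont_def intro: tendsto_within_subset)
  then have "((\<lambda>y. kint ?b y * y ^ 0 * clprod ?b ?b A B y) \<longlongrightarrow> Gamma (- ?b) * 0 ^ 0 * clprod ?b ?b A B 0) (at_right 0)"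
    by (intro tendsto_intros kint_tendsto_0) auto
  from htrans_telescoped[OF _ _ AB _ this] show ?thesis by (simp add: clprod_def)
qed

section \<open>Raising the order and the index \<open>j\<close>\<close>

lemma Gamma_real_nonzero: "x > 0 \<Longrightarrow> Gamma x \<noteq> 0" for x :: real
  by (frule Gamma_real_pos) linarith

lemma at_within_Ici_nontrivial: "x \<ge> 0 \<Longrightarrow> at x within {0..} \<noteq> bot" for x :: real
proof
  assume "x \<ge> 0" and b: "at x within {0..} = bot"
  then have "at_right x \<le> at x within {0..}" by (intro at_le) auto
  with b have "at_right x = bot" by (simp add: bot_unique)
  then show False using trivial_limit_at_right_real[of x] by simp
qed

lemma rho_derivative_A:
  assumes "A \<ge> 0" "B \<ge> 0"
  shows "((\<lambda>A. rho A B) has_real_derivative cosY A B) (at A within S)"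
  using rho_has_derivative[of 0 A 1 B 0 S] assms by (simp add: cosY_def add_diff_eq)

lemma cosY_derivative_A:
  assumes "A \<ge> 0" "B \<ge> 0"
  shows "((\<lambda>A. cosY A B) has_real_derivative (1 - (cosY A B)\<^sup>2) / rho A B) (at A within S)"
proof -
  have r: "rho A B > 0" using assms by (rule rho_pos)
  have "((\<lambda>A. 1 + A - B) has_real_derivative 1) (at A within S)" by (auto intro!: derivative_eq_intros)
  from DERIV_divide[OF this rho_derivative_A[OF assms]] r
  have "((\<lambda>A. cosY A B) has_real_derivative (1 * rho A B - (1 + A - B) * cosY A B) / (rho A B * rho A B)) (at A within S)"
    unfolding cosY_def by simp
  moreover have "(1 * rho A B - (1 + A - B) * cosY A B) / (rho A B * rho A B) = (1 - (cosY A B)\<^sup>2) / rho A B"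
    using r unfolding cosY_def by (simp add: field_simps power2_eq_square)
  ultimately show ?thesis by simp
qed

text \<open>
  Both sides are differentiated in \<open>A\<close>, one-sidedly if \<open>A = 0\<close>. On the right, the derivatives of \<open>rho\<close>
  and \<open>cosY\<close> combine to the derivative rule of Gegenbauer polynomials since \<open>2l + m = N + 1\<close>.
\<close>
lemma htrans_raise_order:
  fixes K :: real
  assumes ab: "a \<ge> -1/2" "b \<ge> -1/2" and f: "kspan c f" "c < real N + 1"
    and l: "l > 0 \<or> l = 0 \<and> m \<ge> 1" and N: "2 * l + real m = real N + 1"
    and eq: "\<And>A B. A \<ge> 0 \<Longrightarrow> B \<ge> 0 \<Longrightarrow> htrans N a b f A B = K * (1 / rho A B) ^ (N + 1) * geg_hat m l (cosY A B)"
    and AB: "A \<ge> 0" "B \<ge> 0"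
  shows "htrans (N + 1) (a + 1) b f A B = (K * (real m + 1)) * (1 / rho A B) ^ (N + 2) * geg_hat (m + 1) l (cosY A B)"
proof -
  let ?r = "rho A B" and ?Y = "cosY A B"
  let ?g = "geg_hat m l ?Y" and ?g' = "geg_hat' m l ?Y"
  have r: "?r > 0" using AB by (rule rho_pos)
  have dT: "((\<lambda>A. htrans N a b f A B) has_real_derivative - htrans (N + 1) (a + 1) b f A B) (at A within {0..})"
    using htrans_has_derivative[of a b 0 1 B 0 c f N A] ab AB f by simp
  have dr: "((\<lambda>A. 1 / rho A B) has_real_derivative - ?Y / ?r\<^sup>2) (at A within {0..})"
    using DERIV_inverse_fun[OF rho_derivative_A[OF AB, of "{0..}"]] r
    by (simp add: inverse_eq_divide power2_eq_square)
  have dp: "((\<lambda>A. (1 / rho A B) ^ (N + 1)) has_real_derivative (real N + 1) * (1 / ?r) ^ N * (- ?Y / ?r\<^sup>2)) (at A within {0..})"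
    by (rule DERIV_cong[OF DERIV_power[OF dr]]) (simp add: add.commute mult_ac)
  have dg: "((\<lambda>A. geg_hat m l (cosY A B)) has_real_derivative ?g' * ((1 - ?Y\<^sup>2) / ?r)) (at A within {0..})"
    by (rule DERIV_chain2[OF geg_hat_has_derivative cosY_derivative_A[OF AB]])
  have "((\<lambda>A. K * ((1 / rho A B) ^ (N + 1) * geg_hat m l (cosY A B))) has_real_derivative
      K * ((real N + 1) * (1 / ?r) ^ N * (- ?Y / ?r\<^sup>2) * ?g + ?g' * ((1 - ?Y\<^sup>2) / ?r) * (1 / ?r) ^ (N + 1))) (at A within {0..})"
    by (intro DERIV_cmult DERIV_mult dp dg)
  then have "((\<lambda>A. htrans N a b f A B) has_real_derivative
      K * ((real N + 1) * (1 / ?r) ^ N * (- ?Y / ?r\<^sup>2) * ?g + ?g' * ((1 - ?Y\<^sup>2) / ?r) * (1 / ?r) ^ (N + 1))) (at A within {0..})"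
    by (rule has_field_derivative_transform_within[where d = 1]) (use eq AB in \<open>auto simp: mult.assoc\<close>)
  moreover have "at A within {0..} \<noteq> bot"
    using AB(1) by (rule at_within_Ici_nontrivial)
  ultimately have "- htrans (N + 1) (a + 1) b f A B =
      K * ((real N + 1) * (1 / ?r) ^ N * (- ?Y / ?r\<^sup>2) * ?g + ?g' * ((1 - ?Y\<^sup>2) / ?r) * (1 / ?r) ^ (N + 1))"
    using dT by (metis has_field_derivative_unique)
  also have "\<dots> = K * (1 / ?r) ^ (N + 2) * ((1 - ?Y\<^sup>2) * ?g' - (real N + 1) * ?Y * ?g)"
    using r by (simp add: field_simps power2_eq_square)
  also have "(1 - ?Y\<^sup>2) * ?g' - (real N + 1) * ?Y * ?g = - (real m + 1) * geg_hat (m + 1) l ?Y"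
    unfolding geg_hat'_eq[OF l] N[symmetric] by (simp add: algebra_simps)
  also have "K * (1 / ?r) ^ (N + 2) * (- (real m + 1) * geg_hat (m + 1) l ?Y)
      = - ((K * (real m + 1)) * (1 / ?r) ^ (N + 2) * geg_hat (m + 1) l ?Y)"
    by (simp only: mult_minus_left mult_minus_right mult_ac)
  finally show ?thesis by (simp only: neg_equal_iff_equal)
qed

lemma htrans_raise_order_iterated:
  fixes K :: real
  assumes b: "b \<ge> -1/2" and a: "a \<ge> -1/2" and N: "b < real N + 1"
    and l: "l > 0 \<or> l = 0 \<and> m \<ge> 1" "2 * l + real m = real N + 1"
    and eq: "\<And>A B. A \<ge> 0 \<Longrightarrow> B \<ge> 0 \<Longrightarrow> htrans N a b (kint b) A B = K * (1 / rho A B) ^ (N + 1) * geg_hat m l (cosY A B)"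
  shows "\<exists>K. \<forall>A\<ge>0. \<forall>B\<ge>0. htrans (N + i) (a + real i) b (kint b) A B
     = K * (1 / rho A B) ^ (N + i + 1) * geg_hat (m + i) l (cosY A B)"
proof (induction i)
  case 0
  then show ?case using eq by auto
next
  case (Suc i)
  then obtain K where K: "\<And>A B. A \<ge> 0 \<Longrightarrow> B \<ge> 0 \<Longrightarrow> htrans (N + i) (a + real i) b (kint b) A B
     = K * (1 / rho A B) ^ (N + i + 1) * geg_hat (m + i) l (cosY A B)" by blast
  have "htrans (N + i + 1) (a + real i + 1) b (kint b) A B
     = (K * (real (m + i) + 1)) * (1 / rho A B) ^ (N + i + 2) * geg_hat (m + i + 1) l (cosY A B)"
    if "A \<ge> 0" "B \<ge> 0" for A B
    by (rule htrans_raise_order[OF _ b kspan_kint _ _ _ K that]) (use a N l in auto)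
  then show ?case by (intro exI[of _ "K * (real (m + i) + 1)"]) (simp add: add_ac)
qed

text \<open>
  The ladder in \<open>m\<close> starts at equal orders if \<open>b \<ge> 0\<close>, and at the orders \<open>1/2\<close> and \<open>-1/2\<close> if \<open>b = -1/2\<close>.
\<close>
lemma htrans_kint:
  assumes b: "b \<ge> -1/2" and N: "real N = 2 * b + real m" and m: "b < 0 \<Longrightarrow> b = -1/2 \<and> m \<ge> 1"
  shows "\<exists>K. \<forall>A\<ge>0. \<forall>B\<ge>0. htrans N (b + real m) b (kint b) A B
     = K * (1 / rho A B) ^ (N + 1) * geg_hat m (b + 1/2) (cosY A B)"
proof (cases "b < 0")
  case False
  then have b0: "b \<ge> 0" by simp
  have mN: "m \<le> N" and M: "real (N - m) = 2 * b"
    using b0 N by (simp_all add: of_nat_diff flip: of_nat_le_iff[where 'a=real])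
  have g: "geg_hat 0 (b + 1/2) x = Gamma (b + 1/2)" "Gamma (b + 1/2) \<noteq> 0" for x
    using b0 Gamma_real_nonzero[of "b + 1/2"] by (simp_all add: geg_hat_def)
  have "htrans (N - m) b b (kint b) A B = htrans (N - m) b b (kint b) 0 0 / Gamma (b + 1/2)
      * (1 / rho A B) ^ (N - m + 1) * geg_hat 0 (b + 1/2) (cosY A B)" if "A \<ge> 0" "B \<ge> 0" for A B
    unfolding htrans_base[OF b0 M that] g(1) using g(2) by simp
  from htrans_raise_order_iterated[OF b b _ _ _ this, of m] show ?thesis using b0 M mN by simp
next
  case True
  then have bm: "b = - 1/2" "m \<ge> 1" "N = m - 1" using m N by auto
  let ?c = "Gamma (1 / 2) * (rGamma (1 / 2) * rGamma (1 / 2)) :: real"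
  have "htrans 0 (1/2) (- 1/2) (kint (- 1/2)) A B = ?c / 2 * (1 / rho A B) ^ (0 + 1) * geg_hat 1 0 (cosY A B)"
    if "A \<ge> 0" "B \<ge> 0" for A B
    using htrans_base_half[OF that] rho_pos[OF that]
    by (simp add: geg_hat_def cosY_def field_simps power2_eq_square)
  from htrans_raise_order_iterated[OF _ _ _ _ _ this, of "m - 1"] show ?thesis
    using bm by (simp add: of_nat_diff)
qed

lemma Lam_in_kspan:
  assumes ab: "a + b = real N" and a: "a \<ge> 0"
  shows "kspan b (Lam N a b j)"
proof (induction j rule: less_induct)
  case (less j)
  show ?case
  proof (cases j)
    case 0
    have "kspan b (\<lambda>y. (rGamma (a + 1) / 2) * kint b y + 0 * kint b y)"
      by (intro kspan.lin kspan_kint)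
    then show ?thesis by (rule kspan.cong) (simp add: 0 Lam_0)
  next
    case (Suc i)
    have Li: "kspan b (Lam N a b i)" using less Suc by simp
    then obtain g where g: "kspan b g" "\<forall>y>0. (Lam N a b i has_real_derivative g y / y) (at y)"
      using kspan_derivative by blast
    let ?c = "(real i + 1) * (real i + 1 + 2 * a)"
    have c: "?c \<noteq> 0" using a by auto
    have prev: "kspan b (\<lambda>y. if i = 0 then 0 else (real i + a + b) * (real i + a - b) * Lam N a b (i - 1) y)"
    proof (cases i)
      case 0
      have "kspan b (\<lambda>y. 0 * kint b y + 0 * kint b y)" by (intro kspan.lin kspan_kint)
      then show ?thesis using 0 by simp
    next
      case (Suc h)
      have "kspan b (Lam N a b h)" using less Suc \<open>j = Suc i\<close> by simp
      from kspan.lin[OF this this, of "(real i + a + b) * (real i + a - b)" 0] show ?thesis using Suc by simp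
    qed
    let ?rhs = "\<lambda>y. 1 / ?c * ((2 * (2 * real i + 2 * a + 1)) * g y + ((2 * real i + 2 * a + 1) * (real N + 1)) * Lam N a b i y)
       + 1 / ?c * (if i = 0 then 0 else (real i + a + b) * (real i + a - b) * Lam N a b (i - 1) y)"
    have "kspan b ?rhs"
      by (intro kspan.lin g Li prev)
    then show ?thesis
    proof (rule kspan.cong)
      fix y :: real assume y: "y > 0"
      obtain d where d: "(Lam N a b i has_real_derivative d) (at y)"
        "?c * Lam N a b (i + 1) y = (2 * real i + 2 * a + 1) * (2 * y * d + (real N + 1) * Lam N a b i y)
          + (if i = 0 then 0 else (real i + a + b) * (real i + a - b) * Lam N a b (i - 1) y)"
        using Lam_recursion[OF y ab, of i] by blast
      have dg: "d = g y / y" using DERIV_unique[OF d(1)] g(2) y by blast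
      have rec: "?c * Lam N a b (i + 1) y = (2 * (2 * real i + 2 * a + 1)) * g y + ((2 * real i + 2 * a + 1) * (real N + 1)) * Lam N a b i y
          + (if i = 0 then 0 else (real i + a + b) * (real i + a - b) * Lam N a b (i - 1) y)"
        unfolding d(2) dg using y by (simp add: algebra_simps)
      have "Lam N a b j y = 1 / ?c * (?c * Lam N a b (i + 1) y)" using c Suc by simp
      then show "Lam N a b j y = ?rhs y"
        unfolding rec by (simp only: distrib_left)
    qed
  qed
qed

text \<open>
  Integration by parts moves the derivative along the ray to the Euler operator on \<open>L\<^sub>j\<close>.
\<close>
lemma htrans_Lam_recursion:
  assumes ab: "a + b = real N" and a: "a \<ge> 0" and b: "b \<ge> -1/2" and AB: "A \<ge> 0" "B \<ge> 0"
    and D: "((\<lambda>s. htrans N a b (Lam N a b j) (s * A) (s * B)) has_real_derivative D) (at 1)"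
  shows "(real j + 1) * (real j + 1 + 2 * a) * htrans N a b (Lam N a b (j + 1)) A B =
     - (2 * real j + 2 * a + 1) * (2 * D + (real N + 1) * htrans N a b (Lam N a b j) A B)
     + (if j = 0 then 0 else (real j + a + b) * (real j + a - b) * htrans N a b (Lam N a b (j - 1)) A B)"
proof -
  let ?L = "Lam N a b" and ?T = "\<lambda>f. htrans N a b f A B"
  have L: "kspan b (?L i)" for i by (rule Lam_in_kspan[OF ab a])
  have bN: "b < real N + 1" using ab a by simp
  have a': "a \<ge> -1/2" using a by simp
  obtain g where g: "kspan b g" "\<And>y. y > 0 \<Longrightarrow> (?L j has_real_derivative g y / y) (at y)"
    using kspan_derivative[OF L] by blast
  have Dg: "D = - ((real N + 1) * ?T (?L j) + ?T g)"
  proof -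
    have "((\<lambda>s. htrans N a b (?L j) (0 + s * A) (0 + s * B)) has_real_derivative
       - (A * htrans (N + 1) (a + 1) b (?L j) (0 + 1 * A) (0 + 1 * B) + B * htrans (N + 1) a (b + 1) (?L j) (0 + 1 * A) (0 + 1 * B))) (at 1 within {0..})"
      by (rule htrans_has_derivative) (use a' b AB L bN in auto)
    moreover have "((\<lambda>s. htrans N a b (?L j) (0 + s * A) (0 + s * B)) has_real_derivative D) (at 1 within {0..})"
      using has_field_derivative_at_within[OF D] by simp
    moreover have "at (1::real) within {0..} \<noteq> bot" by (rule at_within_Ici_nontrivial) simp
    ultimately have "D = - (A * htrans (N + 1) (a + 1) b (?L j) (0 + 1 * A) (0 + 1 * B)
        + B * htrans (N + 1) a (b + 1) (?L j) (0 + 1 * A) (0 + 1 * B))"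
      by (intro has_field_derivative_unique[OF _ _ at_within_Ici_nontrivial[of 1]]) auto
    then show ?thesis using htrans_by_parts[OF a' b AB L g bN] by (simp only: add_0 mult_1)
  qed
  define c where "c = (real j + 1) * (real j + 1 + 2 * a)"
  define p q r where "p = 2 * (2 * real j + 2 * a + 1)" "q = (2 * real j + 2 * a + 1) * (real N + 1)"
    "r = (if j = 0 then 0 else (real j + a + b) * (real j + a - b))"
  note pqr = this
  have rec: "c * ?L (j + 1) y + 0 * ?L j y = 1 * (p * g y + q * ?L j y) + r * ?L (j - 1) y" if y: "y > 0" for y
  proof -
    obtain d where d: "(?L j has_real_derivative d) (at y)"
      "c * ?L (j + 1) y = (2 * real j + 2 * a + 1) * (2 * y * d + (real N + 1) * ?L j y)
        + (if j = 0 then 0 else (real j + a + b) * (real j + a - b) * ?L (j - 1) y)"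
      using Lam_recursion[OF y ab, of j] unfolding c_def by blast
    have "d = g y / y" by (rule DERIV_unique[OF d(1) g(2)[OF y]])
    then show ?thesis unfolding d(2) pqr using y by (simp add: algebra_simps)
  qed
  have "?T (\<lambda>y. c * ?L (j + 1) y + 0 * ?L j y) = ?T (\<lambda>y. 1 * (p * g y + q * ?L j y) + r * ?L (j - 1) y)"
    unfolding htrans_def by (intro Bochner_Integration.integral_cong refl) (use rec in \<open>simp add: space_lpos\<close>)
  then have "c * ?T (?L (j + 1)) = p * ?T g + q * ?T (?L j) + r * ?T (?L (j - 1))"
    using htrans_lin[OF a' b AB L L bN, of c "j + 1" 0 j]
      htrans_lin[OF a' b AB kspan.lin[OF g(1) L] L bN, of 1 p q j r "j - 1"]
      htrans_lin[OF a' b AB g(1) L bN, of p q j] by simp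
  then show ?thesis unfolding Dg c_def pqr by (auto simp: algebra_simps)
qed

text \<open>
  The right-hand side of the theorem, without the constant, as a function of \<open>A\<close> and \<open>B\<close>.
\<close>
definition profile :: "nat \<Rightarrow> real \<Rightarrow> real \<Rightarrow> nat \<Rightarrow> nat \<Rightarrow> real \<Rightarrow> real \<Rightarrow> real" where
  "profile N l l' j k A B = (1 / rho A B) ^ (N + 1) * (geg_hat j l (cosX A B) * geg_hat k l' (cosY A B))"

text \<open>
  Along the ray, at \<open>(A, B)\<close> and with \<open>X = cos \<theta>\<close> and \<open>Y = cos \<phi>\<close>, the logarithmic derivative of \<open>rho\<close>
  is \<open>(1 - XY)/2\<close>, and \<open>X\<close>, \<open>Y\<close> have the derivatives \<open>-(1 - X\<^sup>2)Y/2\<close>, \<open>-(1 - Y\<^sup>2)X/2\<close>. The Gegenbauer rules express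
  the result by the four products of degrees \<open>j \<plusminus> 1\<close> and \<open>k \<plusminus> 1\<close>. The hypotheses on \<open>k + l'\<close> and \<open>l + l'\<close> make
  the coefficients of the two mixed products vanish.
\<close>
lemma profile_derivative:
  assumes AB: "A \<ge> 0" "B \<ge> 0"
    and l: "l > 0" "l' > 0 \<or> l' = 0 \<and> k \<ge> 1" "l' = 0 \<Longrightarrow> j \<ge> 1 \<Longrightarrow> k \<ge> 2"
    and jk: "real k + l' = real j + l" "l + l' = real N + 1" "k \<ge> j"
  shows "\<exists>D. ((\<lambda>s. profile N l l' j k (s * A) (s * B)) has_real_derivative D) (at 1) \<and>
    2 * (real j + l) * (2 * D + (real N + 1) * profile N l l' j k A B) =
      (real j + 1) * (real k + 1) * profile N l l' (j + 1) (k + 1) A B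
      - (if j = 0 then 0 else (real j + 2 * l - 1) * (real k + 2 * l' - 1) * profile N l l' (j - 1) (k - 1) A B)"
proof -
  let ?r = "rho A B" and ?X = "cosX A B" and ?Y = "cosY A B"
  have r: "?r > 0" using AB by (rule rho_pos)
  have r2: "?r\<^sup>2 = 1 + 2 * A + 2 * B + (A - B)\<^sup>2" using AB by (rule rho_square)
  have XY: "?X * ?r = 1 - A + B" "?Y * ?r = 1 + A - B" using r by (simp_all add: cosX_def cosY_def)
  have s1: "(?X + ?Y) * ?r = 2" "(?Y - ?X) * ?r = 2 * (A - B)" using XY by (simp_all add: algebra_simps)
  have dr: "((\<lambda>s. rho (s * A) (s * B)) has_real_derivative ?r * (1 - ?X * ?Y) / 2) (at 1)"
  proof -
    have "((\<lambda>s. rho (s * A) (s * B)) has_real_derivative (A + B + (A - B) * (A - B)) / ?r) (at 1)"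
      using rho_has_derivative[of 0 1 A 0 B UNIV] AB by simp
    moreover have "(A + B + (A - B) * (A - B)) / ?r = ?r * (1 - ?X * ?Y) / 2"
    proof -
      have "(1 - ?X * ?Y) * ?r\<^sup>2 = ?r\<^sup>2 - (?X * ?r) * (?Y * ?r)" by (simp add: power2_eq_square algebra_simps)
      also have "\<dots> = 2 * (A + B + (A - B) * (A - B))" unfolding XY r2 by (simp add: power2_eq_square algebra_simps)
      finally show ?thesis using r by (simp add: field_simps power2_eq_square)
    qed
    ultimately show ?thesis by simp
  qed
  have dX: "((\<lambda>s. cosX (s * A) (s * B)) has_real_derivative - ((1 - ?X\<^sup>2) * ?Y) / 2) (at 1)"
    and dY: "((\<lambda>s. cosY (s * A) (s * B)) has_real_derivative - ((1 - ?Y\<^sup>2) * ?X) / 2) (at 1)"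
  proof -
    have n: "((\<lambda>s. 1 - s * A + s * B) has_real_derivative B - A) (at 1)" "((\<lambda>s. 1 + s * A - s * B) has_real_derivative A - B) (at 1)"
      by (auto intro!: derivative_eq_intros)
    have q: "(d * ?r - u * (?r * (1 - ?X * ?Y) / 2)) / (?r * ?r) = - ((1 - x\<^sup>2) * y) / 2"
      if "2 * d = (x - y) * ?r" "u = x * ?r" "?X * ?Y = x * y" for d u x y
    proof -
      have "2 * (d * ?r - u * (?r * (1 - ?X * ?Y) / 2)) = (2 * d) * ?r - u * (?r * (1 - ?X * ?Y))"
        by (simp add: field_simps)
      also have "\<dots> = (?r * ?r) * (- ((1 - x\<^sup>2) * y))"
        unfolding that by (simp add: algebra_simps power2_eq_square)
      finally show ?thesis using r by (simp add: field_simps)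
    qed
    have q1: "((B - A) * ?r - (1 - A + B) * (?r * (1 - ?X * ?Y) / 2)) / (?r * ?r) = - ((1 - ?X\<^sup>2) * ?Y) / 2"
      and q2: "((A - B) * ?r - (1 + A - B) * (?r * (1 - ?X * ?Y) / 2)) / (?r * ?r) = - ((1 - ?Y\<^sup>2) * ?X) / 2"
      by (intro q; use XY s1 in \<open>simp add: algebra_simps\<close>)+
    show "((\<lambda>s. cosX (s * A) (s * B)) has_real_derivative - ((1 - ?X\<^sup>2) * ?Y) / 2) (at 1)"
      using DERIV_divide[OF n(1) dr] r q1 unfolding cosX_def[of "_ * A"] by simp
    show "((\<lambda>s. cosY (s * A) (s * B)) has_real_derivative - ((1 - ?Y\<^sup>2) * ?X) / 2) (at 1)"
      using DERIV_divide[OF n(2) dr] r q2 unfolding cosY_def[of "_ * A"] by simp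
  qed
  define F F' F1 G G' G1 z where "F = geg_hat j l ?X" "F' = geg_hat' j l ?X" "F1 = geg_hat (j + 1) l ?X"
    "G = geg_hat k l' ?Y" "G' = geg_hat' k l' ?Y" "G1 = geg_hat (k + 1) l' ?Y" "z = (1 / ?r) ^ (N + 1)"
  note defs = this
  have dp: "((\<lambda>s. (1 / rho (s * A) (s * B)) ^ (N + 1)) has_real_derivative - (real N + 1) * z * (1 - ?X * ?Y) / 2) (at 1)"
  proof -
    have gen: "real (N + 1) * (- (u / 2) * q * q ^ (N + 1 - Suc 0)) = - (real N + 1) * q ^ (N + 1) * u / 2" for u q :: real
      by (simp add: field_simps)
    have "((\<lambda>s. 1 / rho (s * A) (s * B)) has_real_derivative - ((1 - ?X * ?Y) / 2) * (1 / ?r)) (at 1)"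
    proof -
      have "((\<lambda>s. inverse (rho (s * A) (s * B))) has_real_derivative - ((1 - ?X * ?Y) / 2) * (1 / ?r)) (at 1)"
        using DERIV_inverse_fun[OF dr] r by (auto elim!: DERIV_cong simp: divide_simps power2_eq_square)
      then show ?thesis by (simp add: inverse_eq_divide)
    qed
    from DERIV_power[OF this, of "N + 1"] show ?thesis
      by (rule DERIV_cong) (simp only: mult_1 defs gen)
  qed
  have dF: "((\<lambda>s. geg_hat j l (cosX (s * A) (s * B))) has_real_derivative F' * (- ((1 - ?X\<^sup>2) * ?Y) / 2)) (at 1)"
    by (rule DERIV_cong[OF DERIV_chain2[OF geg_hat_has_derivative dX]]) (simp only: mult_1 defs)
  have dG: "((\<lambda>s. geg_hat k l' (cosY (s * A) (s * B))) has_real_derivative G' * (- ((1 - ?Y\<^sup>2) * ?X) / 2)) (at 1)"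
    by (rule DERIV_cong[OF DERIV_chain2[OF geg_hat_has_derivative dY]]) (simp only: mult_1 defs)
  let ?D = "- (real N + 1) * z * (1 - ?X * ?Y) / 2 * (F * G)
     + (F' * (- ((1 - ?X\<^sup>2) * ?Y) / 2) * G + G' * (- ((1 - ?Y\<^sup>2) * ?X) / 2) * F) * z"
  have D: "((\<lambda>s. profile N l l' j k (s * A) (s * B)) has_real_derivative ?D) (at 1)"
    unfolding profile_def using DERIV_mult[OF dp DERIV_mult[OF dF dG]] by (simp add: defs)
  define h where "h = 2 * (real j + l)"
  have h: "h > 0" "2 * (real k + l') = h" using l jk by (simp_all add: h_def)
  \<comment> \<open>\<open>Q\<close> and \<open>Q'\<close> are multiples of the polynomials of degrees \<open>j - 1\<close> and \<open>k - 1\<close>. As differences they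
    make sense for \<open>j = 0\<close> too, where \<open>Q\<close> vanishes.\<close>
  define Q Q' where "Q = h * ?X * F - (real j + 1) * F1" "Q' = h * ?Y * G - (real k + 1) * G1"
  note Qs = this
  have eF: "(1 - ?X\<^sup>2) * F' = (real j + 2 * l) * ?X * F - (real j + 1) * F1"
    unfolding defs by (rule geg_hat'_eq) (use l in auto)
  have eG: "(1 - ?Y\<^sup>2) * G' = (real k + 2 * l') * ?Y * G - (real k + 1) * G1"
    unfolding defs by (rule geg_hat'_eq) (use l in auto)
  have main: "h * (2 * ?D + (real N + 1) * (z * (F * G))) = z * ((real j + 1) * F1 * ((real k + 1) * G1) - Q * Q')"
  proof -
    have e1: "2 * ?D + (real N + 1) * (z * (F * G)) = z * ((real N + 1) * (?X * F) * (?Y * G)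
        - ((1 - ?X\<^sup>2) * F') * (?Y * G) - (?X * F) * ((1 - ?Y\<^sup>2) * G'))"
      by (simp add: field_simps)
    have "h * (2 * ?D + (real N + 1) * (z * (F * G))) = z * ((real j + 1) * F1 * (h * ?Y * G) + (real k + 1) * G1 * (h * ?X * F) - (h * ?X * F) * (h * ?Y * G))"
    proof -
      have c: "(real N + 1) - (real j + 2 * l) - (real k + 2 * l') = - h"
      proof -
        have "real k = real j + l - l'" "real N = l + l' - 1" using jk(1,2) by simp_all
        then show ?thesis unfolding h_def by (simp only: algebra_simps)
      qed
      have "h * (2 * ?D + (real N + 1) * (z * (F * G))) = h * z * (((real N + 1) - (real j + 2 * l) - (real k + 2 * l')) * (?X * F) * (?Y * G)
           + (real j + 1) * F1 * (?Y * G) + (real k + 1) * G1 * (?X * F))"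
        unfolding e1 eF eG by (simp add: algebra_simps)
      then show ?thesis unfolding c by (simp add: algebra_simps)
    qed
    also have "\<dots> = z * ((real j + 1) * F1 * ((real k + 1) * G1) - Q * Q')"
      unfolding Qs by (simp add: algebra_simps)
    finally show ?thesis .
  qed
  have QQ: "Q * Q' = (if j = 0 then 0 else (real j + 2 * l - 1) * (real k + 2 * l' - 1) *
      (geg_hat (j - 1) l ?X * geg_hat (k - 1) l' ?Y))"
  proof (cases j)
    case 0
    have "l \<notin> \<int>\<^sub>\<le>\<^sub>0" using l(1) by (auto elim!: nonpos_Ints_cases)
    then have "geg_hat 0 l x = Gamma l" "geg_hat (Suc 0) l x = 2 * (l * Gamma l) * x" for x
      using Gamma_plus1[of l] by (simp_all add: geg_hat_def)
    then have "Q = 0" unfolding Qs defs h_def 0 by simp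
    then show ?thesis using 0 by simp
  next
    case (Suc i)
    then obtain i' where i': "k = Suc i'" using jk(3) by (cases k) auto
    have "2 * (real i + 1 + l) * ?X * geg_hat (i + 1) l ?X = (real i + 2) * geg_hat (i + 2) l ?X + (real i + 2 * l) * geg_hat i l ?X"
      by (rule geg_hat_rec) (use l in auto)
    then have "Q = (real j + 2 * l - 1) * geg_hat (j - 1) l ?X"
      unfolding Qs defs h_def Suc by (simp add: add_ac)
    moreover have "2 * (real i' + 1 + l') * ?Y * geg_hat (i' + 1) l' ?Y = (real i' + 2) * geg_hat (i' + 2) l' ?Y + (real i' + 2 * l') * geg_hat i' l' ?Y"
      by (rule geg_hat_rec) (use l Suc i' in auto)
    then have "Q' = (real k + 2 * l' - 1) * geg_hat (k - 1) l' ?Y"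
      unfolding Qs defs h(2)[symmetric] i' by (simp add: add_ac)
    ultimately show ?thesis using Suc by (simp add: mult_ac)
  qed
  have "2 * (real j + l) * (2 * ?D + (real N + 1) * profile N l l' j k A B) =
      (real j + 1) * (real k + 1) * profile N l l' (j + 1) (k + 1) A B
      - (if j = 0 then 0 else (real j + 2 * l - 1) * (real k + 2 * l' - 1) * profile N l l' (j - 1) (k - 1) A B)"
    using main unfolding QQ h_def[symmetric] profile_def defs[symmetric] by (auto simp: algebra_simps)
  with D show ?thesis by blast
qed

text \<open>
  The recursions for transforms and for profiles have the same shape, so the claim passes from \<open>j - 1\<close>
  and \<open>j\<close> to \<open>j + 1\<close>.
\<close>
theorem htrans_Lam:
  assumes a: "a = b + real m" "a \<ge> 0" and b: "b \<ge> -1/2" "b < 0 \<Longrightarrow> b = -1/2 \<and> m \<ge> 1"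
    and N: "a + b = real N"
  shows "\<exists>K. \<forall>A\<ge>0. \<forall>B\<ge>0. htrans N a b (Lam N a b j) A B = K * profile N (a + 1/2) (b + 1/2) j (j + m) A B"
proof -
  obtain K0 where K0: "\<And>A B. A \<ge> 0 \<Longrightarrow> B \<ge> 0 \<Longrightarrow> htrans N a b (kint b) A B
      = K0 * (1 / rho A B) ^ (N + 1) * geg_hat m (b + 1/2) (cosY A B)"
    using htrans_kint[OF b(1), of N m] b a N by auto
  define c0 where "c0 = rGamma (a + 1) / 2 * K0 / Gamma (a + 1/2)"
  \<comment> \<open>The factor is forced by the leading terms of the two recursions; the lower terms then agree as well.\<close>
  define K where "K = rec_nat c0 (\<lambda>j x. - x * (real j + 1 + real m) / (real j + 1 + 2 * a))"
  have K_0: "K 0 = c0" and K_Suc: "K (Suc j) = - K j * (real j + 1 + real m) / (real j + 1 + 2 * a)" for j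
    by (simp_all add: K_def)
  have "htrans N a b (Lam N a b j) A B = K j * profile N (a + 1/2) (b + 1/2) j (j + m) A B"
    if "A \<ge> 0" "B \<ge> 0" for A B j
    using that
  proof (induction j arbitrary: A B rule: less_induct)
    case (less j)
    let ?P = "\<lambda>j. profile N (a + 1/2) (b + 1/2) j (j + m)"
    show ?case
    proof (cases j)
      case 0
      have L: "Lam N a b 0 = (\<lambda>y. (rGamma (a + 1) / 2) * kint b y + 0 * kint b y)"
        by (rule ext) (simp add: Lam_0)
      have "htrans N a b (Lam N a b 0) A B = rGamma (a + 1) / 2 * htrans N a b (kint b) A B"
        unfolding L using less.prems a b N by (subst htrans_lin[OF _ _ _ _ kspan_kint kspan_kint]) auto
      moreover have "geg_hat 0 (a + 1/2) x = Gamma (a + 1/2)" for x by (simp add: geg_hat_def)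
      moreover have "Gamma (a + 1/2) \<noteq> 0" using Gamma_real_nonzero[of "a + 1/2"] a(2) by linarith
      ultimately show ?thesis using 0 less.prems by (simp add: K_0 K0 c0_def profile_def)
    next
      case (Suc i)
      have IH: "htrans N a b (Lam N a b i) A B = K i * ?P i A B" if "A \<ge> 0" "B \<ge> 0" for A B
        using less.IH[of i] Suc that by simp
      obtain D where D: "((\<lambda>s. ?P i (s * A) (s * B)) has_real_derivative D) (at 1)"
        "2 * (real i + (a + 1/2)) * (2 * D + (real N + 1) * ?P i A B) =
        (real i + 1) * (real (i + m) + 1) * profile N (a + 1/2) (b + 1/2) (i + 1) (i + m + 1) A B
        - (if i = 0 then 0 else (real i + 2 * (a + 1/2) - 1) * (real (i + m) + 2 * (b + 1/2) - 1) *
            profile N (a + 1/2) (b + 1/2) (i - 1) (i + m - 1) A B)"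
        using profile_derivative[OF less.prems, of "a + 1/2" "b + 1/2" "i + m" i N] a b N by fastforce
      have "((\<lambda>s. htrans N a b (Lam N a b i) (s * A) (s * B)) has_real_derivative K i * D) (at 1)"
      proof (rule has_field_derivative_transform_within_open[OF DERIV_cmult[OF D(1)]])
        show "K i * ?P i (s * A) (s * B) = htrans N a b (Lam N a b i) (s * A) (s * B)" if "s \<in> {0<..}" for s
          using IH[of "s * A" "s * B"] that less.prems by simp
      qed auto
      from htrans_Lam_recursion[OF N a(2) b(1) less.prems this]
      have "(real i + 1) * (real i + 1 + 2 * a) * htrans N a b (Lam N a b (i + 1)) A B =
         - K i * (2 * (real i + (a + 1/2)) * (2 * D + (real N + 1) * ?P i A B))
         + (if i = 0 then 0 else (real i + a + b) * (real i + a - b) * htrans N a b (Lam N a b (i - 1)) A B)"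
        unfolding IH[OF less.prems] by (simp add: algebra_simps)
      also have "\<dots> = - K i * ((real i + 1) * (real (i + m) + 1) * ?P j A B)"
      proof (cases i)
        case 0
        then show ?thesis unfolding D(2) using Suc by simp
      next
        case (Suc h)
        have IH': "htrans N a b (Lam N a b h) A B = K h * ?P h A B"
          using less.IH[of h] Suc \<open>j = Suc i\<close> less.prems by simp
        have Ki: "K i * (real i + 2 * a) = - K h * (real i + real m)"
        proof -
          have "real h + 1 + 2 * a \<noteq> 0" using a by simp
          then show ?thesis unfolding Suc K_Suc by (simp add: field_simps)
        qed
        have e: "real (i + m) + 2 * (b + 1/2) - 1 = real i + a + b" "real i + 2 * (a + 1/2) - 1 = real i + 2 * a"
          "real i + a - b = real i + real m" "i - 1 = h" "i + m - 1 = h + m" "i + m + 1 = j + m" "i + 1 = j" "(i = 0) = False"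
          using a Suc \<open>j = Suc i\<close> by simp_all
        have "- K i * (2 * (real i + (a + 1/2)) * (2 * D + (real N + 1) * ?P i A B))
            + (real i + a + b) * (real i + a - b) * (K h * ?P h A B)
          = - K i * ((real i + 1) * (real (i + m) + 1) * ?P j A B)
            + ((K i * (real i + 2 * a)) + K h * (real i + real m)) * ((real i + a + b) * ?P h A B)"
          unfolding D(2) e if_False by (simp add: algebra_simps)
        also have "K i * (real i + 2 * a) + K h * (real i + real m) = 0" unfolding Ki by simp
        finally show ?thesis unfolding e if_False IH' by simp
      qed
      finally have "(real i + 1) * ((real i + 1 + 2 * a) * htrans N a b (Lam N a b j) A B)
         = (real i + 1) * (- K i * (real i + 1 + real m) * ?P j A B)"
        using Suc by (simp add: algebra_simps)
      then have "real i + 1 = 0 \<or>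
          (real i + 1 + 2 * a) * htrans N a b (Lam N a b j) A B = - K i * (real i + 1 + real m) * ?P j A B"
        by (simp only: mult_cancel_left)
      moreover have "real i + 1 \<noteq> 0" by linarith
      ultimately have "(real i + 1 + 2 * a) * htrans N a b (Lam N a b j) A B = - K i * (real i + 1 + real m) * ?P j A B"
        by blast
      moreover have "real i + 1 + 2 * a > 0" using a by simp
      ultimately show ?thesis unfolding Suc K_Suc by (simp add: field_simps)
    qed
  qed
  then show ?thesis by blast
qed

theorem theoremA:
  fixes \<mu> \<nu> :: int and j :: nat and u :: "real \<Rightarrow> complex"
  assumes "\<mu> \<ge> \<nu>" and "\<nu> \<ge> -1" and "even (\<mu> - \<nu>)" and "\<not> (\<mu> = -1 \<and> \<nu> = -1)"
    and "L2_solution \<mu> \<nu> j u"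
  shows "\<exists>A :: complex. \<forall>\<theta> \<phi> :: real. cos \<theta> + cos \<phi> > 0 \<longrightarrow>
    (let a = sin \<theta> / (cos \<theta> + cos \<phi>);
         b = sin \<phi> / (cos \<theta> + cos \<phi>);
         f = (\<lambda>x. u x * of_real (bessel_J_norm (of_int \<mu> / 2) (a * x) *
                                  bessel_J_norm (of_int \<nu> / 2) (b * x) * x powi (\<mu> + \<nu> + 1)))
     in set_integrable lborel {0<..} f \<and>
        (LBINT x:{0<..}. f x) =
          A * of_real (((cos \<theta> + cos \<phi>) / 2) powr (of_int (\<mu> + \<nu> + 2) / 2) *
               gegenbauer_norm j (of_int (\<mu> + 1) / 2) (cos \<theta>) *
               gegenbauer_norm (nat (int j + (\<mu> - \<nu>) div 2)) (of_int (\<nu> + 1) / 2) (cos \<phi>)))"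
proof -
  define m where "m = nat ((\<mu> - \<nu>) div 2)"
  define N where "N = nat ((\<mu> + \<nu>) div 2)"
  have mu0: "\<mu> \<ge> 0" using assms by presburger
  have "(\<mu> - \<nu>) div 2 \<ge> 0" "(\<mu> + \<nu>) div 2 \<ge> 0" using assms(1-4) by presburger+
  moreover have "even (\<mu> + \<nu>)" using assms(3) by presburger
  ultimately have mn: "\<mu> - \<nu> = 2 * int m" and pn: "\<mu> + \<nu> = 2 * int N"
    using assms(3) unfolding m_def N_def by simp_all
  define \<alpha> \<beta> where "\<alpha> = real_of_int \<mu> / 2" "\<beta> = real_of_int \<nu> / 2"
  note ab_def = this
  have abm: "\<alpha> = \<beta> + real m" using arg_cong[OF mn, of real_of_int] by (simp add: ab_def field_simps)
  have abN: "\<alpha> + \<beta> = real N" using arg_cong[OF pn, of real_of_int] by (simp add: ab_def field_simps)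
  have a0: "\<alpha> \<ge> 0" using mu0 by (simp add: ab_def)
  have b0: "\<beta> \<ge> -1/2" using assms(2) by (simp add: ab_def)
  have bneg: "\<beta> = -1/2 \<and> m \<ge> 1" if "\<beta> < 0"
  proof -
    have "\<nu> < 0" using that by (simp add: ab_def)
    then have "\<nu> = -1" using assms(2) by linarith
    moreover from this have "m \<ge> 1" using mn mu0 by linarith
    ultimately show ?thesis by (simp add: ab_def)
  qed
  obtain K where K: "\<And>A B. A \<ge> 0 \<Longrightarrow> B \<ge> 0 \<Longrightarrow>
      htrans N \<alpha> \<beta> (Lam N \<alpha> \<beta> j) A B = K * profile N (\<alpha> + 1/2) (\<beta> + 1/2) j (j + m) A B"
    using htrans_Lam[OF abm a0 b0 bneg abN, of j] by blast
  obtain c where c: "\<And>x. x > 0 \<Longrightarrow> u x = c * of_real (Lambda \<mu> \<nu> j x)"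
    using assms(5) unfolding L2_solution_def by blast
  have Lam: "Lambda \<mu> \<nu> j x = Lam N \<alpha> \<beta> j (x\<^sup>2 / 4)" if "x > 0" for x
    unfolding ab_def by (rule Lambda_eq_Lam) (use pn assms(2) that in \<open>auto simp flip: of_int_add\<close>)
  have "set_integrable lborel {0<..} f \<and> (LBINT x:{0<..}. f x) =
      (c * of_real (2 * 4 ^ N * K)) * of_real (((cos \<theta> + cos \<phi>) / 2) powr (of_int (\<mu> + \<nu> + 2) / 2) *
         gegenbauer_norm j (of_int (\<mu> + 1) / 2) (cos \<theta>) *
         gegenbauer_norm (nat (int j + (\<mu> - \<nu>) div 2)) (of_int (\<nu> + 1) / 2) (cos \<phi>))"
    if D: "cos \<theta> + cos \<phi> > 0" and a: "a = sin \<theta> / (cos \<theta> + cos \<phi>)" and b: "b = sin \<phi> / (cos \<theta> + cos \<phi>)"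
      and f: "f = (\<lambda>x. u x * of_real (bessel_J_norm (of_int \<mu> / 2) (a * x) *
                                  bessel_J_norm (of_int \<nu> / 2) (b * x) * x powi (\<mu> + \<nu> + 1)))"
    for \<theta> \<phi> a b f
  proof -
    let ?d = "cos \<theta> + cos \<phi>"
    define A B where "A = a\<^sup>2" "B = b\<^sup>2"
    note AB = this
    have AB0: "A \<ge> 0" "B \<ge> 0" by (simp_all add: AB)
    have Ad: "A * ?d\<^sup>2 = 1 - (cos \<theta>)\<^sup>2" and Bd: "B * ?d\<^sup>2 = 1 - (cos \<phi>)\<^sup>2"
      using D by (simp_all add: AB a b power_divide sin_squared_eq)
    have AmB: "(A - B) * ?d = cos \<phi> - cos \<theta>"
    proof -
      have "(A - B) * ?d\<^sup>2 = (cos \<phi> - cos \<theta>) * ?d"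
        unfolding left_diff_distrib[of A B] Ad Bd by (simp add: power2_eq_square algebra_simps)
      then have "((A - B) * ?d) * ?d = (cos \<phi> - cos \<theta>) * ?d" by (simp only: power2_eq_square mult.assoc)
      then show ?thesis by (simp only: mult_right_cancel[OF less_imp_neq[OF D, symmetric]])
    qed
    have rho: "rho A B = 2 / ?d"
    proof -
      have "(1 + 2 * A + 2 * B + (A - B)\<^sup>2) * ?d\<^sup>2 = ?d\<^sup>2 + 2 * (A * ?d\<^sup>2) + 2 * (B * ?d\<^sup>2) + ((A - B) * ?d)\<^sup>2"
        by (simp add: algebra_simps power2_eq_square)
      also have "\<dots> = 4"
        unfolding AmB Ad Bd using D by (simp add: power2_eq_square algebra_simps)
      finally have "1 + 2 * A + 2 * B + (A - B)\<^sup>2 = (2 / ?d)\<^sup>2"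
        using D by (simp add: field_simps power_divide)
      then show ?thesis unfolding rho_def using D by simp
    qed
    have X: "cosX A B = cos \<theta>" and Y: "cosY A B = cos \<phi>"
    proof -
      have "(1 - A + B) * ?d = ?d - (A - B) * ?d" "(1 + A - B) * ?d = ?d + (A - B) * ?d" by (simp_all add: algebra_simps)
      then have "(1 - A + B) * ?d = 2 * cos \<theta>" "(1 + A - B) * ?d = 2 * cos \<phi>" unfolding AmB using D by simp_all
      then show "cosX A B = cos \<theta>" "cosY A B = cos \<phi>" unfolding cosX_def cosY_def rho using D by simp_all
    qed
    let ?phi = "\<lambda>y. Lam N \<alpha> \<beta> j y * y ^ N * clprod \<alpha> \<beta> A B y"
    have kL: "kspan \<beta> (Lam N \<alpha> \<beta> j)" by (rule Lam_in_kspan[OF abN a0])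
    have iphi: "integrable lpos ?phi"
      using a0 b0 abN AB0 kL by (intro htrans_integrable[where c = \<beta>]) auto
    have cphi: "continuous_on {0<..} ?phi"
      by (intro continuous_intros kspan_continuous[OF kL] clprod_continuous)
    have sub: "integrable lpos (\<lambda>x. \<bar>x / 2\<bar> * ?phi (x\<^sup>2 / 4)) \<and> (\<integral>x. \<bar>x / 2\<bar> * ?phi (x\<^sup>2 / 4) \<partial>lpos) = (\<integral>x. ?phi x \<partial>lpos)"
    proof (rule lpos_substitution[OF _ _ _ cphi iphi])
      show "((\<lambda>x. x\<^sup>2 / 4) has_real_derivative x / 2) (at x)" for x :: real
        by (auto intro!: derivative_eq_intros)
      show "inj_on (\<lambda>x. x\<^sup>2 / 4) {0::real<..}" by (auto simp: inj_on_def power2_eq_iff)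
      show "(\<lambda>x. x\<^sup>2 / 4) ` {0::real<..} = {0<..}"
      proof (intro equalityI subsetI)
        fix y :: real assume "y \<in> {0<..}"
        then have "y = (2 * sqrt y)\<^sup>2 / 4" "2 * sqrt y \<in> {0<..}" by auto
        then show "y \<in> (\<lambda>x. x\<^sup>2 / 4) ` {0<..}" by blast
      qed auto
    qed (auto intro!: continuous_intros)
    have fx: "f x = c * of_real (2 * 4 ^ N) * of_real (\<bar>x / 2\<bar> * ?phi (x\<^sup>2 / 4))" if x: "x > 0" for x
    proof -
      have "x powi (\<mu> + \<nu> + 1) = x ^ (2 * N + 1)" unfolding pn using x by (simp add: power_int_def nat_add_distrib nat_mult_distrib)
      also have "\<dots> = 2 * 4 ^ N * (\<bar>x / 2\<bar> * (x\<^sup>2 / 4) ^ N)"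
        using x by (simp add: power_divide power_mult)
      finally have p: "x powi (\<mu> + \<nu> + 1) = 2 * 4 ^ N * (\<bar>x / 2\<bar> * (x\<^sup>2 / 4) ^ N)" .
      have J: "bessel_J_norm (of_int \<mu> / 2) (a * x) * bessel_J_norm (of_int \<nu> / 2) (b * x) = clprod \<alpha> \<beta> A B (x\<^sup>2 / 4)"
        unfolding bessel_J_norm_clifford clprod_def ab_def AB by (simp add: power_mult_distrib)
      show ?thesis unfolding f c[OF x] Lam[OF x] J p by (simp add: mult_ac)
    qed
    have fint: "integrable lpos f \<and> (\<integral>x. f x \<partial>lpos) = c * of_real (2 * 4 ^ N) * of_real (\<integral>x. ?phi x \<partial>lpos)"
    proof -
      let ?h = "\<lambda>x. c * of_real (2 * 4 ^ N) * complex_of_real (\<bar>x / 2\<bar> * ?phi (x\<^sup>2 / 4))"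
      have 1: "integrable lpos ?h"
        using sub by (intro integrable_mult_right integrable_of_real) blast
      have 2: "(\<integral>x. ?h x \<partial>lpos) = c * of_real (2 * 4 ^ N) * of_real (\<integral>x. ?phi x \<partial>lpos)"
        using sub by (simp only: integral_mult_right_zero integral_complex_of_real)
      have "integrable lpos f \<longleftrightarrow> integrable lpos ?h"
        by (rule Bochner_Integration.integrable_cong) (use fx in \<open>auto simp: space_lpos\<close>)
      moreover have "(\<integral>x. f x \<partial>lpos) = (\<integral>x. ?h x \<partial>lpos)"
        by (rule Bochner_Integration.integral_cong) (use fx in \<open>auto simp: space_lpos\<close>)
      ultimately show ?thesis using 1 2 by simp
    qed
    have e: "real_of_int (\<mu> + \<nu> + 2) / 2 = real (N + 1)" unfolding pn by simp
    have z: "(1 / rho A B) ^ (N + 1) = (?d / 2) powr (of_int (\<mu> + \<nu> + 2) / 2)"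
      unfolding rho e using D by (subst powr_realpow) auto
    have l: "of_int (\<mu> + 1) / 2 = \<alpha> + 1/2" "of_int (\<nu> + 1) / 2 = \<beta> + 1/2"
      by (simp_all add: ab_def add_divide_distrib)
    have "(\<mu> - \<nu>) div 2 = int m" unfolding mn by simp
    then have k: "nat (int j + (\<mu> - \<nu>) div 2) = j + m" by simp
    have "\<beta> + 1/2 > 0 \<or> \<beta> + 1/2 = 0 \<and> j + m \<ge> 1" using b0 bneg by (cases "\<beta> < 0") auto
    then have g: "gegenbauer_norm j (\<alpha> + 1/2) (cos \<theta>) = geg_hat j (\<alpha> + 1/2) (cos \<theta>)"
      "gegenbauer_norm (j + m) (\<beta> + 1/2) (cos \<phi>) = geg_hat (j + m) (\<beta> + 1/2) (cos \<phi>)"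
      using a0 by (auto intro!: gegenbauer_norm_eq_geg_hat)
    have "(\<integral>x. ?phi x \<partial>lpos) = K * ((?d / 2) powr (of_int (\<mu> + \<nu> + 2) / 2) *
         gegenbauer_norm j (of_int (\<mu> + 1) / 2) (cos \<theta>) *
         gegenbauer_norm (nat (int j + (\<mu> - \<nu>) div 2)) (of_int (\<nu> + 1) / 2) (cos \<phi>))"
      using K[OF AB0] unfolding htrans_def profile_def z X Y l k g by (simp only: mult.assoc)
    then show ?thesis using fint unfolding integrable_lpos_iff integral_lpos_eq
      by (simp only: of_real_mult mult.assoc)
  qed
  then show ?thesis unfolding Let_def by (intro exI[of _ "c * of_real (2 * 4 ^ N * K)"] allI impI) blast
qed

end
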